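(* Let $k\ge 3$, $n$ and $z\ge 1$ be integers, let $\mathbb{H}$ be the set of all $k$-uniform unicyclic hypergraphs of order $n$ with matching number $\alpha(G)= z$, and let $\rho^{*}_{max}=\max\{\rho(G): G\in\mathbb{H}\}$. Let $G\in\mathbb{H}$ with $\rho(G)=\rho^{*}_{max}$, and let $m=n/(k-1)$ be the number of edges of $G$. Then $m\ge z+1$, and: (1) if $m=z+1$, then $G\cong \mathscr{U}(n,k;0;0,z-1;0,0)$; (2) if $m\ge z+2$ and $1\le z\le 2$, then $G\cong \mathscr{U}(n,k;z-1;0,0;0,0)$; (3) if $m\ge z+2$ and $3\le z\le k$, then $G\cong \mathscr{U}(n,k;1;z-2,0;0,0)$; (4) if $m\ge z+2$ and $k+1\le z\le 2k-2$, then $G\cong \mathscr{U}(n,k;1;k-2,z-k;0,0)$; (5) if $m\ge z+2$ and $2k-1\le z\le m-2-\lceil\frac{m-2k}{k-1}\rceil$, then $G\cong \mathscr{U}(n,k;1;k-2,k-2;t,w)$, where $t=\lfloor\frac{z-2k+2}{k-1}\rfloor$ and $w=z-2k+2-\lfloor\frac{z-2k+2}{k-1}\rfloor(k-1)$.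
   Context: Hypergraphs are simple (no repeated edges); a hypergraph is $k$-uniform if every edge is a $k$-subset of the vertex set. The degree of a vertex is the number of edges containing it. A path of length $q$ is an alternating sequence $v_1e_1v_2\cdots v_qe_qv_{q+1}$ of distinct vertices and distinct edges with $v_i,v_{i+1}\in e_i$; a cycle of length $q$ is $v_1e_1v_2\cdots v_qe_qv_1$ with distinct vertices $v_1,\dots,v_q$, distinct edges and $v_i,v_{i+1}\in e_i$ (indices mod $q$). A connected $k$-uniform hypergraph with $n$ vertices and $m$ edges is unicyclic if $n-1=(k-1)m-1$ (equivalently it is connected and has exactly one cycle); thus $m=n/(k-1)$. A matching is a set of pairwise disjoint edges; $\alpha(G)$ is the maximum size of a matching. The adjacency tensor $\mathcal{A}(G)$ of a $k$-uniform hypergraph on vertex set $[n]$ is the order-$k$, dimension-$n$ tensor with $\mathcal{A}_{i_1\cdots i_k}=\frac{1}{(k-1)!}$ if $\{i_1,\dots,i_k\}$ is an edge and $0$ otherwise; $\lambda\in\mathbb{C}$ is an eigenvalue if $\mathcal{A}X^{k-1}=\lambda X^{[k-1]}$ for some nonzero $X\in\mathbb{C}^n$, where $(\mathcal{A}X^{k-1})_i=\sum_{i_2,\dots,i_k}\mathcal{A}_{ii_2\cdots i_k}x_{i_2}\cdots x_{i_k}$ and $X^{[k-1]}=(x_1^{k-1},\dots,x_n^{k-1})$; the spectral radius $\rho(G)$ is the maximum modulus of the eigenvalues. Attaching a pendant edge to a vertex $v$ means adding a new edge consisting of $v$ and $k-1$ new vertices. The hypergraph $\mathscr{U}(n,k;f;r,s;t,w)$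 (with $f\le 1$, $r,s,w\le k-2$, all parameters nonnegative integers) is the $k$-uniform unicyclic hypergraph of order $n$ (with $m=n/(k-1)$ edges) obtained from a 2-cycle $v_1e_1v_2e_2v_1$ (two $k$-edges $e_1,e_2$ with $e_1\cap e_2=\{v_1,v_2\}$) by: (1) attaching $f$ pendant edges to $v_2$; (2) attaching one pendant edge to each of $r$ vertices of $e_1\setminus\{v_1,v_2\}$; (3) attaching one pendant edge to each of $s$ vertices of $e_2\setminus\{v_1,v_2\}$; (4) adding $t$ new edges each containing $v_1$ and $k-1$ new vertices, and attaching exactly one pendant edge to each of these $k-1$ vertices of each such edge; (5) adding $\lceil w/(k-1)\rceil$ further new edges (one if $w\ge1$, none if $w=0$) containing $v_1$ and $k-1$ new vertices, with exactly one pendant edge attached to each vertex of a $w$-subset of its vertices other than $v_1$; (6) attaching $m-f-r-s-t-t(k-1)-w-\lceil\frac{w}{k-1}\rceil-2$ pendant edges to $v_1$. *)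

theory Defs
  imports Complex_Main
begin

section \<open>Uniform hypergraphs\<close>

record 'a hypergraph =
  verts :: "'a set"
  edges :: "'a set set"

definition uniform_hypergraph :: "nat \<Rightarrow> 'a hypergraph \<Rightarrow> bool" where
  "uniform_hypergraph k G \<longleftrightarrow>
     finite (verts G) \<and> (\<forall>e\<in>edges G. e \<subseteq> verts G \<and> card e = k)"

definition is_path :: "'a hypergraph \<Rightarrow> 'a list \<Rightarrow> 'a set list \<Rightarrow> bool" where
  "is_path G vs es \<longleftrightarrow>
     length vs = Suc (length es) \<and> set vs \<subseteq> verts G \<and> set es \<subseteq> edges G \<and>
     distinct vs \<and> distinct es \<and>
     (\<forall>i<length es. vs ! i \<in> es ! i \<and> vs ! Suc i \<in> es ! i)"

definition connected_hypergraph :: "'a hypergraph \<Rightarrow> bool" where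
  "connected_hypergraph G \<longleftrightarrow>
     verts G \<noteq> {} \<and>
     (\<forall>u\<in>verts G. \<forall>v\<in>verts G. \<exists>vs es. is_path G vs es \<and> hd vs = u \<and> last vs = v)"

definition unicyclic :: "nat \<Rightarrow> 'a hypergraph \<Rightarrow> bool" where
  "unicyclic k G \<longleftrightarrow>
     uniform_hypergraph k G \<and> connected_hypergraph G \<and>
     int (card (verts G)) - 1 = (int k - 1) * int (card (edges G)) - 1"

definition matching :: "'a hypergraph \<Rightarrow> 'a set set \<Rightarrow> bool" where
  "matching G M \<longleftrightarrow> M \<subseteq> edges G \<and> pairwise disjnt M"

definition matching_number :: "'a hypergraph \<Rightarrow> nat" where
  "matching_number G = Max (card ` {M. matching G M})"

definition hypergraph_iso :: "'a hypergraph \<Rightarrow> 'b hypergraph \<Rightarrow> bool" where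
  "hypergraph_iso G H \<longleftrightarrow>
     (\<exists>\<phi>. bij_betw \<phi> (verts G) (verts H) \<and> (`) \<phi> ` edges G = edges H)"

section \<open>Adjacency tensor and spectral radius\<close>

text \<open>A tensor of order \<open>k\<close> over the index set \<open>V\<close> is a function on the index lists of
  length \<open>k\<close> with entries in \<open>V\<close>.\<close>

definition adjacency_tensor :: "nat \<Rightarrow> 'a hypergraph \<Rightarrow> 'a list \<Rightarrow> complex" where
  "adjacency_tensor k G is =
     (if length is = k \<and> set is \<in> edges G then 1 / fact (k - 1) else 0)"

definition tensor_apply ::
    "nat \<Rightarrow> 'a set \<Rightarrow> ('a list \<Rightarrow> complex) \<Rightarrow> ('a \<Rightarrow> complex) \<Rightarrow> 'a \<Rightarrow> complex" where
  "tensor_apply k V A X i =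
     (\<Sum>js\<in>{js. length js = k - 1 \<and> set js \<subseteq> V}. A (i # js) * prod_list (map X js))"

definition tensor_eigenvalue ::
    "nat \<Rightarrow> 'a set \<Rightarrow> ('a list \<Rightarrow> complex) \<Rightarrow> complex \<Rightarrow> bool" where
  "tensor_eigenvalue k V A \<mu> \<longleftrightarrow>
     (\<exists>X. (\<exists>i\<in>V. X i \<noteq> 0) \<and> (\<forall>i\<in>V. tensor_apply k V A X i = \<mu> * X i ^ (k - 1)))"

text \<open>For finite nonempty \<open>V\<close> the set of eigenvalues is compact (normalise the eigenvectors),
  and for \<open>k \<ge> 3\<close> it contains \<open>0\<close> (unit vectors are eigenvectors); so the supremum below is the
  maximum modulus of the eigenvalues.\<close>

definition spectral_radius :: "nat \<Rightarrow> 'a hypergraph \<Rightarrow> real" where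
  "spectral_radius k G =
     Sup (cmod ` {\<mu>. tensor_eigenvalue k (verts G) (adjacency_tensor k G) \<mu>})"

section \<open>The hypergraphs \<open>U(n,k;f;r,s;t,w)\<close>\<close>

text \<open>\<open>V1\<close> and \<open>V2\<close> are the vertices of the 2-cycle, \<open>InE1 i\<close> and \<open>InE2 i\<close> (\<open>i < k - 2\<close>) the
  remaining vertices of its edges \<open>e\<^sub>1\<close> and \<open>e\<^sub>2\<close>, and \<open>New v j i\<close> (\<open>i < k - 1\<close>) are the new
  vertices of the \<open>j\<close>-th edge attached to \<open>v\<close>.\<close>

datatype uvertex = V1 | V2 | InE1 nat | InE2 nat | New uvertex nat nat

definition new_edge :: "nat \<Rightarrow> uvertex \<Rightarrow> nat \<Rightarrow> uvertex set" where
  "new_edge k v j = insert v (New v j ` {..<k - 1})"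

text \<open>The edges attached to \<open>V1\<close> are numbered consecutively: first the \<open>t\<close> edges all of whose
  new vertices carry a pendant edge, then the \<open>c\<close> edges (\<open>c = 1\<close> if \<open>1 \<le> w \<le> k - 2\<close>, and \<open>c = 0\<close>
  if \<open>w = 0\<close>) with \<open>w\<close> such vertices, then the \<open>p\<close> pendant edges that bring the number of edges
  to \<open>m\<close>. The parameters are meant to satisfy \<open>f \<le> 1\<close>, \<open>r, s, w \<le> k - 2\<close> and to make the
  subtraction defining \<open>p\<close> exact.\<close>

definition U_edges :: "nat \<Rightarrow> nat \<Rightarrow> nat \<Rightarrow> nat \<Rightarrow> nat \<Rightarrow> nat \<Rightarrow> nat \<Rightarrow> uvertex set set" where
  "U_edges n k f r s t w =
     (let m = n div (k - 1);
          c = nat \<lceil>real w / real (k - 1)\<rceil>;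
          p = m - (f + r + s + t + t * (k - 1) + w + c + 2)
      in {{V1, V2} \<union> InE1 ` {..<k - 2}, {V1, V2} \<union> InE2 ` {..<k - 2}}
         \<union> {new_edge k V2 j | j. j < f}
         \<union> {new_edge k (InE1 i) 0 | i. i < r}
         \<union> {new_edge k (InE2 i) 0 | i. i < s}
         \<union> {new_edge k V1 j | j. j < t}
         \<union> {new_edge k (New V1 j i) 0 | j i. j < t \<and> i < k - 1}
         \<union> {new_edge k V1 j | j. t \<le> j \<and> j < t + c}
         \<union> {new_edge k (New V1 t i) 0 | i. i < w}
         \<union> {new_edge k V1 j | j. t + c \<le> j \<and> j < t + c + p})"

definition U_hypergraph ::
    "nat \<Rightarrow> nat \<Rightarrow> nat \<Rightarrow> nat \<Rightarrow> nat \<Rightarrow> nat \<Rightarrow> nat \<Rightarrow> uvertex hypergraph" where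
  "U_hypergraph n k f r s t w =
     \<lparr>verts = \<Union> (U_edges n k f r s t w), edges = U_edges n k f r s t w\<rparr>"

end

theory Submission
  imports Defs "HOL-Analysis.Analysis" "HOL-Combinatorics.Multiset_Permutations"
begin

text \<open>The spectral radius is the maximum of \<open>k \<Sum>\<^sub>e \<Prod>\<^sub>v\<^sub>\<in>\<^sub>e x\<^sub>v\<close> over nonnegative \<open>x\<close> with
  \<open>\<Sum> x\<^sub>v\<^sup>k = 1\<close>, attained at a positive eigenvector. Hence no rearrangement of the edges of an
  extremal hypergraph that keeps the matching number can increase this form at its Perron vector.
  Moving edges to a vertex \<open>r\<close> of maximum weight shows that all edges contain \<open>r\<close>, except for a matching
  \<open>K\<close> of \<open>z - 1\<close> edges that avoids \<open>r\<close>. Counting vertices, the cycle is either a 2-cycle through \<open>r\<close>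
  with all edges of \<open>K\<close> pendant, or it uses an edge of \<open>K\<close>; the latter is not extremal.

  In the remaining case the eigenvalue equations collapse, with \<open>a = 1 / \<rho>\<^sup>k\<close> and \<open>c = 1 / sqrt (1 - a)\<close>,
  to \<open>a ((c^i + c^j)\<^sup>2 + (\<Sum>b. c^(2 l b))) = 1\<close>, where \<open>i\<close>, \<open>j\<close> and \<open>l b\<close> count the vertices carrying an
  edge of \<open>K\<close> in the two edges of the cycle and in the other edges \<open>b\<close> at \<open>r\<close>. The spectral radius is
  maximal when the bracket is, and by convexity this determines where the edges of \<open>K\<close> are attached.\<close>

section \<open>Perron vectors of the adjacency tensor\<close>


text \<open>Rearranging edges gives only weak inequalities for the form. Strictness comes from the
  case of equality: the Perron vector of \<open>G\<close> would then solve the eigenvalue equations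
  of the new hypergraph too, and these fail at a vertex that keeps its edges and gains one.

  When an edge of \<open>K\<close> meets a single edge at \<open>r\<close> twice, characteristic
  equations are compared instead. If only two edges contain \<open>r\<close>, the two sides
  coincide; this case is not excluded but recentred, since the hypergraph is then already a 2-cycle
  with pendant edges around another vertex.

  Origin of \<open>c\<close>: a pendant edge at \<open>u\<close> contributes the share
  \<open>a\<close> of the load of \<open>u\<close>, so it multiplies the load from the other edges
  by \<open>1 / (1 - a) = c^2\<close>. The square in the bracket arises because both edges of the
  cycle share two vertices, which makes the equations for their products quadratic.

  As \<open>c\<close> depends on \<rho>, the bracket of a competitor is evaluated at the
  \<open>c\<close> of \<open>G\<close>; if it exceeds \<open>1 / a\<close> there, the competitor has
  the larger spectral radius. The admissible competitors are those in which some edge at the centre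
  carries no edge of \<open>K\<close>, for this preserves the matching number.\<close>

definition load :: "'a set set \<Rightarrow> ('a \<Rightarrow> real) \<Rightarrow> 'a \<Rightarrow> real" where
  "load E x v = (\<Sum>e | e \<in> E \<and> v \<in> e. prod x e)"

definition edge_sum :: "'a set set \<Rightarrow> ('a \<Rightarrow> real) \<Rightarrow> real" where
  "edge_sum E x = (\<Sum>e\<in>E. prod x e)"

lemma uniform_finite:
  assumes "uniform_hypergraph k G"
  shows "finite (verts G)" "finite (edges G)" "e \<in> edges G \<Longrightarrow> finite e"
    "e \<in> edges G \<Longrightarrow> e \<subseteq> verts G" "e \<in> edges G \<Longrightarrow> card e = k"
proof -
  have "edges G \<subseteq> Pow (verts G)" "finite (verts G)"
    using assms by (auto simp: uniform_hypergraph_def)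
  then show "finite (verts G)" "finite (edges G)" "e \<in> edges G \<Longrightarrow> finite e"
    "e \<in> edges G \<Longrightarrow> e \<subseteq> verts G"
    by (auto intro: finite_subset)
  show "e \<in> edges G \<Longrightarrow> card e = k"
    using assms by (auto simp: uniform_hypergraph_def)
qed

text \<open>An edge \<open>e\<close> through \<open>i\<close> is hit by exactly the
  \<open>(k - 1)!\<close> orderings of \<open>e - {i}\<close>, which cancels the normalisation of
  the tensor.\<close>

lemma tensor_apply_adjacency:
  assumes "uniform_hypergraph k G" "k \<ge> 1" "i \<in> verts G"
  shows "tensor_apply k (verts G) (adjacency_tensor k G) X i =
    (\<Sum>e | e \<in> edges G \<and> i \<in> e. prod X (e - {i}))"
proof -
  let ?S = "{js. length js = k - 1 \<and> set js \<subseteq> verts G}"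
  let ?E = "{e. e \<in> edges G \<and> i \<in> e}"
  let ?c = "1 / fact (k - 1) :: complex"
  have fS: "finite ?S"
    using finite_lists_length_eq[of "verts G" "k - 1"] uniform_finite(1)[OF assms(1)]
    by (simp add: conj_commute)
  have fE: "finite ?E"
    using uniform_finite(2)[OF assms(1)] by simp
  have "tensor_apply k (verts G) (adjacency_tensor k G) X i =
      (\<Sum>js\<in>?S. \<Sum>e\<in>?E. if insert i (set js) = e then ?c * prod_list (map X js) else 0)"
    unfolding tensor_apply_def
  proof (rule sum.cong[OF refl])
    fix js assume "js \<in> ?S"
    then have len: "length (i # js) = k"
      using assms(2) by auto
    have "(\<Sum>e\<in>?E. if insert i (set js) = e then ?c * prod_list (map X js) else 0) =
        (if insert i (set js) \<in> ?E then ?c * prod_list (map X js) else 0)"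
      using fE by (simp add: sum.delta')
    then show "adjacency_tensor k G (i # js) * prod_list (map X js) =
        (\<Sum>e\<in>?E. if insert i (set js) = e then ?c * prod_list (map X js) else 0)"
      using len by (simp add: adjacency_tensor_def)
  qed
  also have "\<dots> = (\<Sum>e\<in>?E. \<Sum>js\<in>?S. if insert i (set js) = e then ?c * prod_list (map X js) else 0)"
    by (rule sum.swap)
  also have "\<dots> = (\<Sum>e\<in>?E. prod X (e - {i}))"
  proof (rule sum.cong[OF refl])
    fix e assume e: "e \<in> ?E"
    then have ce: "card e = k" "finite e" "e \<subseteq> verts G" "i \<in> e"
      using uniform_finite[OF assms(1)] by auto
    have ce': "card (e - {i}) = k - 1"
      using ce by simp
    \<comment> \<open>A list of \<open>k - 1\<close> entries that together with \<open>i\<close>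
      fills a \<open>k\<close>-set can neither repeat an entry nor contain \<open>i\<close>.\<close>
    have set_eq: "{js \<in> ?S. insert i (set js) = e} = permutations_of_set (e - {i})"
    proof (intro equalityI subsetI)
      fix js assume js: "js \<in> {js \<in> ?S. insert i (set js) = e}"
      have le: "card (set js) \<le> k - 1"
        using js card_length[of js] by auto
      have "i \<notin> set js"
      proof
        assume "i \<in> set js"
        then have "set js = e" using js by auto
        then show False using le ce assms(2) by auto
      qed
      then have s: "set js = e - {i}" using js by auto
      then have "card (set js) = length js" using ce' js by auto
      then show "js \<in> permutations_of_set (e - {i})"
        using s by (auto simp: permutations_of_set_def card_distinct)
    next
      fix js assume js: "js \<in> permutations_of_set (e - {i})"
      then have "set js = e - {i}" "distinct js" by (auto simp: permutations_of_set_def)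
      then show "js \<in> {js \<in> ?S. insert i (set js) = e}"
        using ce ce' distinct_card[of js] by auto
    qed
    have "(\<Sum>js\<in>?S. if insert i (set js) = e then ?c * prod_list (map X js) else 0) =
       (\<Sum>js\<in>{js \<in> ?S. insert i (set js) = e}. ?c * prod_list (map X js))"
      using fS by (rule sum.inter_filter[symmetric])
    also have "\<dots> = (\<Sum>js\<in>permutations_of_set (e - {i}). ?c * prod X (e - {i}))"
      unfolding set_eq
      by (intro sum.cong refl)
        (auto simp: permutations_of_set_def prod.distinct_set_conv_list[symmetric])
    also have "\<dots> = prod X (e - {i})"
      using ce ce' by simp
    finally show "(\<Sum>js\<in>?S. if insert i (set js) = e then ?c * prod_list (map X js) else 0) =
      prod X (e - {i})" .
  qed
  finally show ?thesis .
qed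

text \<open>Each edge product is counted once at each of its \<open>k\<close> vertices. Summing the
  eigenvalue equations over all vertices therefore gives the value of the form.\<close>

lemma handshake:
  assumes "uniform_hypergraph k G"
  shows "(\<Sum>v\<in>verts G. load (edges G) x v) = real k * edge_sum (edges G) x"
proof -
  note u = uniform_finite[OF assms]
  have "(\<Sum>v\<in>verts G. load (edges G) x v) =
      (\<Sum>v\<in>verts G. \<Sum>e\<in>edges G. if v \<in> e then prod x e else 0)"
    unfolding load_def using u(2) by (simp add: sum.inter_filter)
  also have "\<dots> = (\<Sum>e\<in>edges G. \<Sum>v\<in>verts G. if v \<in> e then prod x e else 0)"
    by (rule sum.swap)
  also have "\<dots> = (\<Sum>e\<in>edges G. real k * prod x e)"
  proof (rule sum.cong[OF refl])
    fix e assume e: "e \<in> edges G"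
    have "(\<Sum>v\<in>verts G. if v \<in> e then prod x e else 0) = (\<Sum>v\<in>{v \<in> verts G. v \<in> e}. prod x e)"
      using u(1) by (rule sum.inter_filter[symmetric])
    also have "{v \<in> verts G. v \<in> e} = e" using u(4)[OF e] by auto
    finally show "(\<Sum>v\<in>verts G. if v \<in> e then prod x e else 0) = real k * prod x e"
      using u(5)[OF e] by simp
  qed
  finally show ?thesis by (simp add: edge_sum_def sum_distrib_left)
qed

text \<open>Vectors are total functions on the vertex type, which may be infinite. Pinning the
  coordinates outside \<open>V\<close> to 0 gives a product of compact sets, compact by Tychonoff's
  theorem.\<close>

lemma compact_cube:
  fixes V :: "'a set"
  shows "compact {x :: 'a \<Rightarrow> real. \<forall>i. x i \<in> (if i \<in> V then {0..1} else {0})}"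
proof -
  have "compactin (product_topology (\<lambda>i. euclidean) UNIV)
     (PiE UNIV (\<lambda>i. if i \<in> V then {0..1} else {0::real}))"
    by (subst compactin_PiE) auto
  then show ?thesis
    unfolding euclidean_product_topology by (simp add: PiE_def Pi_def cong del: if_weak_cong)
qed

text \<open>Both sides of the last inequality are homogeneous of degree \<open>k\<close>. It
  suffices to maximise over the compact set of nonnegative vectors of \<open>k\<close>-norm 1 and to
  rescale all others.\<close>

lemma weight_maximiser:
  assumes "uniform_hypergraph k G" "k \<ge> 1" "verts G \<noteq> {}"
  obtains L x where "\<forall>v\<in>verts G. x v \<ge> 0" "(\<Sum>v\<in>verts G. x v ^ k) = 1"
    "real k * edge_sum (edges G) x = L"
    "\<And>y. \<forall>v\<in>verts G. y v \<ge> 0 \<Longrightarrow> real k * edge_sum (edges G) y \<le> L * (\<Sum>v\<in>verts G. y v ^ k)"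
proof -
  let ?V = "verts G"
  note u = uniform_finite[OF assms(1)]
  define S where "S = {x :: 'a \<Rightarrow> real. \<forall>i. x i \<in> (if i \<in> ?V then {0..1} else {0})}
     \<inter> {x. (\<Sum>v\<in>?V. x v ^ k) = 1}"
  have cont: "continuous_on UNIV (\<lambda>x :: 'a \<Rightarrow> real. x v)" for v
    by (rule continuous_on_product_coordinates)
  have "closed {x :: 'a \<Rightarrow> real. (\<Sum>v\<in>?V. x v ^ k) = 1}"
    by (intro closed_Collect_eq continuous_intros cont)
  then have compS: "compact S"
    unfolding S_def by (intro compact_Int_closed compact_cube)
  obtain v0 where v0: "v0 \<in> ?V" using assms(3) by auto
  have "(\<lambda>v. if v = v0 then 1 else 0) \<in> S"
    using v0 u(1) assms(2) by (auto simp: S_def power_0_left if_distrib[of "\<lambda>a. a ^ k"] cong: if_cong)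
  then have neS: "S \<noteq> {}" by auto
  have contT: "continuous_on S (\<lambda>x. real k * edge_sum (edges G) x)"
    unfolding edge_sum_def
    by (intro continuous_intros continuous_on_subset[OF cont]) auto
  obtain x where x: "x \<in> S" and
    max: "\<And>y. y \<in> S \<Longrightarrow> real k * edge_sum (edges G) y \<le> real k * edge_sum (edges G) x"
    using continuous_attains_sup[OF compS neS contT] by auto
  show ?thesis
  proof (rule that[of x "real k * edge_sum (edges G) x"])
    show "\<forall>v\<in>?V. x v \<ge> 0" "(\<Sum>v\<in>?V. x v ^ k) = 1"
      using x by (auto simp: S_def split: if_splits)
  next
    fix y :: "'a \<Rightarrow> real" assume y: "\<forall>v\<in>?V. y v \<ge> 0"
    let ?s = "\<Sum>v\<in>?V. y v ^ k"
    show "real k * edge_sum (edges G) y \<le> real k * edge_sum (edges G) x * ?s"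
    proof (cases "?s = 0")
      case True
      then have "\<forall>v\<in>?V. y v ^ k = 0"
        using y u(1) by (subst (asm) sum_nonneg_eq_0_iff) auto
      then have y0: "\<forall>v\<in>?V. y v = 0" by auto
      have "prod y e = 0" if "e \<in> edges G" for e
      proof -
        have "e \<noteq> {}" using u(5)[OF that] assms(2) by auto
        then show ?thesis using y0 u(3,4)[OF that] by (subst prod_zero_iff) auto
      qed
      then have "edge_sum (edges G) y = 0" by (simp add: edge_sum_def)
      then show ?thesis using True by simp
    next
      case False
      have s: "?s > 0"
        using False y by (simp add: sum_nonneg order_less_le)
      \<comment> \<open>Division by the \<open>k\<close>-norm moves \<open>y\<close> onto the
        compact set.\<close>
      define c where "c = root k ?s"
      have c: "c > 0" "c ^ k = ?s" using s assms(2) by (auto simp: c_def)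
      define z where "z = (\<lambda>v. if v \<in> ?V then y v / c else 0)"
      have zsum: "(\<Sum>v\<in>?V. z v ^ k) = 1"
      proof -
        have "(\<Sum>v\<in>?V. z v ^ k) = (\<Sum>v\<in>?V. y v ^ k / c ^ k)"
          by (intro sum.cong) (auto simp: z_def power_divide)
        also have "\<dots> = 1" using c s by (simp add: sum_divide_distrib[symmetric])
        finally show ?thesis .
      qed
      have z0: "z v \<ge> 0" for v using y c by (auto simp: z_def)
      have "z v \<le> 1" for v
      proof (cases "v \<in> ?V")
        case True
        have "z v ^ k \<le> (\<Sum>v\<in>?V. z v ^ k)"
          using True u(1) z0 by (intro member_le_sum) auto
        then show ?thesis using zsum z0 assms(2)
          by (metis not_le one_less_power[of "z v" k] less_le_trans zero_less_one less_eq_Suc_le One_nat_def)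
      qed (simp add: z_def)
      then have "z \<in> S" using zsum z0 by (auto simp: S_def) (auto simp: z_def)
      then have mz: "real k * edge_sum (edges G) z \<le> real k * edge_sum (edges G) x" by (rule max)
      have "edge_sum (edges G) z = edge_sum (edges G) y / c ^ k"
      proof -
        have "prod z e = prod y e / c ^ k" if "e \<in> edges G" for e
        proof -
          have "prod z e = prod (\<lambda>v. y v / c) e"
            using u(4)[OF that] by (intro prod.cong) (auto simp: z_def)
          then show ?thesis using u(5)[OF that] by (simp add: prod_dividef)
        qed
        then show ?thesis by (simp add: edge_sum_def sum_divide_distrib)
      qed
      then have "real k * edge_sum (edges G) y = real k * edge_sum (edges G) z * ?s"
        using c s by simp
      also have "\<dots> \<le> real k * edge_sum (edges G) x * ?s"
        using mz s by (intro mult_right_mono) auto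
      finally show ?thesis .
    qed
  qed auto
qed

text \<open>Multiplying the eigenvalue equation at \<open>v\<close> by \<open>x v\<close> completes
  the products over \<open>e - {v}\<close> to full edge products. These no longer depend on
  \<open>v\<close>, so they can be compared between vertices and summed.\<close>

lemma load_alt:
  assumes "uniform_hypergraph k G"
  shows "load (edges G) x v = x v * (\<Sum>e | e \<in> edges G \<and> v \<in> e. prod x (e - {v}))"
proof -
  have "prod x e = x v * prod x (e - {v})" if "e \<in> edges G" "v \<in> e" for e
    using uniform_finite(3)[OF assms that(1)] that(2) by (rule prod.remove)
  then show ?thesis unfolding load_def sum_distrib_left by (intro sum.cong) auto
qed

text \<open>The form is affine in each single coordinate. Varying only \<open>x v\<close> gives a
  function \<open>F\<close> of one variable that is nonpositive for nonnegative arguments and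
  vanishes at \<open>x v\<close>; as \<open>x v > 0\<close>, this is an interior maximum and the
  derivative is zero.\<close>

lemma first_order_condition:
  assumes G: "uniform_hypergraph k G" and k: "k \<ge> 2"
    and bound: "\<And>y. \<forall>v\<in>verts G. y v \<ge> 0 \<Longrightarrow>
      real k * edge_sum (edges G) y \<le> L * (\<Sum>v\<in>verts G. y v ^ k)"
    and x: "\<forall>v\<in>verts G. x v > 0"
    and eq: "real k * edge_sum (edges G) x = L * (\<Sum>v\<in>verts G. x v ^ k)"
    and v: "v \<in> verts G"
  shows "load (edges G) x v = L * x v ^ k"
proof -
  note u = uniform_finite[OF G]
  define a where "a = (\<Sum>e | e \<in> edges G \<and> v \<in> e. prod x (e - {v}))"
  define b where "b = (\<Sum>e | e \<in> edges G \<and> v \<notin> e. prod x e)"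
  define d where "d = (\<Sum>u\<in>verts G - {v}. x u ^ k)"
  have tot: "edge_sum (edges G) (x(v := t)) = a * t + b" for t
  proof -
    have "edge_sum (edges G) (x(v := t)) = (\<Sum>e\<in>{e. e \<in> edges G \<and> v \<in> e} \<union> {e. e \<in> edges G \<and> v \<notin> e}. prod (x(v := t)) e)"
      unfolding edge_sum_def by (intro sum.cong) auto
    also have "\<dots> = (\<Sum>e | e \<in> edges G \<and> v \<in> e. prod (x(v := t)) e) + (\<Sum>e | e \<in> edges G \<and> v \<notin> e. prod (x(v := t)) e)"
      using u(2) by (intro sum.union_disjoint) auto
    also have "(\<Sum>e | e \<in> edges G \<and> v \<in> e. prod (x(v := t)) e) = (\<Sum>e | e \<in> edges G \<and> v \<in> e. prod x (e - {v}) * t)"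
    proof (intro sum.cong refl)
      fix e assume e: "e \<in> {e. e \<in> edges G \<and> v \<in> e}"
      then have "prod (x(v := t)) e = t * prod (x(v := t)) (e - {v})"
        using u(3) by (subst prod.remove[of e v]) auto
      also have "prod (x(v := t)) (e - {v}) = prod x (e - {v})"
        by (intro prod.cong) auto
      finally show "prod (x(v := t)) e = prod x (e - {v}) * t" by simp
    qed
    also have "(\<Sum>e | e \<in> edges G \<and> v \<notin> e. prod (x(v := t)) e) = b"
      unfolding b_def by (intro sum.cong prod.cong refl) auto
    finally show ?thesis unfolding a_def sum_distrib_right .
  qed
  have pw: "(\<Sum>u\<in>verts G. (x(v := t)) u ^ k) = t ^ k + d" for t
  proof -
    have "(\<Sum>u\<in>verts G. (x(v := t)) u ^ k) = t ^ k + (\<Sum>u\<in>verts G - {v}. (x(v := t)) u ^ k)"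
      using u(1) v by (subst sum.remove[of _ v]) auto
    also have "(\<Sum>u\<in>verts G - {v}. (x(v := t)) u ^ k) = d"
      unfolding d_def by (intro sum.cong) auto
    finally show ?thesis .
  qed
  define F where "F = (\<lambda>t. real k * (a * t + b) - L * (t ^ k + d))"
  have F0: "F t \<le> 0" if "t \<ge> 0" for t
    using bound[of "x(v := t)"] that x unfolding F_def tot pw by (force simp: less_imp_le)
  have Fx: "F (x v) = 0"
    using eq tot[of "x v"] pw[of "x v"] by (simp add: F_def)
  have der: "DERIV F (x v) :> real k * a - L * (real k * x v ^ (k - 1))"
    unfolding F_def by (auto intro!: derivative_eq_intros)
  have "real k * a - L * (real k * x v ^ (k - 1)) = 0"
  proof (rule DERIV_local_max[OF der])
    show "0 < x v" using x v by auto
    show "\<forall>y. \<bar>x v - y\<bar> < x v \<longrightarrow> F y \<le> F (x v)"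
      using F0 Fx by auto
  qed
  then have "a = L * x v ^ (k - 1)" using k by (simp add: algebra_simps)
  moreover have "x v ^ k = x v * x v ^ (k - 1)"
    using k by (metis power_eq_if zero_neq_numeral le_zero_eq)
  ultimately show ?thesis using load_alt[OF G, of x v] by (simp add: a_def)
qed

section \<open>Connectivity and positivity of the maximiser\<close>

lemma list_crossing:
  assumes "vs \<noteq> []" "hd vs \<in> Z" "last vs \<notin> Z"
  shows "\<exists>i. Suc i < length vs \<and> vs ! i \<in> Z \<and> vs ! Suc i \<notin> Z"
  using assms
proof (induction vs)
  case (Cons a vs)
  show ?case
  proof (cases "vs = []")
    case False
    show ?thesis
    proof (cases "hd vs \<in> Z")
      case True
      then obtain i where "Suc i < length vs \<and> vs ! i \<in> Z \<and> vs ! Suc i \<notin> Z"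
        using Cons False by auto
      then show ?thesis by (intro exI[of _ "Suc i"]) auto
    next
      case hd: False
      then show ?thesis using Cons False by (intro exI[of _ 0]) (auto simp: hd_conv_nth)
    qed
  qed (use Cons in auto)
qed simp

lemma connected_crossing_edge:
  assumes "connected_hypergraph G" "u \<in> verts G" "u \<in> Z" "v \<in> verts G" "v \<notin> Z"
  obtains e a b where "e \<in> edges G" "a \<in> e" "a \<in> Z" "b \<in> e" "b \<notin> Z"
proof -
  obtain vs es where p: "is_path G vs es" "hd vs = u" "last vs = v"
    using assms unfolding connected_hypergraph_def by meson
  then have "vs \<noteq> []" by (auto simp: is_path_def)
  then obtain i where i: "Suc i < length vs" "vs ! i \<in> Z" "vs ! Suc i \<notin> Z"
    using list_crossing[of vs Z] p assms by auto
  then have "i < length es" using p by (auto simp: is_path_def)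
  then have "es ! i \<in> edges G" "vs ! i \<in> es ! i" "vs ! Suc i \<in> es ! i"
    using p by (auto simp: is_path_def)
  then show ?thesis using that i by auto
qed

text \<open>With \<open>y i = |X i|\<close> the triangle inequality turns the eigenvalue equation
  into \<open>|\<mu>| * y i ^ k \<le> load (edges G) y i\<close>. Summing over the vertices and
  inserting the bound on the form leaves \<open>|\<mu>| \<le> L\<close>.\<close>

lemma eigenvalue_bound:
  assumes G: "uniform_hypergraph k G" and k: "k \<ge> 2"
    and bound: "\<And>y. \<forall>v\<in>verts G. y v \<ge> 0 \<Longrightarrow>
      real k * edge_sum (edges G) y \<le> L * (\<Sum>v\<in>verts G. y v ^ k)"
    and ev: "tensor_eigenvalue k (verts G) (adjacency_tensor k G) \<mu>"
  shows "cmod \<mu> \<le> L"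
proof -
  note u = uniform_finite[OF G]
  obtain X where X: "\<exists>i\<in>verts G. X i \<noteq> 0"
    "\<forall>i\<in>verts G. tensor_apply k (verts G) (adjacency_tensor k G) X i = \<mu> * X i ^ (k - 1)"
    using ev by (auto simp: tensor_eigenvalue_def)
  define y where "y = (\<lambda>i. cmod (X i))"
  have "cmod \<mu> * y i ^ k \<le> load (edges G) y i" if i: "i \<in> verts G" for i
  proof -
    have "cmod \<mu> * y i ^ (k - 1) = cmod (\<Sum>e | e \<in> edges G \<and> i \<in> e. prod X (e - {i}))"
      using arg_cong[of _ _ cmod, OF X(2)[rule_format, OF i]] tensor_apply_adjacency[OF G _ i, of X] k
      by (simp add: y_def norm_mult norm_power)
    also have "\<dots> \<le> (\<Sum>e | e \<in> edges G \<and> i \<in> e. prod y (e - {i}))"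
      unfolding y_def by (rule order_trans[OF norm_sum]) (simp add: prod_norm)
    finally have "cmod \<mu> * y i ^ (k - 1) * y i \<le> (\<Sum>e | e \<in> edges G \<and> i \<in> e. prod y (e - {i})) * y i"
      by (rule mult_right_mono) (simp add: y_def)
    moreover have "y i ^ k = y i ^ (k - 1) * y i"
      using k by (metis power_eq_if zero_neq_numeral le_zero_eq mult.commute)
    ultimately show ?thesis by (simp add: load_alt[OF G] algebra_simps)
  qed
  then have "(\<Sum>i\<in>verts G. cmod \<mu> * y i ^ k) \<le> (\<Sum>i\<in>verts G. load (edges G) y i)"
    by (rule sum_mono)
  then have le: "cmod \<mu> * (\<Sum>i\<in>verts G. y i ^ k) \<le> L * (\<Sum>i\<in>verts G. y i ^ k)"
    using bound[of y] handshake[OF G, of y] by (simp add: sum_distrib_left y_def)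
  obtain i where i: "i \<in> verts G" "X i \<noteq> 0" using X by auto
  have "0 < y i ^ k" using i by (simp add: y_def)
  also have "\<dots> \<le> (\<Sum>i\<in>verts G. y i ^ k)"
    using u(1) i by (intro member_le_sum) (auto simp: y_def)
  finally show ?thesis using le by simp
qed

text \<open>If the maximiser had zeros, connectivity would give an edge meeting the zero set
  \<open>Z\<close> and its complement. Raising the vector to \<open>eps\<close> on \<open>Z\<close>
  gains at least order \<open>eps^(k-1)\<close> in the form but adds only order \<open>eps^k\<close>
  to the power sum. So the maximiser is positive and an eigenvector; its value \<open>L\<close> is
  an eigenvalue, and no eigenvalue has larger modulus.\<close>

lemma perron_frobenius:
  assumes G: "uniform_hypergraph k G" "connected_hypergraph G" and k: "k \<ge> 2"
  shows "(\<exists>x. (\<forall>v\<in>verts G. x v > 0) \<and> (\<forall>v\<in>verts G. load (edges G) x v = spectral_radius k G * x v ^ k))"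
    and "\<And>y. \<forall>v\<in>verts G. y v \<ge> 0 \<Longrightarrow>
      real k * edge_sum (edges G) y \<le> spectral_radius k G * (\<Sum>v\<in>verts G. y v ^ k)"
proof -
  let ?V = "verts G"
  note u = uniform_finite[OF G(1)]
  have ne: "?V \<noteq> {}" using G(2) by (auto simp: connected_hypergraph_def)
  obtain L x where x0: "\<forall>v\<in>?V. x v \<ge> 0" and xs: "(\<Sum>v\<in>?V. x v ^ k) = 1"
    and xL: "real k * edge_sum (edges G) x = L"
    and bound: "\<And>y. \<forall>v\<in>?V. y v \<ge> 0 \<Longrightarrow> real k * edge_sum (edges G) y \<le> L * (\<Sum>v\<in>?V. y v ^ k)"
    using weight_maximiser[OF G(1) _ ne] k by (metis le_trans one_le_numeral)
  have tot0: "edge_sum (edges G) y \<ge> 0" if "\<forall>v\<in>?V. y v \<ge> 0" for y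
    using that u(4) unfolding edge_sum_def by (intro sum_nonneg prod_nonneg) auto
  have L0: "L \<ge> 0" using tot0[OF x0] xL by auto
  define Z where "Z = {v \<in> ?V. x v = 0}"
  have Z: "Z = {}"
  proof (rule ccontr)
    assume "Z \<noteq> {}"
    then obtain a0 where a0: "a0 \<in> Z" by auto
    have "\<exists>b0\<in>?V. b0 \<notin> Z"
    proof (rule ccontr)
      assume "\<not> ?thesis"
      then have "(\<Sum>v\<in>?V. x v ^ k) = 0" using k by (intro sum.neutral) (auto simp: Z_def)
      then show False using xs by simp
    qed
    then obtain b0 where b0: "b0 \<in> ?V" "b0 \<notin> Z" by auto
    obtain e a b where e: "e \<in> edges G" "a \<in> e" "a \<in> Z" "b \<in> e" "b \<notin> Z"
      using connected_crossing_edge[OF G(2), of a0 Z b0] a0 b0 by (auto simp: Z_def)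
    define c where "c = prod x (e - Z)"
    have c: "c > 0"
      unfolding c_def using x0 u(4)[OF e(1)] by (intro prod_pos) (force simp: Z_def order_less_le)
    \<comment> \<open>\<open>N\<close> and \<open>eps\<close> are chosen so that the cost
      \<open>L * card Z * eps^k\<close> stays below the gain \<open>k * c * eps^(k-1)\<close>; the
      added 1 makes this strict and keeps \<open>N\<close> positive even for
      \<open>L = 0\<close>.\<close>
    define N where "N = L * real (card Z) + 1"
    have N: "N > 0" using L0 by (simp add: N_def add_nonneg_pos)
    define eps where "eps = min 1 (real k * c / N)"
    have kc: "real k * c > 0" using c k by simp
    have eps: "0 < eps" "eps \<le> 1" "eps * N \<le> real k * c"
      using kc N by (auto simp: eps_def min_def field_simps)
    define y where "y = (\<lambda>v. if v \<in> Z then eps else x v)"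
    have y0: "\<forall>v\<in>?V. y v \<ge> 0" and yx: "\<And>v. v \<in> ?V \<Longrightarrow> x v \<le> y v"
      using x0 eps by (auto simp: y_def Z_def)
    have xe: "prod x e = 0"
      using e u(3) by (subst prod_zero_iff) (auto simp: Z_def)
    have fe: "finite e" using e u by auto
    have ye: "prod y e \<ge> eps ^ (k - 1) * c"
    proof -
      have "prod y e = prod y (e \<inter> Z) * prod y (e - Z)"
        by (rule prod.Int_Diff[OF fe])
      also have "prod y (e \<inter> Z) = eps ^ card (e \<inter> Z)"
        by (simp add: y_def)
      also have "prod y (e - Z) = c"
        unfolding c_def by (intro prod.cong) (auto simp: y_def)
      finally have eq: "prod y e = eps ^ card (e \<inter> Z) * c" .
      have "card (e \<inter> Z) < card e"
        using e fe by (intro psubset_card_mono) auto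
      then have "card (e \<inter> Z) \<le> k - 1" using u(5) e by auto
      then have "eps ^ (k - 1) \<le> eps ^ card (e \<inter> Z)"
        using eps by (intro power_decreasing) auto
      then show ?thesis unfolding eq using c by (intro mult_right_mono) auto
    qed
    have "edge_sum (edges G) x + eps ^ (k - 1) * c \<le> edge_sum (edges G) y"
    proof -
      have "edge_sum (edges G) x = (\<Sum>e\<in>edges G - {e}. prod x e)"
        unfolding edge_sum_def using u(2) e xe by (subst sum.remove[of _ e]) auto
      also have "\<dots> \<le> (\<Sum>e\<in>edges G - {e}. prod y e)"
        using u(4) x0 yx by (intro sum_mono prod_mono) auto
      finally have "edge_sum (edges G) x + eps ^ (k - 1) * c \<le> (\<Sum>e\<in>edges G - {e}. prod y e) + prod y e"
        using ye by simp
      also have "\<dots> = edge_sum (edges G) y"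
        unfolding edge_sum_def using u(2) e by (subst (2) sum.remove[of _ e]) auto
      finally show ?thesis .
    qed
    then have "real k * (edge_sum (edges G) x + eps ^ (k - 1) * c) \<le> real k * edge_sum (edges G) y"
      by (rule mult_left_mono) simp
    also have "\<dots> \<le> L * (\<Sum>v\<in>?V. y v ^ k)" by (rule bound[OF y0])
    also have "(\<Sum>v\<in>?V. y v ^ k) = 1 + real (card Z) * eps ^ k"
    proof -
      have ZV: "Z \<subseteq> ?V" by (auto simp: Z_def)
      have "(\<Sum>v\<in>?V. y v ^ k) = (\<Sum>v\<in>?V - Z. y v ^ k) + (\<Sum>v\<in>Z. y v ^ k)"
        using ZV u(1) by (rule sum.subset_diff)
      also have "(\<Sum>v\<in>Z. y v ^ k) = real (card Z) * eps ^ k" by (simp add: y_def)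
      also have "(\<Sum>v\<in>?V - Z. y v ^ k) = (\<Sum>v\<in>?V - Z. x v ^ k)"
        by (intro sum.cong) (auto simp: y_def)
      also have "\<dots> = (\<Sum>v\<in>?V - Z. x v ^ k) + (\<Sum>v\<in>Z. x v ^ k)"
        using k by (simp add: Z_def)
      also have "\<dots> = 1" using sum.subset_diff[OF ZV u(1), of "\<lambda>v. x v ^ k"] xs by simp
      finally show ?thesis .
    qed
    finally have "real k * eps ^ (k - 1) * c \<le> L * real (card Z) * eps ^ k"
      using xL by (simp add: algebra_simps)
    also have "eps ^ k = eps ^ (k - 1) * eps"
      using k by (metis power_eq_if zero_neq_numeral le_zero_eq mult.commute)
    finally have "eps ^ (k - 1) * (real k * c) \<le> eps ^ (k - 1) * (L * real (card Z) * eps)"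
      by (simp add: algebra_simps)
    then have "real k * c \<le> L * real (card Z) * eps" using eps by simp
    also have "\<dots> < eps * N" using eps by (simp add: N_def algebra_simps)
    finally show False using eps by simp
  qed
  have xp: "\<forall>v\<in>?V. x v > 0" using Z x0 by (force simp: Z_def order_less_le)
  have eig: "\<forall>v\<in>?V. load (edges G) x v = L * x v ^ k"
    using first_order_condition[OF G(1) k bound xp] xL xs by auto
  have evL: "tensor_eigenvalue k ?V (adjacency_tensor k G) (complex_of_real L)"
    unfolding tensor_eigenvalue_def
  proof (intro exI[of _ "\<lambda>v. complex_of_real (x v)"] conjI ballI)
    show "\<exists>i\<in>?V. complex_of_real (x i) \<noteq> 0" using ne xp by force
    fix i assume i: "i \<in> ?V"
    have "x i * (\<Sum>e | e \<in> edges G \<and> i \<in> e. prod x (e - {i})) = x i * (L * x i ^ (k - 1))"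
    proof -
      have "x i ^ k = x i * x i ^ (k - 1)"
        using k by (metis power_eq_if zero_neq_numeral le_zero_eq)
      then show ?thesis using eig i by (simp add: load_alt[OF G(1)])
    qed
    then have "(\<Sum>e | e \<in> edges G \<and> i \<in> e. prod x (e - {i})) = L * x i ^ (k - 1)"
      using xp i by auto
    then have "complex_of_real (\<Sum>e | e \<in> edges G \<and> i \<in> e. prod x (e - {i})) = complex_of_real (L * x i ^ (k - 1))"
      by simp
    then show "tensor_apply k ?V (adjacency_tensor k G) (\<lambda>v. complex_of_real (x v)) i
        = complex_of_real L * complex_of_real (x i) ^ (k - 1)"
      using tensor_apply_adjacency[OF G(1) _ i] k by simp
  qed
  have "spectral_radius k G = L"
    unfolding spectral_radius_def
  proof (rule cSup_eq_maximum)
    show "L \<in> cmod ` {\<mu>. tensor_eigenvalue k ?V (adjacency_tensor k G) \<mu>}"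
      using evL L0 by (intro image_eqI[of _ _ "complex_of_real L"]) auto
    show "\<And>r. r \<in> cmod ` {\<mu>. tensor_eigenvalue k ?V (adjacency_tensor k G) \<mu>} \<Longrightarrow> r \<le> L"
      using eigenvalue_bound[OF G(1) k bound] by auto
  qed
  then show "\<exists>x. (\<forall>v\<in>?V. x v > 0) \<and> (\<forall>v\<in>?V. load (edges G) x v = spectral_radius k G * x v ^ k)"
    and "\<And>y. \<forall>v\<in>?V. y v \<ge> 0 \<Longrightarrow>
      real k * edge_sum (edges G) y \<le> spectral_radius k G * (\<Sum>v\<in>?V. y v ^ k)"
    using xp eig bound by auto
qed

section \<open>Connectivity and isomorphism invariance\<close>


lemma perron_vector:
  assumes "uniform_hypergraph k G" "connected_hypergraph G" "k \<ge> 2"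
  obtains x where "\<forall>v\<in>verts G. x v > 0"
    "\<forall>v\<in>verts G. load (edges G) x v = spectral_radius k G * x v ^ k"
  using perron_frobenius(1)[OF assms] by auto

text \<open>A positive vector attaining the bound is a maximiser and hence an eigenvector. This is
  applied to the Perron vector of a different hypergraph on the same vertices.\<close>

lemma perron_equality:
  assumes G: "uniform_hypergraph k G" "connected_hypergraph G" and k: "k \<ge> 2"
    and x: "\<forall>v\<in>verts G. x v > 0"
    and eq: "real k * edge_sum (edges G) x = spectral_radius k G * (\<Sum>v\<in>verts G. x v ^ k)"
    and v: "v \<in> verts G"
  shows "load (edges G) x v = spectral_radius k G * x v ^ k"
  using first_order_condition[OF G(1) k perron_frobenius(2)[OF G k] x eq v] by auto

text \<open>Appending \<open>e\<close> may repeat a vertex or an edge, which \<open>is_path\<close>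
  forbids. If \<open>v\<close> already lies on the path, the path is cut there; if \<open>e\<close>
  was already used, it is cut in front of \<open>e\<close>, and \<open>e\<close> then leads to
  \<open>v\<close>.\<close>

lemma path_extend:
  assumes p: "is_path G vs es" and e: "e \<in> edges G" "e \<subseteq> verts G" "last vs \<in> e" "v \<in> e"
  shows "\<exists>vs' es'. is_path G vs' es' \<and> hd vs' = hd vs \<and> last vs' = v"
proof -
  have len: "length vs = Suc (length es)" "distinct vs" "distinct es" "set vs \<subseteq> verts G" "set es \<subseteq> edges G"
    and inc: "\<And>i. i < length es \<Longrightarrow> vs ! i \<in> es ! i \<and> vs ! Suc i \<in> es ! i"
    using p by (auto simp: is_path_def)
  have ne: "vs \<noteq> []" using len by auto
  consider "v \<in> set vs" | "v \<notin> set vs" "e \<in> set es" | "v \<notin> set vs" "e \<notin> set es" by blast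
  then show ?thesis
  proof cases
    case 1
    then obtain i where i: "i < length vs" "vs ! i = v" by (auto simp: in_set_conv_nth)
    have "is_path G (take (Suc i) vs) (take i es)"
      using len inc i set_take_subset[of "Suc i" vs] set_take_subset[of i es]
      by (auto simp: is_path_def)
    moreover have "hd (take (Suc i) vs) = hd vs" using ne by (cases vs) auto
    moreover have "last (take (Suc i) vs) = v"
      using i by (simp add: take_Suc_conv_app_nth)
    ultimately show ?thesis by blast
  next
    case 2
    then obtain i where i: "i < length es" "es ! i = e" by (auto simp: in_set_conv_nth)
    have nth: "(take (Suc i) vs @ [v]) ! j = (if j \<le> i then vs ! j else v)" if "j \<le> Suc i" for j
      using that i len by (auto simp: nth_append)
    have nthe: "(take i es @ [e]) ! j = es ! j" if "j \<le> i" for j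
      using that i len by (cases "j = i") (auto simp: nth_append)
    have "e \<notin> set (take i es)"
      using i len(3) by (auto simp: in_set_conv_nth nth_eq_iff_index_eq)
    then have "is_path G (take (Suc i) vs @ [v]) (take i es @ [e])"
      using len inc i 2 e set_take_subset[of "Suc i" vs] set_take_subset[of i es]
      unfolding is_path_def
      by (auto simp: nth nthe less_Suc_eq not_le)
    moreover have "hd (take (Suc i) vs @ [v]) = hd vs" using ne by (cases vs) auto
    ultimately show ?thesis by (metis last_snoc)
  next
    case 3
    have nth: "(vs @ [v]) ! j = (if j \<le> length es then vs ! j else v)" if "j \<le> Suc (length es)" for j
      using that len by (auto simp: nth_append)
    have nthe: "(es @ [e]) ! j = (if j < length es then es ! j else e)" if "j \<le> length es" for j
      using that by (auto simp: nth_append)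
    have lst: "vs ! length es \<in> e" using e(3) len ne by (simp add: last_conv_nth)
    have "is_path G (vs @ [v]) (es @ [e])"
      using len inc 3 e lst unfolding is_path_def
      by (auto simp: nth nthe less_Suc_eq)
    moreover have "hd (vs @ [v]) = hd vs" using ne by (cases vs) auto
    ultimately show ?thesis by (metis last_snoc)
  qed
qed

text \<open>Paths carry distinctness conditions; the reflexive transitive closure of this relation
  expresses reachability without them.\<close>

definition adj :: "'a set set \<Rightarrow> ('a \<times> 'a) set" where
  "adj E = {(u, v). \<exists>e\<in>E. u \<in> e \<and> v \<in> e}"

lemma adjI: "e \<in> E \<Longrightarrow> u \<in> e \<Longrightarrow> v \<in> e \<Longrightarrow> (u, v) \<in> adj E"
  by (auto simp: adj_def)

lemma adj_rtrancl_sym: "(u, v) \<in> (adj E)\<^sup>* \<Longrightarrow> (v, u) \<in> (adj E)\<^sup>*"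
proof -
  have "sym (adj E)" by (auto simp: adj_def sym_def)
  then show "(u, v) \<in> (adj E)\<^sup>* \<Longrightarrow> (v, u) \<in> (adj E)\<^sup>*" by (meson sym_rtrancl symD)
qed

text \<open>As \<open>adj\<close> is symmetric, reachability from one root is enough, and
  \<open>path_extend\<close> turns a chain of \<open>adj\<close> steps into a genuine path.\<close>

lemma connected_from_root:
  assumes sub: "\<forall>e\<in>edges G. e \<subseteq> verts G" and r: "r \<in> verts G"
    and reach: "\<And>v. v \<in> verts G \<Longrightarrow> (r, v) \<in> (adj (edges G))\<^sup>*"
  shows "connected_hypergraph G"
proof -
  have path: "\<exists>vs es. is_path G vs es \<and> hd vs = u \<and> last vs = v"
    if "(u, v) \<in> (adj (edges G))\<^sup>*" "u \<in> verts G" for u v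
    using that
  proof (induction rule: rtrancl_induct)
    case base
    have "is_path G [u] []" using base by (auto simp: is_path_def)
    then show ?case by (metis last.simps list.sel(1))
  next
    case (step w v)
    then obtain vs es where p: "is_path G vs es" "hd vs = u" "last vs = w" by auto
    obtain e where "e \<in> edges G" "w \<in> e" "v \<in> e" using step by (auto simp: adj_def)
    then show ?case using path_extend[OF p(1), of e v] sub p by auto
  qed
  show ?thesis
    unfolding connected_hypergraph_def
  proof (intro conjI ballI)
    show "verts G \<noteq> {}" using r by auto
    fix u v assume "u \<in> verts G" "v \<in> verts G"
    then have "(u, v) \<in> (adj (edges G))\<^sup>*"
      using reach adj_rtrancl_sym by (meson rtrancl_trans)
    then show "\<exists>vs es. is_path G vs es \<and> hd vs = u \<and> last vs = v"
      using path \<open>u \<in> verts G\<close> by auto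
  qed
qed

lemma connected_reach:
  assumes G: "connected_hypergraph G" "r \<in> verts G" "v \<in> verts G"
  shows "(r, v) \<in> (adj (edges G))\<^sup>*"
proof (rule ccontr)
  assume n: "\<not> ?thesis"
  let ?Z = "{v. (r, v) \<in> (adj (edges G))\<^sup>*}"
  obtain e a b where e: "e \<in> edges G" "a \<in> e" "a \<in> ?Z" "b \<in> e" "b \<notin> ?Z"
    using connected_crossing_edge[OF G(1), of r ?Z v] G n by blast
  then have "(a, b) \<in> adj (edges G)" by (intro adjI)
  then show False using e by (auto intro: rtrancl_into_rtrancl)
qed

text \<open>The parent edge of a vertex leads to a vertex that is strictly closer to \<open>r\<close>; the vertex of
  \<open>e\<close> closest to \<open>r\<close> therefore never has \<open>e\<close> as its parent edge.\<close>

lemma parent_edges: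
  assumes G: "uniform_hypergraph k G" "connected_hypergraph G" "r \<in> verts G" and k: "k \<ge> 1"
  obtains par p where
    "\<And>u. u \<in> verts G \<Longrightarrow> u \<noteq> r \<Longrightarrow> par u \<in> edges G \<and> u \<in> par u"
    "\<And>e. e \<in> edges G \<Longrightarrow> p e \<in> e \<and> (p e = r \<or> par (p e) \<noteq> e)"
proof -
  note u = uniform_finite[OF G(1)]
  define d where "d v = (LEAST j. (r, v) \<in> adj (edges G) ^^ j)" for v
  have dex: "(r, v) \<in> adj (edges G) ^^ d v" if "v \<in> verts G" for v
    unfolding d_def using connected_reach[OF G(2,3) that] by (auto simp: rtrancl_power intro: LeastI)
  have dle: "d v \<le> j" if "(r, v) \<in> adj (edges G) ^^ j" for v j
    unfolding d_def using that by (rule Least_le)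
  have ex: "\<exists>e. e \<in> edges G \<and> v \<in> e \<and> (\<exists>w\<in>e. d w < d v)" if v: "v \<in> verts G" "v \<noteq> r" for v
  proof -
    have "d v \<noteq> 0"
    proof
      assume "d v = 0"
      then show False using dex[OF v(1)] v(2) by auto
    qed
    then obtain j where j: "d v = Suc j" by (cases "d v") auto
    then obtain w where w: "(r, w) \<in> adj (edges G) ^^ j" "(w, v) \<in> adj (edges G)"
      using dex[OF v(1)] by auto
    then obtain e where "e \<in> edges G" "w \<in> e" "v \<in> e" by (auto simp: adj_def)
    moreover have "d w < d v" using dle[OF w(1)] j by simp
    ultimately show ?thesis by blast
  qed
  define par where "par v = (SOME e. e \<in> edges G \<and> v \<in> e \<and> (\<exists>w\<in>e. d w < d v))" for v
  have par: "par v \<in> edges G \<and> v \<in> par v \<and> (\<exists>w\<in>par v. d w < d v)" if "v \<in> verts G" "v \<noteq> r" for v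
    unfolding par_def using ex[OF that] by (rule someI_ex)
  define p where "p e = (ARG_MIN d v. v \<in> e)" for e
  have p: "p e \<in> e \<and> (\<forall>w\<in>e. d (p e) \<le> d w)" if e: "e \<in> edges G" for e
  proof -
    obtain v where "v \<in> e" using u(5)[OF e] k by (cases "e = {}") auto
    then show ?thesis unfolding p_def by (metis arg_min_natI arg_min_nat_le)
  qed
  show ?thesis
  proof (rule that[of par p])
    show "par v \<in> edges G \<and> v \<in> par v" if "v \<in> verts G" "v \<noteq> r" for v
      using par[OF that] by auto
    show "p e \<in> e \<and> (p e = r \<or> par (p e) \<noteq> e)" if e: "e \<in> edges G" for e
    proof -
      have "par (p e) \<noteq> e" if "p e \<noteq> r"
      proof
        assume "par (p e) = e"
        moreover have "p e \<in> verts G" using p[OF e] u(4)[OF e] by auto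
        ultimately show False using par[of "p e"] p[OF e] that by (metis not_le)
      qed
      then show ?thesis using p[OF e] by auto
    qed
  qed
qed

text \<open>Every vertex other than \<open>r\<close> lies in its parent edge \<open>e\<close>
  without being the vertex \<open>p e\<close>. The sets \<open>e - {p e}\<close>, of size
  \<open>k - 1\<close>, thus cover all vertices except \<open>r\<close>.\<close>

lemma connected_card_le:
  assumes G: "uniform_hypergraph k G" "connected_hypergraph G" and k: "k \<ge> 1"
  shows "card (verts G) \<le> (k - 1) * card (edges G) + 1"
proof -
  note u = uniform_finite[OF G(1)]
  obtain r where r: "r \<in> verts G" using G(2) by (auto simp: connected_hypergraph_def)
  obtain par p where par: "\<And>u. u \<in> verts G \<Longrightarrow> u \<noteq> r \<Longrightarrow> par u \<in> edges G \<and> u \<in> par u"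
    and p: "\<And>e. e \<in> edges G \<Longrightarrow> p e \<in> e \<and> (p e = r \<or> par (p e) \<noteq> e)"
    using parent_edges[OF G r k] by blast
  have "verts G - {r} \<subseteq> (\<Union>e\<in>edges G. e - {p e})"
  proof
    fix v assume v: "v \<in> verts G - {r}"
    then have "par v \<in> edges G" "v \<in> par v" using par by auto
    moreover have "v \<noteq> p (par v)" using p[of "par v"] v calculation by (metis DiffE singletonI)
    ultimately show "v \<in> (\<Union>e\<in>edges G. e - {p e})" by auto
  qed
  then have "card (verts G - {r}) \<le> card (\<Union>e\<in>edges G. e - {p e})"
    using u by (intro card_mono) auto
  also have "\<dots> \<le> (\<Sum>e\<in>edges G. card (e - {p e}))"
    by (rule card_UN_le[OF u(2)])
  also have "\<dots> = (\<Sum>e\<in>edges G. k - 1)"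
    using p u by (intro sum.cong) auto
  finally show ?thesis using r u(1) by (simp add: mult.commute)
qed

lemma unicyclic_card:
  "unicyclic k G \<Longrightarrow> k \<ge> 1 \<Longrightarrow> card (verts G) = (k - 1) * card (edges G)"
proof -
  assume a: "unicyclic k G" "k \<ge> 1"
  then have "int (card (verts G)) = (int k - 1) * int (card (edges G))"
    by (simp add: unicyclic_def)
  also have "\<dots> = int ((k - 1) * card (edges G))" using a(2) by (simp add: of_nat_diff)
  finally show ?thesis by linarith
qed

lemma unicyclicI:
  assumes "uniform_hypergraph k G" "connected_hypergraph G" "k \<ge> 1"
    "card (verts G) = (k - 1) * card (edges G)"
  shows "unicyclic k G"
  using assms by (simp add: unicyclic_def of_nat_diff)

text \<open>A vertex set that is too large for fewer than \<open>card E\<close> connecting edges forces the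
  transformation of the edges to be injective.\<close>

lemma unicyclic_transform:
  assumes G: "unicyclic k G" and k: "k \<ge> 3"
    and f: "\<And>e. e \<in> edges G \<Longrightarrow> f e \<subseteq> verts G \<and> card (f e) = k"
    and con: "connected_hypergraph \<lparr>verts = verts G, edges = f ` edges G\<rparr>"
  shows "unicyclic k \<lparr>verts = verts G, edges = f ` edges G\<rparr>" "inj_on f (edges G)"
proof -
  let ?H = "\<lparr>verts = verts G, edges = f ` edges G\<rparr>"
  have uG: "uniform_hypergraph k G" using G by (simp add: unicyclic_def)
  note u = uniform_finite[OF uG]
  have uH: "uniform_hypergraph k ?H" using u f by (auto simp: uniform_hypergraph_def)
  have n: "card (verts G) = (k - 1) * card (edges G)" using unicyclic_card[OF G] k by auto
  have "card (verts G) \<le> (k - 1) * card (f ` edges G) + 1"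
    using connected_card_le[OF uH con] k by auto
  then have "(k - 1) * card (edges G) < (k - 1) * (card (f ` edges G) + 1)"
    using n k unfolding distrib_left by linarith
  then have "card (edges G) \<le> card (f ` edges G)"
    by (metis mult_less_cancel1 less_Suc_eq_le Suc_eq_plus1)
  then have c: "card (f ` edges G) = card (edges G)"
    using card_image_le[OF u(2), of f] by auto
  then show "inj_on f (edges G)" using u(2) by (simp add: eq_card_imp_inj_on)
  show "unicyclic k ?H"
    using uH con c n k by (intro unicyclicI) auto
qed

section \<open>Invariance of the spectral radius under isomorphism\<close>

lemma sum_image_filter:
  assumes "inj_on f E"
  shows "(\<Sum>e | e \<in> f ` E \<and> P e. g e) = (\<Sum>e | e \<in> E \<and> P (f e). g (f e))"
proof -
  have "{e. e \<in> f ` E \<and> P e} = f ` {e \<in> E. P (f e)}" by auto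
  then show ?thesis using assms
    by (simp add: sum.reindex inj_on_subset[of f E])
qed

text \<open>An eigenvector of \<open>H\<close> composed with \<open>\<phi>\<close> is one of
  \<open>G\<close> for the same eigenvalue, since the edges through \<open>i\<close> correspond to
  the edges through \<open>\<phi> i\<close>.\<close>

lemma eigenvalue_iso:
  assumes G: "uniform_hypergraph k G" and k: "k \<ge> 1"
    and bij: "bij_betw \<phi> (verts G) (verts H)" and e: "(`) \<phi> ` edges G = edges H"
    and H: "uniform_hypergraph k H"
    and ev: "tensor_eigenvalue k (verts H) (adjacency_tensor k H) \<mu>"
  shows "tensor_eigenvalue k (verts G) (adjacency_tensor k G) \<mu>"
proof -
  note u = uniform_finite[OF G]
  have inj: "inj_on \<phi> (verts G)" and im: "\<phi> ` verts G = verts H"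
    using bij by (auto simp: bij_betw_def)
  obtain X where X: "\<exists>i\<in>verts H. X i \<noteq> 0"
    "\<forall>i\<in>verts H. tensor_apply k (verts H) (adjacency_tensor k H) X i = \<mu> * X i ^ (k - 1)"
    using ev by (auto simp: tensor_eigenvalue_def)
  show ?thesis
    unfolding tensor_eigenvalue_def
  proof (intro exI[of _ "X \<circ> \<phi>"] conjI ballI)
    show "\<exists>i\<in>verts G. (X \<circ> \<phi>) i \<noteq> 0" using X(1) unfolding im[symmetric] by auto
    fix i assume i: "i \<in> verts G"
    then have iH: "\<phi> i \<in> verts H" using im by auto
    have "inj_on ((`) \<phi>) (Pow (verts G))"
      by (rule inj_on_image_Pow[OF inj])
    then have injE: "inj_on ((`) \<phi>) (edges G)"
      using u(4) by (auto intro: inj_on_subset)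
    have mem: "\<phi> i \<in> \<phi> ` e \<longleftrightarrow> i \<in> e" if "e \<in> edges G" for e
      using inj i u(4)[OF that] by (auto simp: inj_on_def)
    have "(\<Sum>e | e \<in> edges H \<and> \<phi> i \<in> e. prod X (e - {\<phi> i})) =
        (\<Sum>e | e \<in> edges G \<and> \<phi> i \<in> \<phi> ` e. prod X (\<phi> ` e - {\<phi> i}))"
      unfolding e[symmetric] by (rule sum_image_filter[OF injE])
    also have "\<dots> = (\<Sum>e | e \<in> edges G \<and> i \<in> e. prod (X \<circ> \<phi>) (e - {i}))"
    proof (intro sum.cong)
      fix e assume e: "e \<in> {e. e \<in> edges G \<and> i \<in> e}"
      then have sub: "e \<subseteq> verts G" using u(4) by auto
      have "\<phi> ` e - {\<phi> i} = \<phi> ` (e - {i})"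
        using inj sub e by (auto simp: inj_on_def)
      moreover have "inj_on \<phi> (e - {i})" using inj sub by (auto intro: inj_on_subset)
      ultimately show "prod X (\<phi> ` e - {\<phi> i}) = prod (X \<circ> \<phi>) (e - {i})"
        by (simp add: prod.reindex)
    qed (use mem in auto)
    finally have "tensor_apply k (verts H) (adjacency_tensor k H) X (\<phi> i) =
      tensor_apply k (verts G) (adjacency_tensor k G) (X \<circ> \<phi>) i"
      using tensor_apply_adjacency[OF G k i] tensor_apply_adjacency[OF H k iH] by simp
    then show "tensor_apply k (verts G) (adjacency_tensor k G) (X \<circ> \<phi>) i = \<mu> * (X \<circ> \<phi>) i ^ (k - 1)"
      using X(2) iH by simp
  qed
qed

lemma spectral_radius_iso:
  assumes G: "uniform_hypergraph k G" and k: "k \<ge> 1"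
    and bij: "bij_betw \<phi> (verts G) (verts H)" and e: "(`) \<phi> ` edges G = edges H"
    and H: "uniform_hypergraph k H"
  shows "spectral_radius k G = spectral_radius k H"
proof -
  let ?\<psi> = "inv_into (verts G) \<phi>"
  have bij': "bij_betw ?\<psi> (verts H) (verts G)" using bij by (rule bij_betw_inv_into)
  have "?\<psi> ` \<phi> ` e = e" if "e \<in> edges G" for e
    using uniform_finite(4)[OF G that] bij by (metis bij_betw_def inv_into_image_cancel)
  then have e': "(`) ?\<psi> ` edges H = edges G"
    unfolding e[symmetric] image_image by simp
  have "{\<mu>. tensor_eigenvalue k (verts G) (adjacency_tensor k G) \<mu>} =
      {\<mu>. tensor_eigenvalue k (verts H) (adjacency_tensor k H) \<mu>}"
    using eigenvalue_iso[OF G k bij e H] eigenvalue_iso[OF H k bij' e' G] by blast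
  then show ?thesis by (simp add: spectral_radius_def)
qed

text \<open>Over an infinite vertex type the set \<open>HH\<close> may be infinite. Each member is
  isomorphic to a hypergraph on the fixed set \<open>V\<close>, and there are only finitely many of
  those, so the maximum in the theorem is a genuine one.\<close>

lemma finite_spectral_radii:
  assumes k: "k \<ge> 1" and V: "finite (V :: 'a set)"
    and HH: "\<And>H :: 'a hypergraph. H \<in> HH \<Longrightarrow> uniform_hypergraph k H \<and> card (verts H) = card V"
  shows "finite (spectral_radius k ` HH)"
proof (rule finite_subset)
  let ?F = "(\<lambda>E. spectral_radius k \<lparr>verts = V, edges = E\<rparr>) ` Pow (Pow V)"
  show "finite ?F" using V by simp
  show "spectral_radius k ` HH \<subseteq> ?F"
  proof
    fix r assume "r \<in> spectral_radius k ` HH"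
    then obtain H where H: "H \<in> HH" "r = spectral_radius k H" by auto
    then have uH: "uniform_hypergraph k H" and c: "card (verts H) = card V" using HH by auto
    note u = uniform_finite[OF uH]
    obtain \<phi> where b: "bij_betw \<phi> (verts H) V"
      using finite_same_card_bij[OF u(1) V c] by auto
    let ?E = "(`) \<phi> ` edges H"
    have sub: "?E \<subseteq> Pow V" using u(4) b by (auto simp: bij_betw_def)
    have "uniform_hypergraph k \<lparr>verts = V, edges = ?E\<rparr>"
      unfolding uniform_hypergraph_def
    proof (intro conjI ballI)
      fix e assume "e \<in> edges \<lparr>verts = V, edges = ?E\<rparr>"
      then obtain e' where e': "e' \<in> edges H" "e = \<phi> ` e'" by auto
      then show "e \<subseteq> verts \<lparr>verts = V, edges = ?E\<rparr>" using sub by auto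
      have "inj_on \<phi> e'" using b u(4)[OF e'(1)] by (auto simp: bij_betw_def intro: inj_on_subset)
      then show "card e = k" using e' u(5) by (simp add: card_image)
    qed (use V in auto)
    then have "r = spectral_radius k \<lparr>verts = V, edges = ?E\<rparr>"
      using spectral_radius_iso[OF uH k _ _ , of \<phi> "\<lparr>verts = V, edges = ?E\<rparr>"] b H(2) by simp
    then show "r \<in> ?F" using sub by blast
  qed
qed

section \<open>The star structure of an extremal hypergraph\<close>


lemma finite_matchings: "finite (edges G) \<Longrightarrow> finite {M. matching G M}"
  by (rule finite_subset[of _ "Pow (edges G)"]) (auto simp: matching_def)

lemma matching_number_eqI:
  assumes "finite (edges G)" "matching G M" "card M = z" "\<And>M'. matching G M' \<Longrightarrow> card M' \<le> z"
  shows "matching_number G = z"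
  unfolding matching_number_def
  using assms finite_matchings[OF assms(1)] by (intro Max_eqI) auto

lemma maximum_matching:
  assumes "finite (edges G)"
  obtains M where "matching G M" "card M = matching_number G"
    "\<And>M'. matching G M' \<Longrightarrow> card M' \<le> matching_number G"
proof -
  have "matching G {}" by (simp add: matching_def)
  then have "matching_number G \<in> card ` {M. matching G M}"
    unfolding matching_number_def using finite_matchings[OF assms] by (intro Max_in) auto
  moreover have "card M' \<le> matching_number G" if "matching G M'" for M'
    unfolding matching_number_def using finite_matchings[OF assms] that by (intro Max_ge) auto
  ultimately show ?thesis using that by auto
qed

text \<open>All edges in \<open>N\<close> contain the centre \<open>r\<close>, and the edges in \<open>K\<close> form a matching that avoids \<open>r\<close>
  and the edge \<open>g\<close>; hence \<open>K\<close> together with \<open>g\<close> is a maximum matching.\<close>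

locale star_core =
  fixes k :: nat and V :: "'a set" and N K :: "'a set set" and r :: 'a and g :: "'a set"
  assumes k3: "k \<ge> 3"
    and finV: "finite V"
    and uni: "\<And>e. e \<in> N \<union> K \<Longrightarrow> e \<subseteq> V \<and> card e = k"
    and cover: "V = \<Union>N \<union> \<Union>K"
    and rN: "\<And>e. e \<in> N \<Longrightarrow> r \<in> e"
    and rK: "\<And>h. h \<in> K \<Longrightarrow> r \<notin> h"
    and disjK: "pairwise disjnt K"
    and gN: "g \<in> N"
    and gK: "\<And>h. h \<in> K \<Longrightarrow> disjnt g h"
    and touch: "\<And>h. h \<in> K \<Longrightarrow> h \<inter> \<Union>N \<noteq> {}"
    and cardV: "card V = (k - 1) * card (N \<union> K)"
begin

abbreviation "hyp \<equiv> \<lparr>verts = V, edges = N \<union> K\<rparr>"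

lemma NK: "N \<inter> K = {}" using rN rK by auto

lemma finE: "finite N" "finite K"
proof -
  have "N \<union> K \<subseteq> Pow V" using uni by auto
  then have "finite (N \<union> K)" using finV by (meson finite_Pow_iff finite_subset)
  then show "finite N" "finite K" by auto
qed

lemma card_E: "card (N \<union> K) = card N + card K"
  using card_Un_disjoint[OF finE NK] .

lemma fin_edge: "e \<in> N \<union> K \<Longrightarrow> finite e"
  using uni finV by (meson finite_subset)

lemma rV: "r \<in> V" using rN[OF gN] uni gN by auto

lemma uniform: "uniform_hypergraph k hyp"
  using finV uni by (simp add: uniform_hypergraph_def)

lemma connected: "connected_hypergraph hyp"
proof (rule connected_from_root[where r = r])
  fix v assume "v \<in> verts hyp"
  then have v: "v \<in> V" by simp
  have N: "(r, u) \<in> adj (N \<union> K)" if "u \<in> \<Union>N" for u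
    using that rN by (auto intro: adjI)
  show "(r, v) \<in> (adj (edges hyp))\<^sup>*"
  proof (cases "v \<in> \<Union>N")
    case True
    then show ?thesis using N by auto
  next
    case False
    then obtain h where h: "h \<in> K" "v \<in> h" using v cover by auto
    then obtain u where u: "u \<in> h" "u \<in> \<Union>N" using touch by blast
    have "(u, v) \<in> adj (N \<union> K)" using h u by (auto intro: adjI)
    then show ?thesis using N[OF u(2)] by (auto intro: rtrancl_into_rtrancl)
  qed
qed (use uni rV in auto)

lemma unicyclic: "unicyclic k hyp"
  using unicyclicI[OF uniform connected] cardV k3 by simp

text \<open>Two edges of \<open>N\<close> meet in \<open>r\<close>, so no matching contains more
  than one of them.\<close>

lemma matching_number: "matching_number hyp = card K + 1"
proof (rule matching_number_eqI[where M = "insert g K"])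
  show "finite (edges hyp)" using finE by simp
  show "matching hyp (insert g K)"
    unfolding matching_def pairwise_insert
    using gN gK disjK by (auto simp: disjnt_sym)
  show "card (insert g K) = card K + 1"
    using finE gN NK by (subst card_insert_disjoint) auto
  fix M assume M: "matching hyp M"
  then have sub: "M \<subseteq> N \<union> K" and pw: "pairwise disjnt M" by (auto simp: matching_def)
  have fM: "finite M" using sub finE by (meson finite_UnI finite_subset)
  have "card (M \<inter> N) \<le> 1"
  proof -
    have "e = e'" if "e \<in> M \<inter> N" "e' \<in> M \<inter> N" for e e'
      using pw that rN by (metis IntE disjnt_iff pairwiseD)
    then show ?thesis using fM by (metis One_nat_def card_le_Suc0_iff_eq finite_Int)
  qed
  moreover have "card (M \<inter> K) \<le> card K" using finE by (intro card_mono) auto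
  moreover have "card M \<le> card (M \<inter> N) + card (M \<inter> K)"
  proof -
    have "M = (M \<inter> N) \<union> (M \<inter> K)" using sub by auto
    then show ?thesis by (metis card_Un_le)
  qed
  ultimately show "card M \<le> card K + 1" by linarith
qed

end

lemma prod_exchange:
  fixes x :: "'a \<Rightarrow> real"
  assumes "finite e" "p \<in> e" "q \<notin> e" "\<forall>v\<in>e. x v > 0" "x p \<le> x q"
  shows "prod x e \<le> prod x (insert q (e - {p}))"
proof -
  have "prod x e = x p * prod x (e - {p})" using assms by (intro prod.remove) auto
  also have "\<dots> \<le> x q * prod x (e - {p})"
    using assms by (intro mult_right_mono prod_nonneg) (auto simp: less_imp_le)
  also have "\<dots> = prod x (insert q (e - {p}))"
    using assms by (subst prod.insert) auto
  finally show ?thesis .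
qed

text \<open>Maximality is asked only against hypergraphs on the same vertex set, because every
  transformation below keeps the vertices and replaces edges.\<close>

locale extremal =
  fixes k z :: nat and G :: "'a hypergraph"
  assumes k3: "k \<ge> 3" and z1: "z \<ge> 1"
    and uniG: "unicyclic k G" and matG: "matching_number G = z"
    and maxG: "\<And>H. unicyclic k H \<Longrightarrow> verts H = verts G \<Longrightarrow> matching_number H = z \<Longrightarrow>
      spectral_radius k H \<le> spectral_radius k G"
begin

lemma unif: "uniform_hypergraph k G" and con: "connected_hypergraph G"
  using uniG by (auto simp: unicyclic_def)

lemmas fin = uniform_finite[OF unif]

lemma card_verts: "card (verts G) = (k - 1) * card (edges G)"
  using unicyclic_card[OF uniG] k3 by auto

text \<open>The Perron vector \<open>x\<close> of \<open>G\<close> shows that the new hypergraph has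
  at least the same spectral radius, and maximality gives equality. Then \<open>x\<close> is an
  eigenvector of the new hypergraph as well, so the load of \<open>v\<close> is the same in both.
  But \<open>v\<close> keeps its edges, with products that did not decrease, and gains
  \<open>f e0\<close>.\<close>

lemma no_improvement:
  assumes x: "\<forall>v\<in>verts G. x v > 0"
    and eig: "\<forall>v\<in>verts G. load (edges G) x v = spectral_radius k G * x v ^ k"
    and f: "\<And>e. e \<in> edges G \<Longrightarrow> f e \<subseteq> verts G \<and> card (f e) = k \<and> prod x e \<le> prod x (f e)"
    and con': "connected_hypergraph \<lparr>verts = verts G, edges = f ` edges G\<rparr>"
    and mat': "matching_number \<lparr>verts = verts G, edges = f ` edges G\<rparr> = z"
    and v: "v \<in> verts G" and keep: "\<And>e. e \<in> edges G \<Longrightarrow> v \<in> e \<Longrightarrow> v \<in> f e"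
    and e0: "e0 \<in> edges G" "v \<notin> e0" "v \<in> f e0"
  shows False
proof -
  let ?H = "\<lparr>verts = verts G, edges = f ` edges G\<rparr>"
  let ?\<rho> = "spectral_radius k G"
  have k2: "k \<ge> 2" using k3 by simp
  have uH: "unicyclic k ?H" and inj: "inj_on f (edges G)"
    using unicyclic_transform[OF uniG k3 _ con'] f by auto
  have unH: "uniform_hypergraph k ?H" using uH by (simp add: unicyclic_def)
  have le: "spectral_radius k ?H \<le> ?\<rho>" using maxG[OF uH] mat' by simp
  let ?s = "\<Sum>v\<in>verts G. x v ^ k"
  have s: "?s > 0" using x v fin(1) by (intro sum_pos) auto
  have PG: "real k * edge_sum (edges G) x = ?\<rho> * ?s"
    using handshake[OF unif, of x] eig by (simp add: sum_distrib_left)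
  have "edge_sum (f ` edges G) x = (\<Sum>e\<in>edges G. prod x (f e))"
    unfolding edge_sum_def using inj by (simp add: sum.reindex)
  then have ge: "edge_sum (edges G) x \<le> edge_sum (f ` edges G) x"
    using f by (simp add: edge_sum_def sum_mono)
  have PH: "real k * edge_sum (f ` edges G) x \<le> spectral_radius k ?H * ?s"
    using perron_frobenius(2)[OF unH con' k2, of x] x by (auto simp: less_imp_le)
  have "?\<rho> * ?s \<le> real k * edge_sum (f ` edges G) x"
    using ge PG by (metis mult_left_mono of_nat_0_le_iff)
  then have "?\<rho> * ?s \<le> spectral_radius k ?H * ?s" using PH by linarith
  then have "?\<rho> \<le> spectral_radius k ?H" using s by simp
  then have rr: "spectral_radius k ?H = ?\<rho>" using le by simp
  have "real k * edge_sum (f ` edges G) x = ?\<rho> * ?s"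
    using PH \<open>?\<rho> * ?s \<le> real k * edge_sum (f ` edges G) x\<close> rr by simp
  then have "load (f ` edges G) x v = ?\<rho> * x v ^ k"
    using perron_equality[OF unH con' k2, of x v] x v rr by simp
  then have eq: "load (f ` edges G) x v = load (edges G) x v" using eig v by simp
  have pos: "prod x (f e) > 0" if "e \<in> edges G" for e
    using x f[OF that] by (intro prod_pos) auto
  have "load (edges G) x v \<le> (\<Sum>e | e \<in> edges G \<and> v \<in> e. prod x (f e))"
    unfolding load_def using f by (intro sum_mono) auto
  also have "\<dots> < prod x (f e0) + \<dots>" using pos[OF e0(1)] by simp
  also have "\<dots> = (\<Sum>e\<in>insert e0 {e. e \<in> edges G \<and> v \<in> e}. prod x (f e))"
    using e0 fin(2) by (subst sum.insert) auto
  also have "\<dots> \<le> (\<Sum>e | e \<in> edges G \<and> v \<in> f e. prod x (f e))"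
    using e0 keep pos fin(2) by (intro sum_mono2) (auto simp: less_imp_le)
  also have "\<dots> = load (f ` edges G) x v"
    unfolding load_def by (rule sum_image_filter[OF inj, symmetric])
  finally show False using eq by simp
qed

lemma card_verts_ge: "card (verts G) \<ge> 2"
proof -
  have "verts G \<noteq> {}" using con by (auto simp: connected_hypergraph_def)
  then have "card (verts G) > 0" using fin(1) by (simp add: card_gt_0_iff)
  then have e: "card (edges G) > 0" using card_verts by (metis gr0I mult_0_right)
  have "(k - 1) * 1 \<le> (k - 1) * card (edges G)" using e by (intro mult_le_mono2) auto
  then show "card (verts G) \<ge> 2" using card_verts k3 by linarith
qed

lemma verts_cover: "verts G = \<Union>(edges G)"
proof
  show "\<Union>(edges G) \<subseteq> verts G" using fin(4) by auto
  show "verts G \<subseteq> \<Union>(edges G)"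
  proof
    fix v assume v: "v \<in> verts G"
    have "\<not> verts G \<subseteq> {v}" using card_verts_ge card_mono[of "{v}" "verts G"] by auto
    then obtain w where "w \<in> verts G" "w \<noteq> v" by auto
    then show "v \<in> \<Union>(edges G)"
      using connected_crossing_edge[OF con, of v "{v}" w] v by auto
  qed
qed

text \<open>Take for \<open>r\<close> a vertex of maximum Perron weight. Moving every edge outside \<open>K\<close> that avoids
  \<open>r\<close> to \<open>r\<close>, by exchanging its vertex closest to \<open>r\<close> for \<open>r\<close>, keeps the matching number and would
  increase the spectral radius.\<close>

lemma star_core_structure:
  obtains N K r g where "star_core k (verts G) N K r g" "edges G = N \<union> K" "card K + 1 = z"
proof -
  have k2: "k \<ge> 2" and k1: "k \<ge> 1" using k3 by auto
  obtain x where x: "\<forall>v\<in>verts G. x v > 0"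
    and eig: "\<forall>v\<in>verts G. load (edges G) x v = spectral_radius k G * x v ^ k"
    using perron_vector[OF unif con k2] by blast
  have Vne: "verts G \<noteq> {}" using card_verts_ge by auto
  obtain r where r: "r \<in> verts G" and rmax: "\<And>v. v \<in> verts G \<Longrightarrow> x v \<le> x r"
  proof -
    have "Max (x ` verts G) \<in> x ` verts G" using Vne fin(1) by (intro Max_in) auto
    then obtain r where "r \<in> verts G" "x r = Max (x ` verts G)" by auto
    then show ?thesis using that fin(1) by (metis Max_ge finite_imageI imageI)
  qed
  obtain M where M: "matching G M" "card M = z"
    using maximum_matching[OF fin(2)] matG by metis
  have Msub: "M \<subseteq> edges G" and Mdis: "pairwise disjnt M" using M by (auto simp: matching_def)
  have fM: "finite M" using Msub fin(2) by (rule finite_subset)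
  \<comment> \<open>If an edge of \<open>M\<close> contains \<open>r\<close>, it is taken as
    \<open>g\<close>; otherwise any edge will do. Either way the rest of \<open>M\<close> avoids
    \<open>r\<close>.\<close>
  have "\<exists>g\<in>M. \<forall>h\<in>M - {g}. r \<notin> h"
  proof (cases "\<exists>g\<in>M. r \<in> g")
    case True
    then obtain g where g: "g \<in> M" "r \<in> g" by auto
    have "r \<notin> h" if "h \<in> M - {g}" for h
      using Mdis g that by (metis DiffE disjnt_iff insertCI pairwiseD)
    then show ?thesis using g by auto
  next
    case False
    have "M \<noteq> {}" using M z1 by auto
    then show ?thesis using False by auto
  qed
  then obtain g where g: "g \<in> M" "\<And>h. h \<in> M - {g} \<Longrightarrow> r \<notin> h" by auto
  define K where "K = M - {g}"
  have cK: "card K + 1 = z" using M g fM z1 by (simp add: K_def)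
  have KE: "K \<subseteq> edges G" and gE: "g \<in> edges G" using Msub g by (auto simp: K_def)
  have Kdis: "pairwise disjnt K" using Mdis by (auto simp: K_def pairwise_def)
  have Kr: "\<And>h. h \<in> K \<Longrightarrow> r \<notin> h" using g by (auto simp: K_def)
  have Kg: "\<And>h. h \<in> K \<Longrightarrow> disjnt g h"
    using Mdis g by (auto simp: K_def pairwise_def)
  obtain par p where par: "\<And>u. u \<in> verts G \<Longrightarrow> u \<noteq> r \<Longrightarrow> par u \<in> edges G \<and> u \<in> par u"
    and p: "\<And>e. e \<in> edges G \<Longrightarrow> p e \<in> e \<and> (p e = r \<or> par (p e) \<noteq> e)"
    using parent_edges[OF unif con r k1] by blast
  define f where "f e = (if e \<in> K \<or> r \<in> e then e else insert r (e - {p e}))" for e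
  let ?H = "\<lparr>verts = verts G, edges = f ` edges G\<rparr>"
  have fprop: "f e \<subseteq> verts G \<and> card (f e) = k \<and> prod x e \<le> prod x (f e)" if e: "e \<in> edges G" for e
  proof (cases "e \<in> K \<or> r \<in> e")
    case True
    then show ?thesis using fin(4,5)[OF e] by (simp add: f_def)
  next
    case False
    have fe: "finite e" "card e = k" "e \<subseteq> verts G" "p e \<in> e" using fin e p by auto
    have "card (insert r (e - {p e})) = k"
      using fe False k3 by (subst card_insert_disjoint) auto
    moreover have "prod x e \<le> prod x (insert r (e - {p e}))"
      using fe False x rmax by (intro prod_exchange) auto
    ultimately show ?thesis using False fe r by (auto simp: f_def)
  qed
  have fr: "r \<in> f e" if "e \<notin> K" for e using that by (simp add: f_def)
  have fK: "f e = e" if "e \<in> K" for e using that by (simp add: f_def)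
  \<comment> \<open>Only \<open>p (par u)\<close> can be removed from \<open>par u\<close>, and
    \<open>u\<close> is never this vertex.\<close>
  have par_notin_p: "u \<in> f (par u)" if u: "u \<in> verts G" "u \<noteq> r" for u
  proof -
    have "u \<noteq> p (par u)" using par[OF u] p[of "par u"] u by metis
    then show ?thesis using par[OF u] by (auto simp: f_def)
  qed
  have near: "(r, u) \<in> adj (f ` edges G)" if "u \<in> verts G" "u \<noteq> r" "par u \<notin> K" for u
    using that par_notin_p fr par by (meson adjI imageI)
  have con': "connected_hypergraph ?H"
  proof (rule connected_from_root[where r = r])
    show "\<forall>e\<in>edges ?H. e \<subseteq> verts ?H" using fprop by auto
    show "r \<in> verts ?H" using r by simp
    fix v assume "v \<in> verts ?H"
    then have v: "v \<in> verts G" by simp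
    consider "v = r" | "v \<noteq> r" "par v \<notin> K" | "v \<noteq> r" "par v \<in> K" by blast
    then show "(r, v) \<in> (adj (edges ?H))\<^sup>*"
    proof cases
      case 2
      then show ?thesis using near v by auto
    next
      \<comment> \<open>A parent edge in \<open>K\<close> is not moved. Its vertex
        \<open>p ?e\<close> is not \<open>r\<close> and has a parent edge outside \<open>K\<close>,
        because distinct edges of \<open>K\<close> are disjoint; the image of that edge contains
        \<open>r\<close>.\<close>
      case 3
      let ?e = "par v"
      let ?w = "p ?e"
      have e: "?e \<in> edges G" "v \<in> ?e" using par v 3 by auto
      have w: "?w \<in> ?e" "?w = r \<or> par ?w \<noteq> ?e" using p[OF e(1)] by auto
      have wr: "?w \<noteq> r" using Kr[OF 3(2)] w(1) by metis
      have wV: "?w \<in> verts G" using w fin(4)[OF e(1)] by auto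
      have "par ?w \<notin> K"
      proof
        assume "par ?w \<in> K"
        then have "disjnt (par ?w) ?e" using Kdis 3 w wr by (auto simp: pairwise_def)
        then show False using w(1) par[OF wV wr] by (auto simp: disjnt_iff)
      qed
      then have "(r, ?w) \<in> adj (f ` edges G)" using near wV wr by auto
      moreover have "(?w, v) \<in> adj (f ` edges G)"
        using e w fK[OF 3(2)] by (intro adjI[of ?e]) (auto simp: image_iff intro!: bexI[of _ ?e])
      ultimately show ?thesis by (auto intro: rtrancl_into_rtrancl)
    qed simp
  qed
  have gf: "disjnt (f g) h" if "h \<in> K" for h
    using Kg[OF that] Kr[OF that] by (auto simp: f_def disjnt_iff)
  have mat': "matching_number ?H = z"
  proof (rule matching_number_eqI[where M = "insert (f g) K"])
    show "finite (edges ?H)" using fin(2) by simp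
    have "K \<subseteq> f ` edges G" using fK KE by (force simp: image_iff)
    then show "matching ?H (insert (f g) K)"
      unfolding matching_def pairwise_insert using gE gf Kdis by (auto simp: disjnt_sym)
    have gK: "g \<notin> K" by (simp add: K_def)
    have "f g \<notin> K" using fr[OF gK] Kr by auto
    then show "card (insert (f g) K) = z"
      using cK fM by (simp add: K_def)
    fix M' assume M': "matching ?H M'"
    then have sub: "M' \<subseteq> f ` edges G" and pw: "pairwise disjnt M'" by (auto simp: matching_def)
    have fM': "finite M'" using sub fin(2) by (meson finite_imageI finite_subset)
    have rr: "r \<in> e" if eM: "e \<in> M' - K" for e
    proof -
      obtain e' where "e' \<in> edges G" "e = f e'" using sub eM by auto
      then show ?thesis using fr[of e'] fK[of e'] eM by (cases "e' \<in> K") auto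
    qed
    have "card (M' - K) \<le> 1"
    proof -
      have "e = e'" if "e \<in> M' - K" "e' \<in> M' - K" for e e'
        using pw that rr by (metis DiffE disjnt_iff pairwiseD)
      then show ?thesis using fM' by (metis One_nat_def card_le_Suc0_iff_eq finite_Diff)
    qed
    moreover have "card (M' \<inter> K) \<le> card K" using fM by (intro card_mono) (auto simp: K_def)
    moreover have "card M' \<le> card (M' - K) + card (M' \<inter> K)"
      by (metis Int_Diff_Un card_Un_le add.commute)
    ultimately show "card M' \<le> z" using cK by linarith
  qed
  have all_r: "r \<in> e" if e: "e \<in> edges G" "e \<notin> K" for e
  proof (rule ccontr)
    assume "r \<notin> e"
    then show False
      using no_improvement[OF x eig fprop con' mat' r, of e] e fr by (auto simp: f_def)
  qed
  have core: "star_core k (verts G) (edges G - K) K r g"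
  proof
    show "g \<in> edges G - K" using gE by (auto simp: K_def)
    show "verts G = \<Union>(edges G - K) \<union> \<Union>K" using verts_cover KE by auto
    show "card (verts G) = (k - 1) * card (edges G - K \<union> K)"
      using card_verts KE by (simp add: Un_absorb2)
    show "h \<inter> \<Union>(edges G - K) \<noteq> {}" if h: "h \<in> K" for h
    proof -
      have hE: "h \<in> edges G" using h KE by auto
      obtain u where u: "u \<in> h" using fin(5)[OF hE] k3 by (cases "h = {}") auto
      then have uV: "u \<in> verts G" using fin(4)[OF hE] by auto
      obtain e a b where e: "e \<in> edges G" "a \<in> e" "a \<in> h" "b \<in> e" "b \<notin> h"
        using connected_crossing_edge[OF con uV u r Kr[OF h]] by blast
      have "e \<notin> K"
      proof
        assume "e \<in> K"
        moreover have "e \<noteq> h" using e by auto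
        ultimately have "disjnt e h" using Kdis h by (auto simp: pairwise_def)
        then show False using e by (auto simp: disjnt_iff)
      qed
      then show ?thesis using e by auto
    qed
  qed (use k3 fin KE all_r Kr Kdis Kg in auto)
  show ?thesis
    using that[OF core _ cK] KE by auto
qed

end

section \<open>Position of the cycle\<close>


text \<open>The situation in which the cycle is \<open>r e1 v2 e2 r\<close> and every edge of
  \<open>K\<close> hangs as a pendant edge on the edges at \<open>r\<close>.\<close>

locale twin_star = star_core +
  fixes v2 :: 'a and e1 e2 :: "'a set"
  assumes e1N: "e1 \<in> N" and e2N: "e2 \<in> N" and e12: "e1 \<noteq> e2"
    and v2e: "v2 \<in> e1" "v2 \<in> e2" and v2r: "v2 \<noteq> r"
    and overlap: "\<And>v e e'. e \<in> N \<Longrightarrow> e' \<in> N \<Longrightarrow> v \<in> e \<Longrightarrow> v \<in> e' \<Longrightarrow> v \<noteq> r \<Longrightarrow> e \<noteq> e' \<Longrightarrow>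
      v = v2 \<and> {e, e'} = {e1, e2}"
    and single: "\<And>h. h \<in> K \<Longrightarrow> card (h \<inter> \<Union>N) = 1"

lemma sum_minus_one:
  fixes f :: "'b \<Rightarrow> nat"
  assumes "\<And>i. i \<in> I \<Longrightarrow> f i \<ge> 1"
  shows "sum f I = (\<Sum>i\<in>I. f i - 1) + card I"
proof -
  have "sum f I = (\<Sum>i\<in>I. (f i - 1) + 1)"
    using assms by (intro sum.cong refl) (metis le_add_diff_inverse2)
  then show ?thesis by (simp only: sum.distrib) simp
qed

context star_core
begin

lemma fin_UN: "finite (\<Union>N)"
  using cover finV by (metis finite_Un)

text \<open>In a hypertree both sums would vanish; the single unit is the difference between
  \<open>(k - 1) m\<close> and \<open>n - 1\<close>. The first sum counts surplus edges of
  \<open>N\<close> at vertices other than \<open>r\<close>, the second surplus contacts of edges of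
  \<open>K\<close> with \<open>N\<close>.\<close>

lemma excess_sum:
  "(\<Sum>v\<in>\<Union>N - {r}. card {e \<in> N. v \<in> e} - 1) + (\<Sum>h\<in>K. card (h \<inter> \<Union>N) - 1) = 1"
proof -
  let ?U = "\<Union>N - {r}"
  let ?a = "\<lambda>v. card {e \<in> N. v \<in> e}"
  let ?b = "\<lambda>h. card (h \<inter> \<Union>N)"
  have fU: "finite ?U" using fin_UN by auto
  have "?a v \<ge> 1" if "v \<in> ?U" for v
  proof -
    have "{e \<in> N. v \<in> e} \<noteq> {}" using that by auto
    then show ?thesis using finE by (simp add: Suc_leI card_gt_0_iff)
  qed
  then have sa: "(\<Sum>v\<in>?U. ?a v) = (\<Sum>v\<in>?U. ?a v - 1) + card ?U"
    by (rule sum_minus_one)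
  have "?b h \<ge> 1" if "h \<in> K" for h
    using touch[OF that] fin_UN by (simp add: Suc_leI card_gt_0_iff)
  then have sb: "(\<Sum>h\<in>K. ?b h) = (\<Sum>h\<in>K. ?b h - 1) + card K"
    by (rule sum_minus_one)
  have "(\<Sum>v\<in>?U. ?a v) = (k - 1) * card N"
  proof (rule sum_multicount[OF fU finE(1)], intro ballI)
    fix e assume e: "e \<in> N"
    have "{i \<in> ?U. i \<in> e} = e - {r}" using e by auto
    then show "card {i \<in> ?U. i \<in> e} = k - 1" using uni e rN[OF e] by auto
  qed
  moreover have "card V = card (\<Union>N) + card (\<Union>h\<in>K. h - \<Union>N)"
  proof -
    have "V = \<Union>N \<union> (\<Union>h\<in>K. h - \<Union>N)" using cover by auto
    moreover have "finite (\<Union>h\<in>K. h - \<Union>N)" using finE fin_edge by auto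
    ultimately show ?thesis using fin_UN by (metis (no_types, lifting) DiffD2 UN_E card_Un_disjoint disjoint_iff)
  qed
  moreover have "card (\<Union>N) = card ?U + 1"
    using fin_UN rN[OF gN] gN by (metis Suc_eq_plus1 UnionI card_Suc_Diff1)
  moreover have "card (\<Union>h\<in>K. h - \<Union>N) = (\<Sum>h\<in>K. card (h - \<Union>N))"
    using finE fin_edge disjK by (intro card_UN_disjoint) (auto simp: pairwise_def disjnt_iff)
  moreover have "(\<Sum>h\<in>K. card (h - \<Union>N)) + (\<Sum>h\<in>K. ?b h) = k * card K"
  proof -
    have "card (h - \<Union>N) + ?b h = k" if "h \<in> K" for h
    proof -
      have "card h = card (h - \<Union>N) + card (h \<inter> \<Union>N)"
        using fin_edge that by (subst add.commute, intro card_Int_Diff) auto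
      then show ?thesis using uni that by auto
    qed
    then have "(\<Sum>h\<in>K. card (h - \<Union>N) + ?b h) = (\<Sum>h\<in>K. k)" by (intro sum.cong) auto
    then show ?thesis by (simp add: sum.distrib)
  qed
  ultimately have "(k - 1) * (card N + card K) + (\<Sum>v\<in>?U. ?a v - 1) + (\<Sum>h\<in>K. ?b h - 1) + card K =
     1 + (k - 1) * card N + k * card K"
    using sa sb cardV[unfolded card_E] by linarith
  moreover have "k * card K = (k - 1) * card K + card K"
    using k3 by (metis Suc_diff_1 add.commute mult_Suc not_numeral_le_zero not_gr0)
  ultimately show ?thesis by (simp add: distrib_left)
qed

text \<open>A sum of natural numbers equal to 1 has exactly one nonzero summand. It belongs to a
  vertex lying in two edges of \<open>N\<close>, or to an edge \<open>h\<close> of \<open>K\<close>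
  that touches \<open>N\<close> twice and so closes the cycle.\<close>

lemma sunflower_cases:
  obtains (twin) v2 e1 e2 where "twin_star k V N K r g v2 e1 e2"
  | (loop) h p q where "h \<in> K" "p \<noteq> q" "h \<inter> \<Union>N = {p, q}"
      "\<And>h'. h' \<in> K \<Longrightarrow> h' \<noteq> h \<Longrightarrow> card (h' \<inter> \<Union>N) = 1"
      "\<And>v e e'. e \<in> N \<Longrightarrow> e' \<in> N \<Longrightarrow> v \<in> e \<Longrightarrow> v \<in> e' \<Longrightarrow> v \<noteq> r \<Longrightarrow> e = e'"
proof -
  let ?U = "\<Union>N - {r}"
  let ?a = "\<lambda>v. card {e \<in> N. v \<in> e}"
  let ?b = "\<lambda>h. card (h \<inter> \<Union>N)"
  have fU: "finite ?U" using fin_UN by auto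
  have a1: "?a v \<ge> 1" if "v \<in> ?U" for v
  proof -
    have "{e \<in> N. v \<in> e} \<noteq> {}" using that by auto
    then show ?thesis using finE by (simp add: Suc_leI card_gt_0_iff)
  qed
  have b1: "?b h \<ge> 1" if "h \<in> K" for h
    using touch[OF that] fin_UN by (simp add: Suc_leI card_gt_0_iff)
  have uniq: "e = e'" if "?a v \<le> 1" "e \<in> N" "e' \<in> N" "v \<in> e" "v \<in> e'" for v e e'
  proof -
    have "finite {e \<in> N. v \<in> e}" using finE by auto
    then show ?thesis using that by (metis (mono_tags, lifting) card_le_Suc0_iff_eq One_nat_def mem_Collect_eq)
  qed
  consider "(\<Sum>v\<in>?U. ?a v - 1) = 1" "(\<Sum>h\<in>K. ?b h - 1) = 0"
    | "(\<Sum>v\<in>?U. ?a v - 1) = 0" "(\<Sum>h\<in>K. ?b h - 1) = 1"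
    using excess_sum by linarith
  then show ?thesis
  proof cases
    case 1
    obtain v where v: "v \<in> ?U" "?a v - 1 = 1" "\<forall>w\<in>?U. v \<noteq> w \<longrightarrow> ?a w - 1 = 0"
      using 1(1) unfolding sum_eq_1_iff[OF fU] by auto
    then have "?a v = 2" by auto
    then obtain e1 e2 where e: "{e \<in> N. v \<in> e} = {e1, e2}" "e1 \<noteq> e2"
      by (auto simp: card_2_iff)
    have "\<forall>h\<in>K. ?b h - 1 = 0" using 1(2) finE by (simp add: sum_eq_0_iff)
    then have b: "?b h = 1" if "h \<in> K" for h using b1[OF that] that by fastforce
    have "twin_star k V N K r g v e1 e2"
    proof (unfold_locales)
      show "e1 \<in> N" "e2 \<in> N" "e1 \<noteq> e2" "v \<in> e1" "v \<in> e2" "v \<noteq> r" using e v by auto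
      fix w e e' assume w: "e \<in> N" "e' \<in> N" "w \<in> e" "w \<in> e'" "w \<noteq> r" "e \<noteq> e'"
      have wv: "w = v"
      proof (rule ccontr)
        assume "w \<noteq> v"
        then have "?a w - 1 = 0" using v(3) w by auto
        then have "?a w \<le> 1" by simp
        then show False using uniq[of w e e'] w by auto
      qed
      then have "{e, e'} \<subseteq> {e1, e2}" using w e(1) by auto
      then show "w = v \<and> {e, e'} = {e1, e2}" using w(6) wv by auto
    next
      fix h assume "h \<in> K" then show "?b h = 1" by (rule b)
    qed
    then show ?thesis by (rule twin)
  next
    case 2
    obtain h where h: "h \<in> K" "?b h - 1 = 1" "\<forall>h'\<in>K. h \<noteq> h' \<longrightarrow> ?b h' - 1 = 0"
      using 2(2) unfolding sum_eq_1_iff[OF finE(2)] by auto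
    then have "?b h = 2" by auto
    then obtain p q where pq: "h \<inter> \<Union>N = {p, q}" "p \<noteq> q"
      by (auto simp: card_2_iff)
    show ?thesis
    proof (rule loop[OF h(1) pq(2,1)])
      show "?b h' = 1" if h': "h' \<in> K" "h' \<noteq> h" for h'
      proof -
        have "?b h' - 1 = 0" using h(3) h' by metis
        then show ?thesis using b1[OF h'(1)] by linarith
      qed
      show "e = e'" if w: "e \<in> N" "e' \<in> N" "v \<in> e" "v \<in> e'" "v \<noteq> r" for v e e'
      proof -
        have "\<forall>w\<in>?U. ?a w - 1 = 0" using 2(1) fU by (simp add: sum_eq_0_iff)
        then have "?a v - 1 = 0" using w by auto
        then show ?thesis using uniq[of v e e'] w by simp
      qed
    qed
  qed
qed

end

section \<open>The characteristic equation\<close>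


text \<open>The \<open>k\<close> eigenvalue equations at the vertices of \<open>e\<close> are
  multiplied; afterwards the vector occurs only through edge products.\<close>

lemma edge_weight_power:
  assumes G: "uniform_hypergraph k G" and e: "e \<in> edges G" and \<rho>: "\<rho> > 0"
    and eig: "\<forall>v\<in>verts G. load (edges G) x v = \<rho> * x v ^ k"
  shows "prod x e ^ k = (1 / \<rho> ^ k) * (\<Prod>u\<in>e. load (edges G) x u)"
proof -
  note u = uniform_finite[OF G]
  have "(\<Prod>u\<in>e. load (edges G) x u) = (\<Prod>u\<in>e. \<rho> * x u ^ k)"
    using u(4)[OF e] eig by (intro prod.cong) auto
  also have "\<dots> = \<rho> ^ k * prod x e ^ k"
    using u(5)[OF e] by (simp add: prod.distrib prod_power_distrib)
  finally show ?thesis using \<rho> by simp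
qed

lemma load_eq:
  assumes "{e. e \<in> E \<and> v \<in> e} = D"
  shows "load E x v = (\<Sum>e\<in>D. prod x e)"
  using assms by (simp add: load_def)

lemma prod_if_power:
  fixes b :: real
  assumes "finite S"
  shows "(\<Prod>u\<in>S. (if u \<in> A then b else 1) * p) = b ^ card (A \<inter> S) * p ^ card S"
proof -
  have "(\<Prod>u\<in>S. if u \<in> A then b else 1) = b ^ card (A \<inter> S)"
    using assms by (subst prod.inter_restrict[symmetric]) (auto simp: Int_commute)
  then show ?thesis by (simp add: prod.distrib)
qed

locale star_perron = star_core +
  fixes x :: "'a \<Rightarrow> real" and \<rho> :: real
  assumes xpos: "\<And>v. v \<in> V \<Longrightarrow> x v > 0"
    and eig: "\<And>v. v \<in> V \<Longrightarrow> load (N \<union> K) x v = \<rho> * x v ^ k"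
    and N2: "card N \<ge> 2"
begin

abbreviation "y \<equiv> load (N \<union> K) x"
abbreviation "P \<equiv> prod x"
definition "al = 1 / \<rho> ^ k"
text \<open>The factor by which a pendant edge at \<open>u\<close> raises the load coming from the
  other edges at \<open>u\<close>, as it takes the share \<open>al\<close> of the total.\<close>

definition "bt = 1 / (1 - al)"

lemma Ppos: "e \<in> N \<union> K \<Longrightarrow> P e > 0"
  using xpos uni by (intro prod_pos) auto

lemma finEv: "finite {e. e \<in> N \<union> K \<and> v \<in> e}"
  using finE by auto

lemma P_le_y: "e \<in> N \<union> K \<Longrightarrow> v \<in> e \<Longrightarrow> P e \<le> y v"
  unfolding load_def using finEv Ppos by (intro member_le_sum) (auto simp: less_imp_le)

lemma ypos: "v \<in> V \<Longrightarrow> y v > 0"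
proof -
  assume "v \<in> V"
  then obtain e where "e \<in> N \<union> K" "v \<in> e" using cover by auto
  then show ?thesis using P_le_y Ppos by (meson less_le_trans)
qed

lemma \<rho>pos: "\<rho> > 0"
  using ypos[OF rV] eig[OF rV] xpos[OF rV] by (simp add: zero_less_mult_iff)

lemma al0: "al > 0" using \<rho>pos by (simp add: al_def)

lemma edge_identity: "e \<in> N \<union> K \<Longrightarrow> P e ^ k = al * (\<Prod>u\<in>e. y u)"
  using edge_weight_power[OF uniform _ \<rho>pos, of e x] eig by (simp add: al_def)

lemma yr: "y r = (\<Sum>e\<in>N. P e)"
  using rN rK by (intro load_eq) auto

text \<open>In the edge identity of \<open>g\<close> every load is at least \<open>P g\<close>, and
  the load of \<open>r\<close> is strictly larger because a second edge of \<open>N\<close>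
  contributes to it.\<close>

lemma al1: "al < 1"
proof -
  obtain e' where e': "e' \<in> N" "e' \<noteq> g"
  proof -
    have "\<not> N \<subseteq> {g}"
    proof
      assume "N \<subseteq> {g}"
      then have "card N \<le> 1" using card_mono[of "{g}" N] by auto
      then show False using N2 by simp
    qed
    then show ?thesis using that by auto
  qed
  have "P g + P e' \<le> y r"
  proof -
    have "(\<Sum>e\<in>{g, e'}. P e) \<le> y r"
      unfolding yr using finE e' gN Ppos by (intro sum_mono2) (auto simp: less_imp_le)
    then show ?thesis using e' by simp
  qed
  then have lt: "P g < y r" using Ppos[of e'] e' by simp
  have g: "g \<in> N \<union> K" "r \<in> g" "finite g" using gN rN fin_edge by auto
  have "P g ^ k = P g * P g ^ (k - 1)"
    using k3 by (metis power_eq_if not_numeral_le_zero)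
  also have "P g ^ (k - 1) = (\<Prod>u\<in>g - {r}. P g)"
    using g uni by simp
  also have "\<dots> \<le> (\<Prod>u\<in>g - {r}. y u)"
    using P_le_y[OF g(1)] Ppos[OF g(1)] by (intro prod_mono) auto
  also have "P g * (\<Prod>u\<in>g - {r}. y u) < y r * (\<Prod>u\<in>g - {r}. y u)"
    using lt uni[OF g(1)] ypos by (intro mult_strict_right_mono prod_pos) auto
  also have "\<dots> = (\<Prod>u\<in>g. y u)" using g by (simp add: prod.remove)
  finally have "P g ^ k < (\<Prod>u\<in>g. y u)" using Ppos[OF g(1)] by simp
  then have "al * (\<Prod>u\<in>g. y u) < 1 * (\<Prod>u\<in>g. y u)" using edge_identity[OF g(1)] by simp
  moreover have "(\<Prod>u\<in>g. y u) > 0" using uni[OF g(1)] ypos by (intro prod_pos) auto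
  ultimately show ?thesis by (simp only: mult_less_cancel_right_pos)
qed

lemma bt1: "bt > 1" using al0 al1 by (simp add: bt_def)

lemma K_unique: "h \<in> K \<Longrightarrow> h' \<in> K \<Longrightarrow> u \<in> h \<Longrightarrow> u \<in> h' \<Longrightarrow> h = h'"
  using disjK by (metis disjnt_iff pairwiseD)

lemma leaf: "h \<in> K \<Longrightarrow> u \<in> h \<Longrightarrow> u \<notin> \<Union>N \<Longrightarrow> y u = P h"
  by (subst load_eq[where D = "{h}"]) (auto dest: K_unique)

text \<open>The other \<open>k - 1\<close> vertices of \<open>h\<close> lie in no further edge, so
  their load is \<open>P h\<close>. In the edge identity this cancels all but one power of
  \<open>P h\<close>.\<close>

lemma pendant:
  assumes h: "h \<in> K" and u: "h \<inter> \<Union>N = {u}"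
  shows "P h = al * y u"
proof -
  have hE: "h \<in> N \<union> K" and fh: "finite h" and uh: "u \<in> h" using h u fin_edge by auto
  have "(\<Prod>v\<in>h. y v) = y u * (\<Prod>v\<in>h - {u}. y v)" using fh uh by (rule prod.remove)
  also have "(\<Prod>v\<in>h - {u}. y v) = (\<Prod>v\<in>h - {u}. P h)"
    using u h by (intro prod.cong leaf) auto
  also have "\<dots> = P h ^ (k - 1)" using uh fh uni[OF hE] by simp
  finally have "P h ^ k = al * y u * P h ^ (k - 1)" using edge_identity[OF hE] by simp
  moreover have "P h ^ k = P h * P h ^ (k - 1)"
    using k3 by (metis power_eq_if not_numeral_le_zero)
  ultimately show ?thesis using Ppos[OF hE] by simp
qed

text \<open>If an edge \<open>h\<close> of \<open>K\<close> is attached at \<open>u\<close>, then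
  \<open>P h = al * y u\<close>, and solving the load equation for \<open>y u\<close> produces the
  factor \<open>bt\<close>.\<close>

lemma attached:
  assumes D: "D \<subseteq> N" and ND: "{e \<in> N. u \<in> e} = D" and ur: "u \<noteq> r"
    and one: "\<And>h. h \<in> K \<Longrightarrow> u \<in> h \<Longrightarrow> card (h \<inter> \<Union>N) = 1" and ne: "D \<noteq> {}"
  shows "y u = (if u \<in> \<Union>K then bt else 1) * (\<Sum>e\<in>D. P e)"
proof (cases "u \<in> \<Union>K")
  case True
  then obtain h where h: "h \<in> K" "u \<in> h" by auto
  have uN: "u \<in> \<Union>N" using ND ne by auto
  have "h \<inter> \<Union>N = {u}"
    using one[OF h] h uN by (metis IntI card_1_singletonE singletonD)
  then have Ph: "P h = al * y u" using pendant h by auto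
  have hD: "h \<notin> D" using D h NK by auto
  have "y u = (\<Sum>e\<in>insert h D. P e)"
    by (rule load_eq) (use ND h K_unique in auto)
  also have "\<dots> = P h + (\<Sum>e\<in>D. P e)"
    using hD D finE by (subst sum.insert) (auto intro: finite_subset)
  finally have "y u * (1 - al) = (\<Sum>e\<in>D. P e)" using Ph by (simp add: algebra_simps)
  then show ?thesis using True al1 by (simp add: bt_def field_simps)
next
  case False
  then have "y u = (\<Sum>e\<in>D. P e)" by (intro load_eq) (use ND in auto)
  then show ?thesis using False by simp
qed

text \<open>Every vertex of \<open>e\<close> other than \<open>r\<close> has load \<open>P e\<close>
  or \<open>bt * P e\<close>. In the edge identity \<open>k - 1\<close> powers of \<open>P e\<close>
  cancel and only the load of \<open>r\<close> remains.\<close>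

lemma branch:
  assumes e: "e \<in> N"
    and uniq: "\<And>u e'. u \<in> e \<Longrightarrow> u \<noteq> r \<Longrightarrow> e' \<in> N \<Longrightarrow> u \<in> e' \<Longrightarrow> e' = e"
    and one: "\<And>h. h \<in> K \<Longrightarrow> h \<inter> e \<noteq> {} \<Longrightarrow> card (h \<inter> \<Union>N) = 1"
  shows "P e = al * y r * bt ^ card (\<Union>K \<inter> e)"
proof -
  have eE: "e \<in> N \<union> K" and fe: "finite e" and re: "r \<in> e" using e fin_edge rN by auto
  have yu: "y u = (if u \<in> \<Union>K then bt else 1) * P e" if u: "u \<in> e - {r}" for u
  proof -
    have "{e \<in> N. u \<in> e} = {e}" using u e uniq by auto
    moreover have "card (h \<inter> \<Union>N) = 1" if "h \<in> K" "u \<in> h" for h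
      using one[OF that(1)] that(2) u by blast
    ultimately show ?thesis using attached[of "{e}" u] e u by simp
  qed
  have "(\<Prod>v\<in>e. y v) = y r * (\<Prod>v\<in>e - {r}. y v)" using fe re by (rule prod.remove)
  also have "(\<Prod>v\<in>e - {r}. y v) = (\<Prod>u\<in>e - {r}. (if u \<in> \<Union>K then bt else 1) * P e)"
    using yu by (rule prod.cong[OF refl])
  also have "\<dots> = bt ^ card (\<Union>K \<inter> (e - {r})) * P e ^ (k - 1)"
    using fe re uni[OF eE] by (subst prod_if_power) auto
  also have "\<Union>K \<inter> (e - {r}) = \<Union>K \<inter> e" using rK by auto
  finally have "P e ^ k = (al * y r * bt ^ card (\<Union>K \<inter> e)) * P e ^ (k - 1)"
    using edge_identity[OF eE] by simp
  moreover have "P e ^ k = P e * P e ^ (k - 1)"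
    using k3 by (metis power_eq_if not_numeral_le_zero)
  ultimately show ?thesis using Ppos[OF eE] by simp
qed

end

text \<open>The bracket of the characteristic equation for a set \<open>A\<close> of attachment
  vertices. If \<open>v2\<close> lies in \<open>A\<close>, it enters both exponents of the
  square.\<close>

definition twin_char :: "'a set set \<Rightarrow> 'a set \<Rightarrow> 'a set \<Rightarrow> 'a set \<Rightarrow> real \<Rightarrow> real" where
  "twin_char N e1 e2 A c =
     (c ^ card (A \<inter> e1) + c ^ card (A \<inter> e2))\<^sup>2 + (\<Sum>e\<in>N - {e1, e2}. c ^ (2 * card (A \<inter> e)))"

lemma twin_char_mono:
  assumes "1 \<le> c" "c \<le> d"
  shows "twin_char N e1 e2 A c \<le> twin_char N e1 e2 A d"
  unfolding twin_char_def using assms by (intro add_mono power_mono sum_mono) auto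

lemma square_cancel:
  fixes s :: real
  assumes "s\<^sup>2 = a * (f\<^sup>2 * s) * t\<^sup>2" "s \<noteq> 0"
  shows "s = a * (f * t)\<^sup>2"
proof -
  have "s * s = s * (a * (f * t)\<^sup>2)"
    using assms(1) by (simp add: power2_eq_square mult_ac)
  then show ?thesis using assms(2) by simp
qed

locale twin_perron = twin_star + star_perron
begin

text \<open>Both \<open>r\<close> and \<open>v2\<close> have loads involving other edges of
  \<open>N\<close>, so one power fewer cancels than in \<open>branch\<close> and the equation is
  quadratic. A pendant edge at \<open>v2\<close> is accounted for in \<open>y v2\<close>, which is
  why the exponent omits \<open>v2\<close>.\<close>

lemma twin_edge:
  assumes e: "e \<in> {e1, e2}"
  shows "P e ^ 2 = al * y r * y v2 * bt ^ card (\<Union>K \<inter> (e - {v2}))"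
proof -
  have eN: "e \<in> N" and v2e': "v2 \<in> e" using e e1N e2N v2e by auto
  have eE: "e \<in> N \<union> K" and fe: "finite e" and re: "r \<in> e" using eN fin_edge rN by auto
  have yu: "y u = (if u \<in> \<Union>K then bt else 1) * P e" if u: "u \<in> e - {r, v2}" for u
  proof -
    have "{e \<in> N. u \<in> e} = {e}" using u eN overlap by blast
    then show ?thesis using attached[of "{e}" u] eN u single by auto
  qed
  have "(\<Prod>v\<in>e. y v) = y r * (\<Prod>v\<in>e - {r}. y v)" using fe re by (rule prod.remove)
  also have "(\<Prod>v\<in>e - {r}. y v) = y v2 * (\<Prod>v\<in>e - {r} - {v2}. y v)"
    using fe v2e' v2r by (intro prod.remove) auto
  also have "e - {r} - {v2} = e - {r, v2}" by auto
  also have "(\<Prod>v\<in>e - {r, v2}. y v) = (\<Prod>u\<in>e - {r, v2}. (if u \<in> \<Union>K then bt else 1) * P e)"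
    using yu by (rule prod.cong[OF refl])
  also have "\<dots> = bt ^ card (\<Union>K \<inter> (e - {r, v2})) * P e ^ (k - 2)"
  proof -
    have "card (e - {r, v2}) = k - 2"
      using fe re v2e' v2r uni[OF eE] by (subst card_Diff_subset) auto
    then show ?thesis using fe by (subst prod_if_power) auto
  qed
  also have "\<Union>K \<inter> (e - {r, v2}) = \<Union>K \<inter> (e - {v2})" using rK by auto
  finally have "P e ^ k = (al * y r * y v2 * bt ^ card (\<Union>K \<inter> (e - {v2}))) * P e ^ (k - 2)"
    using edge_identity[OF eE] by simp
  moreover have "P e ^ k = P e ^ 2 * P e ^ (k - 2)"
  proof -
    obtain i where "k = 2 + i" using k3 by (metis add_2_eq_Suc le_Suc_ex numeral_3_eq_3 add_Suc add_Suc_right)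
    then show ?thesis by (simp only: power_add diff_add_inverse)
  qed
  ultimately show ?thesis using Ppos[OF eE] by simp
qed

text \<open>By \<open>twin_edge\<close> the products of \<open>e1\<close> and \<open>e2\<close> are
  multiples of one number \<open>s\<close> that contains the unknown load of \<open>v2\<close>. This
  load is in turn \<open>c^(2 f)\<close> times the sum of the two products. Eliminating it yields
  the squared term, and the load equation at \<open>r\<close>, divided by \<open>y r\<close>,
  becomes the claim.\<close>

lemma characteristic:
  "al * twin_char N e1 e2 (\<Union>K \<inter> \<Union>N) (1 / sqrt (1 - al)) = 1"
proof -
  let ?c = "1 / sqrt (1 - al)"
  let ?A = "\<Union>K \<inter> \<Union>N"
  have c2: "?c ^ 2 = bt" using al1 by (simp add: bt_def power_divide)
  have c0: "?c > 0" using al1 by simp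
  have inter: "?A \<inter> e = \<Union>K \<inter> e" if "e \<in> N" for e using that by auto
  have other: "P e = al * y r * ?c ^ (2 * card (?A \<inter> e))" if e: "e \<in> N - {e1, e2}" for e
  proof -
    have "P e = al * y r * bt ^ card (\<Union>K \<inter> e)"
      using e overlap single by (intro branch) blast+
    then show ?thesis using inter[of e] e by (simp add: power_mult c2)
  qed
  define f where "f = (if v2 \<in> \<Union>K then 1 else 0 :: nat)"
  define j where "j e = card (\<Union>K \<inter> (e - {v2}))" for e
  have cj: "card (?A \<inter> e) = j e + f" if e: "e \<in> {e1, e2}" for e
  proof -
    have eN: "e \<in> N" "v2 \<in> e" using e e1N e2N v2e by auto
    have fin: "finite (\<Union>K \<inter> e)" using eN fin_edge by auto
    show ?thesis
    proof (cases "v2 \<in> \<Union>K")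
      case True
      then have "\<Union>K \<inter> (e - {v2}) = (\<Union>K \<inter> e) - {v2}" "v2 \<in> \<Union>K \<inter> e" using eN by auto
      then show ?thesis using fin inter[OF eN(1)] True
        by (metis Suc_eq_plus1 card_Suc_Diff1 f_def j_def)
    next
      case False
      then have "\<Union>K \<inter> (e - {v2}) = \<Union>K \<inter> e" by auto
      then show ?thesis using inter[OF eN(1)] False by (simp add: f_def j_def)
    qed
  qed
  have yv2: "y v2 = ?c ^ (2 * f) * (P e1 + P e2)"
  proof -
    have "{e \<in> N. v2 \<in> e} = {e1, e2}" using overlap e1N e2N v2e v2r by blast
    then have "y v2 = (if v2 \<in> \<Union>K then bt else 1) * (\<Sum>e\<in>{e1, e2}. P e)"
      using single e1N e2N v2r by (intro attached) auto
    then show ?thesis using e12 by (simp add: f_def c2)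
  qed
  have Pp: "P e1 > 0" "P e2 > 0" using Ppos e1N e2N by auto
  have yr0: "y r > 0" and y20: "y v2 > 0" using ypos rV uni[of e1] e1N v2e by auto
  define s where "s = sqrt (al * y r * y v2)"
  have s2: "s ^ 2 = al * y r * y v2" and s0: "s > 0" using al0 yr0 y20 by (auto simp: s_def)
  have btj: "bt ^ i = (?c ^ i) ^ 2" for i
    unfolding c2[symmetric] by (simp only: power_mult[symmetric] mult.commute)
  have Pe: "P e = s * ?c ^ j e" if e: "e \<in> {e1, e2}" for e
  proof -
    have "P e ^ 2 = (s * ?c ^ j e) ^ 2"
      using twin_edge[OF e] s2 btj[of "j e"] by (simp only: power_mult_distrib j_def)
    moreover have "P e \<ge> 0" using e Pp by auto
    moreover have "s * ?c ^ j e \<ge> 0" using s0 c0 by simp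
    ultimately show ?thesis by (metis power2_eq_iff_nonneg)
  qed
  let ?S = "P e1 + P e2"
  let ?T = "?c ^ j e1 + ?c ^ j e2"
  have "?S = s * ?T" using Pe by (simp add: distrib_left)
  then have "?S ^ 2 = al * y r * y v2 * ?T ^ 2" using s2 by (simp add: power_mult_distrib)
  then have "?S ^ 2 = al * y r * ((?c ^ f) ^ 2 * ?S) * ?T ^ 2"
    unfolding yv2 by (simp only: power_even_eq)
  moreover have "?S \<noteq> 0" using Pp by simp
  ultimately have S: "?S = al * y r * (?c ^ f * ?T) ^ 2"
    by (rule square_cancel)
  have T: "?c ^ f * ?T = ?c ^ card (?A \<inter> e1) + ?c ^ card (?A \<inter> e2)"
    using cj by (simp add: power_add distrib_left mult.commute)
  have "y r = ?S + (\<Sum>e\<in>N - {e1, e2}. P e)"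
  proof -
    have "(\<Sum>e\<in>N. P e) = (\<Sum>e\<in>N - {e1, e2}. P e) + (\<Sum>e\<in>{e1, e2}. P e)"
      using finE e1N e2N by (intro sum.subset_diff) auto
    then show ?thesis using yr e12 by simp
  qed
  also have "(\<Sum>e\<in>N - {e1, e2}. P e) = (\<Sum>e\<in>N - {e1, e2}. al * y r * ?c ^ (2 * card (?A \<inter> e)))"
    using other by (rule sum.cong[OF refl])
  also have "?S + \<dots> = y r * (al * twin_char N e1 e2 ?A ?c)"
    unfolding S T twin_char_def by (simp add: sum_distrib_left distrib_left mult_ac)
  finally have "y r * 1 = y r * (al * twin_char N e1 e2 ?A ?c)" by simp
  then show ?thesis using yr0 by simp
qed

end

section \<open>From the characteristic equation to the spectral radius\<close>

lemma (in twin_star) card_N_ge: "card N \<ge> 2"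
proof -
  have "card {e1, e2} \<le> card N" using e1N e2N finE by (intro card_mono) auto
  then show ?thesis using e12 by simp
qed

lemma (in twin_star) characteristic_root:
  assumes "a = 1 / spectral_radius k hyp ^ k"
  shows "0 < a" "a < 1" "a * twin_char N e1 e2 (\<Union>K \<inter> \<Union>N) (1 / sqrt (1 - a)) = 1"
    "spectral_radius k hyp > 0"
proof -
  have k2: "k \<ge> 2" using k3 by simp
  obtain x where x: "\<forall>v\<in>verts hyp. x v > 0"
    "\<forall>v\<in>verts hyp. load (edges hyp) x v = spectral_radius k hyp * x v ^ k"
    using perron_vector[OF uniform connected k2] by blast
  interpret twin_perron k V N K r g v2 e1 e2 x "spectral_radius k hyp"
    by unfold_locales (use x card_N_ge in simp_all)
  show "0 < a" "a < 1" "a * twin_char N e1 e2 (\<Union>K \<inter> \<Union>N) (1 / sqrt (1 - a)) = 1"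
    "spectral_radius k hyp > 0"
    using al0 al1 characteristic \<rho>pos assms by (auto simp: al_def)
qed

text \<open>The left-hand side of the characteristic equation increases with \<open>a = 1 / \<rho>\<^sup>k\<close>, so a larger
  characteristic function has a smaller root and belongs to a larger spectral radius.\<close>

lemma (in twin_star) spectral_radius_greater:
  assumes b: "0 < b" "b < 1" "b = 1 / \<rho> ^ k" "\<rho> > 0"
    and gt: "b * twin_char N e1 e2 (\<Union>K \<inter> \<Union>N) (1 / sqrt (1 - b)) > 1"
  shows "spectral_radius k hyp > \<rho>"
proof (rule ccontr)
  assume n: "\<not> ?thesis"
  define a where "a = 1 / spectral_radius k hyp ^ k"
  note a = characteristic_root[OF a_def]
  have "spectral_radius k hyp ^ k \<le> \<rho> ^ k" using n a(4) by (intro power_mono) auto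
  then have ba: "b \<le> a" unfolding a_def b(3) using a(4) b(4) by (intro divide_left_mono) auto
  let ?f = "\<lambda>a. twin_char N e1 e2 (\<Union>K \<inter> \<Union>N) (1 / sqrt (1 - a))"
  have "1 \<le> 1 / sqrt (1 - b)" using b by simp
  moreover have "1 / sqrt (1 - b) \<le> 1 / sqrt (1 - a)" using ba a b by (intro divide_left_mono) auto
  ultimately have "?f b \<le> ?f a" by (rule twin_char_mono)
  moreover have "?f b \<ge> 0" using gt b by (metis less_eq_real_def mult_pos_neg not_less order_less_trans zero_less_one)
  ultimately have "b * ?f b \<le> a * ?f a" using ba b(1) by (intro mult_mono) auto
  then show False using gt a(3) by simp
qed

section \<open>Excluding cycles away from the centre\<close>


lemma not_subset_pair:
  assumes "card e \<ge> 3"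
  shows "\<not> e \<subseteq> {a, b}"
proof
  assume "e \<subseteq> {a, b}"
  then have "card e \<le> card {a, b}" by (intro card_mono) auto
  also have "\<dots> \<le> 2" by (cases "a = b") auto
  finally show False using assms by simp
qed

text \<open>With \<open>u = 1 - s\<close> one has \<open>w^2 - u^2 = 2 s u\<close>, so after
  clearing denominators the claim is equivalent to the last assumption. For
  \<open>s = sqrt a\<close> and \<open>w = sqrt (1 - a)\<close>, the left side is the term of a
  doubly touched edge, and the right side plus 1 is the square belonging to a 2-cycle.\<close>

lemma loop_inequality:
  fixes s w Q :: real
  assumes "0 < s" "s < 1" "w > 0" "w\<^sup>2 = 1 - s\<^sup>2" "Q > 0" "s * Q < (1 - s) * w"
  shows "(Q / (1 - s))\<^sup>2 < (Q / w)\<^sup>2 + 2 * (Q / w)"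
proof -
  define u where "u = 1 - s"
  have u: "u > 0" "s = 1 - u" using assms by (auto simp: u_def)
  have w2: "w\<^sup>2 = u * (2 - u)" using assms(4) u by (simp add: power2_eq_square algebra_simps)
  have u2: "2 - u > 0" using u assms by auto
  have "w\<^sup>2 * Q\<^sup>2 - u\<^sup>2 * Q\<^sup>2 = Q * u * (2 * (s * Q))"
    unfolding w2 u(2) by (simp add: power2_eq_square algebra_simps)
  also have "\<dots> < Q * u * (2 * (u * w))"
    using assms u by (intro mult_strict_left_mono) auto
  finally have "w\<^sup>2 * Q\<^sup>2 < u\<^sup>2 * Q\<^sup>2 + 2 * u\<^sup>2 * w * Q"
    by (simp add: power2_eq_square algebra_simps)
  then have "w\<^sup>2 * Q\<^sup>2 / (u\<^sup>2 * w\<^sup>2) < (u\<^sup>2 * Q\<^sup>2 + 2 * u\<^sup>2 * w * Q) / (u\<^sup>2 * w\<^sup>2)"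
    using u(1) assms(3) by (intro divide_strict_right_mono) auto
  moreover have "w\<^sup>2 * Q\<^sup>2 / (u\<^sup>2 * w\<^sup>2) = (Q / u)\<^sup>2"
    using u(1) assms(3) by (simp add: power_divide)
  moreover have "(u\<^sup>2 * Q\<^sup>2 + 2 * u\<^sup>2 * w * Q) / (u\<^sup>2 * w\<^sup>2) = (Q / w)\<^sup>2 + 2 * (Q / w)"
    using u(1) assms(3) by (simp add: power2_eq_square field_simps)
  ultimately show ?thesis by (simp add: u_def)
qed

context star_perron
begin

text \<open>The vertices \<open>p\<close> and \<open>q\<close> have the same load \<open>Y\<close>,
  and the edge identity of \<open>h\<close> gives \<open>(P h)^2 = al * Y^2\<close>. So
  \<open>h\<close> takes the share \<open>sqrt al\<close> of each of these loads, where a pendant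
  edge would take \<open>al\<close>; the two vertices together produce the denominator
  \<open>(1 - sqrt al)^2\<close>.\<close>

lemma loop_characteristic:
  assumes h: "h \<in> K" and pq: "p \<noteq> q" "h \<inter> \<Union>N = {p, q}" and e': "e' \<in> N" "p \<in> e'" "q \<in> e'"
    and one: "\<And>h'. h' \<in> K \<Longrightarrow> h' \<noteq> h \<Longrightarrow> card (h' \<inter> \<Union>N) = 1"
    and uniq: "\<And>v e e'. e \<in> N \<Longrightarrow> e' \<in> N \<Longrightarrow> v \<in> e \<Longrightarrow> v \<in> e' \<Longrightarrow> v \<noteq> r \<Longrightarrow> e = e'"
  shows "al * (bt ^ card (\<Union>K \<inter> (e' - {p, q})) / (1 - sqrt al)\<^sup>2 +
    (\<Sum>e\<in>N - {e'}. bt ^ card (\<Union>K \<inter> e))) = 1"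
proof -
  define s where "s = sqrt al"
  have s: "s > 0" "s < 1" "s\<^sup>2 = al" using al0 al1 by (auto simp: s_def)
  have hE: "h \<in> N \<union> K" and fh: "finite h" and ph: "p \<in> h" "q \<in> h"
    using h pq fin_edge by auto
  have pr: "p \<noteq> r" "q \<noteq> r" using rK[OF h] ph by auto
  have eE: "e' \<in> N \<union> K" and fe: "finite e'" and re: "r \<in> e'" using e' fin_edge rN by auto
  have eh: "e' \<noteq> h" using rK[OF h] re by auto
  define Y where "Y = P e' + P h"
  have yv: "y v = Y" if v: "v \<in> {p, q}" for v
  proof -
    have v': "v \<in> e'" "v \<in> h" "v \<noteq> r" using v e' ph pr by auto
    have "a \<in> {e', h}" if "a \<in> N \<union> K" "v \<in> a" for a
      using that uniq[of a e' v] K_unique[of a h v] v' e'(1) h by auto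
    then have "{e. e \<in> N \<union> K \<and> v \<in> e} = {e', h}"
      using e'(1) h v' by blast
    then have "y v = (\<Sum>e\<in>{e', h}. P e)" by (rule load_eq)
    then show ?thesis using eh by (simp add: Y_def)
  qed
  have "(\<Prod>v\<in>h. y v) = Y * Y * (\<Prod>v\<in>h - {p, q}. y v)"
  proof -
    have "(\<Prod>v\<in>h. y v) = (\<Prod>v\<in>h - {p, q}. y v) * (\<Prod>v\<in>{p, q}. y v)"
      using fh ph by (intro prod.subset_diff) auto
    then show ?thesis using pq yv by simp
  qed
  also have "(\<Prod>v\<in>h - {p, q}. y v) = (\<Prod>v\<in>h - {p, q}. P h)"
    using pq h by (intro prod.cong leaf) auto
  also have "\<dots> = P h ^ (k - 2)"
    using fh ph pq uni[OF hE] by (simp add: card_Diff_subset numeral_2_eq_2)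
  finally have "P h ^ k = (al * (Y * Y)) * P h ^ (k - 2)"
    using edge_identity[OF hE] by (simp only: mult.assoc)
  moreover have "P h ^ k = P h ^ 2 * P h ^ (k - 2)"
  proof -
    have "P h ^ 2 * P h ^ (k - 2) = P h ^ (2 + (k - 2))" by (simp only: power_add)
    also have "2 + (k - 2) = k" using k3 by simp
    finally show ?thesis by simp
  qed
  ultimately have "P h ^ 2 * P h ^ (k - 2) = (al * (Y * Y)) * P h ^ (k - 2)" by simp
  moreover have "P h ^ (k - 2) \<noteq> 0" using Ppos[OF hE] by simp
  ultimately have "P h ^ 2 = al * (Y * Y)" by (metis mult_right_cancel)
  then have "P h ^ 2 = (s * Y) ^ 2" unfolding power_mult_distrib s(3) by (simp only: power2_eq_square[of Y])
  moreover have "s * Y \<ge> 0" "P h \<ge> 0" using s Ppos[OF hE] Ppos[OF eE] by (auto simp: Y_def)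
  ultimately have Ph: "P h = s * Y" by (metis power2_eq_iff_nonneg)
  have "Y * (1 - s) = Y - s * Y" by (simp add: algebra_simps)
  also have "\<dots> = P e'" unfolding Ph[symmetric] by (simp add: Y_def)
  finally have "Y * (1 - s) = P e'" .
  moreover have "1 - s \<noteq> 0" using s by simp
  ultimately have y_eq: "Y = P e' / (1 - s)" by (metis nonzero_mult_div_cancel_right)
  have yu: "y u = (if u \<in> \<Union>K then bt else 1) * P e'" if u: "u \<in> e' - {r, p, q}" for u
  proof -
    have "{e \<in> N. u \<in> e} = {e'}" using u e' uniq by blast
    moreover have "card (h' \<inter> \<Union>N) = 1" if h': "h' \<in> K" "u \<in> h'" for h'
    proof -
      have "u \<notin> h" using u e' pq by auto
      then show ?thesis using one h' by auto
    qed
    ultimately show ?thesis using attached[of "{e'}" u] e' u by simp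
  qed
  have "(\<Prod>v\<in>e'. y v) = (\<Prod>v\<in>e' - {r, p, q}. y v) * (\<Prod>v\<in>{r, p, q}. y v)"
    using fe re e' by (intro prod.subset_diff) auto
  also have "(\<Prod>v\<in>{r, p, q}. y v) = y r * (Y * Y)" using pr pq(1) yv by simp
  also have "(\<Prod>v\<in>e' - {r, p, q}. y v) = (\<Prod>u\<in>e' - {r, p, q}. (if u \<in> \<Union>K then bt else 1) * P e')"
    using yu by (rule prod.cong[OF refl])
  also have "\<dots> = bt ^ card (\<Union>K \<inter> (e' - {r, p, q})) * P e' ^ (k - 3)"
  proof -
    have "card (e' - {r, p, q}) = k - 3"
      using fe re e' pr pq(1) uni[OF eE] by (subst card_Diff_subset) auto
    then show ?thesis using fe by (subst prod_if_power) auto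
  qed
  also have "\<Union>K \<inter> (e' - {r, p, q}) = \<Union>K \<inter> (e' - {p, q})" using rK by auto
  finally have "P e' ^ k = al * (bt ^ card (\<Union>K \<inter> (e' - {p, q})) * P e' ^ (k - 3) * (y r * (Y * Y)))"
    using edge_identity[OF eE] by (simp only:)
  also have "\<dots> = (al * bt ^ card (\<Union>K \<inter> (e' - {p, q})) / (1 - s)\<^sup>2 * y r) * (P e' ^ (k - 3) * (P e')\<^sup>2)"
    unfolding y_eq by (simp add: power2_eq_square)
  also have "P e' ^ (k - 3) * (P e')\<^sup>2 = P e' ^ (k - 1)"
  proof -
    have "P e' ^ (k - 3) * (P e')\<^sup>2 = P e' ^ (k - 3 + 2)" by (simp only: power_add)
    also have "k - 3 + 2 = k - 1" using k3 by simp
    finally show ?thesis .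
  qed
  finally have "P e' ^ k = (al * bt ^ card (\<Union>K \<inter> (e' - {p, q})) / (1 - s)\<^sup>2 * y r) * P e' ^ (k - 1)" .
  moreover have "P e' ^ k = P e' * P e' ^ (k - 1)"
    using k3 by (metis power_eq_if not_numeral_le_zero)
  moreover have "P e' ^ (k - 1) \<noteq> 0" using Ppos[OF eE] by simp
  ultimately have Pe': "P e' = al * bt ^ card (\<Union>K \<inter> (e' - {p, q})) / (1 - s)\<^sup>2 * y r"
    by (metis mult_right_cancel)
  have other: "P e = al * y r * bt ^ card (\<Union>K \<inter> e)" if e: "e \<in> N - {e'}" for e
  proof (rule branch)
    show "e \<in> N" using e by auto
    show "e'' = e" if "u \<in> e" "u \<noteq> r" "e'' \<in> N" "u \<in> e''" for u e''
      using uniq[of e'' e u] that e by auto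
    show "card (h' \<inter> \<Union>N) = 1" if h': "h' \<in> K" "h' \<inter> e \<noteq> {}" for h'
    proof (rule one[OF h'(1)])
      show "h' \<noteq> h"
      proof
        assume "h' = h"
        then obtain u where u: "u \<in> h" "u \<in> e" using h'(2) by auto
        have eN: "e \<in> N" "e \<noteq> e'" using e by auto
        have "u \<in> {p, q}" unfolding pq(2)[symmetric] using u eN by auto
        then have "u \<in> e'" "u \<noteq> r" using e' pr by auto
        then show False using uniq[OF eN(1) e'(1) u(2)] eN(2) by simp
      qed
    qed
  qed
  have "y r = P e' + (\<Sum>e\<in>N - {e'}. P e)"
    unfolding yr using finE(1) e'(1) by (rule sum.remove)
  also have "(\<Sum>e\<in>N - {e'}. P e) = (\<Sum>e\<in>N - {e'}. al * y r * bt ^ card (\<Union>K \<inter> e))"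
    using other by (rule sum.cong[OF refl])
  also have "P e' + \<dots> = y r * (al * (bt ^ card (\<Union>K \<inter> (e' - {p, q})) / (1 - s)\<^sup>2 +
    (\<Sum>e\<in>N - {e'}. bt ^ card (\<Union>K \<inter> e))))"
    unfolding Pe' by (simp add: sum_distrib_left distrib_left mult_ac)
  finally have "y r * 1 = y r * (al * (bt ^ card (\<Union>K \<inter> (e' - {p, q})) / (1 - s)\<^sup>2 +
    (\<Sum>e\<in>N - {e'}. bt ^ card (\<Union>K \<inter> e))))" by simp
  then show ?thesis using ypos[OF rV] by (simp add: s_def)
qed

end

section \<open>Cycles through an edge of \<open>K\<close>\<close>

context extremal
begin

text \<open>The edge \<open>e'\<close> is moved from \<open>q\<close> to \<open>p\<close>, whose
  weight is at least as large. Its image \<open>d\<close> and \<open>e\<close> then form a 2-cycle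
  through \<open>r\<close> and \<open>p\<close>. The vertex \<open>q\<close> stays covered by
  \<open>h\<close>, and \<open>K\<close> is untouched, so \<open>no_improvement\<close>
  applies.\<close>

lemma no_loop_two_edges:
  assumes core: "star_core k (verts G) N K r g" and E: "edges G = N \<union> K" and z: "card K + 1 = z"
    and h: "h \<in> K" and pq: "p \<noteq> q" "h \<inter> \<Union>N = {p, q}"
    and e: "e \<in> N" "p \<in> e" "e' \<in> N" "q \<in> e'" "e \<noteq> e'"
    and uniq: "\<And>v e e'. e \<in> N \<Longrightarrow> e' \<in> N \<Longrightarrow> v \<in> e \<Longrightarrow> v \<in> e' \<Longrightarrow> v \<noteq> r \<Longrightarrow> e = e'"
    and x: "\<forall>v\<in>verts G. x v > 0"
    and eig: "\<forall>v\<in>verts G. load (edges G) x v = spectral_radius k G * x v ^ k"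
    and le: "x q \<le> x p"
  shows False
proof -
  interpret star_core k "verts G" N K r g by (rule core)
  have ph: "p \<in> h" "q \<in> h" using pq by auto
  have pr: "p \<noteq> r" "q \<noteq> r" using rK[OF h] ph by auto
  have pe': "p \<notin> e'" using uniq[of e e' p] e pr by auto
  have fe': "finite e'" "card e' = k" "e' \<subseteq> verts G" "r \<in> e'" using fin_edge uni e rN by auto
  define d where "d = insert p (e' - {q})"
  have pV: "p \<in> verts G" using e uni by auto
  have dc: "card d = k" unfolding d_def using fe' pe' e k3 by (subst card_insert_disjoint) auto
  have dV: "d \<subseteq> verts G" using pV fe' by (auto simp: d_def)
  have dr: "r \<in> d" using fe' pr by (auto simp: d_def)
  have dN: "d \<notin> N"
  proof
    assume dN: "d \<in> N"
    then have de: "d = e" using uniq[of d e p] e pr by (auto simp: d_def)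
    \<comment> \<open>Since \<open>k \<ge> 3\<close>, the edge \<open>e'\<close> has a third vertex,
      which would also lie in \<open>d = e\<close>.\<close>
    have "\<not> e' \<subseteq> {q, r}" using fe' k3 by (intro not_subset_pair) simp
    then obtain u where "u \<in> e'" "u \<noteq> q" "u \<noteq> r" by auto
    then show False using uniq[of e e' u] e de by (auto simp: d_def)
  qed
  have ge': "g \<noteq> e'" using gK[OF h] ph e by (auto simp: disjnt_iff)
  define N' where "N' = insert d (N - {e'})"
  define f where "f a = (if a = e' then d else a)" for a
  have fE: "f ` edges G = N' \<union> K"
    using e(3) NK by (auto simp: E N'_def f_def)
  have cN: "card (N' \<union> K) = card (N \<union> K)"
  proof -
    have "d \<notin> K" using dr rK by auto
    then have "N' \<union> K = insert d ((N \<union> K) - {e'})" "d \<notin> (N \<union> K) - {e'}"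
      using e(3) NK dN by (auto simp: N'_def)
    then show ?thesis using finE e(3) by (metis UnI1 card.insert_remove card_Suc_Diff1 finite_Diff finite_UnI card_insert_disjoint)
  qed
  interpret H: star_core k "verts G" N' K r g
  proof
    show "verts G = \<Union>N' \<union> \<Union>K"
    proof
      show "\<Union>N' \<union> \<Union>K \<subseteq> verts G" using uni dV by (auto simp: N'_def)
      show "verts G \<subseteq> \<Union>N' \<union> \<Union>K"
      proof
        fix v assume "v \<in> verts G"
        then consider "v \<in> \<Union>K" | a where "a \<in> N" "v \<in> a" using cover by auto
        then show "v \<in> \<Union>N' \<union> \<Union>K"
        proof cases
          case 2
          then show ?thesis using h ph by (cases "a = e'"; cases "v = q") (auto simp: N'_def d_def)
        qed auto
      qed
    qed
    show "h' \<inter> \<Union>N' \<noteq> {}" if h': "h' \<in> K" for h'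
    proof (cases "h' = h")
      case True
      then show ?thesis using ph by (auto simp: N'_def d_def)
    next
      case False
      obtain u a where u: "u \<in> h'" "a \<in> N" "u \<in> a" using touch[OF h'] by auto
      have "u \<noteq> q" using False u ph disjK h h' by (auto simp: pairwise_def disjnt_iff)
      then have "u \<in> \<Union>N'" using u by (cases "a = e'") (auto simp: N'_def d_def)
      then show ?thesis using u by auto
    qed
    show "card (verts G) = (k - 1) * card (N' \<union> K)" using cardV cN by simp
  qed (use k3 finV uni dV dc dr rN rK disjK gN ge' gK in \<open>auto simp: N'_def\<close>)
  have pe: "prod x e' \<le> prod x d"
    unfolding d_def using fe' e pe' x le by (intro prod_exchange) auto
  show False
  proof (rule no_improvement[OF x eig, where f = f and v = p and ?e0.0 = e'])
    show "f a \<subseteq> verts G \<and> card (f a) = k \<and> prod x a \<le> prod x (f a)" if "a \<in> edges G" for a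
      using that uni dV dc pe by (auto simp: E f_def)
    show "connected_hypergraph \<lparr>verts = verts G, edges = f ` edges G\<rparr>"
      unfolding fE by (rule H.connected)
    show "matching_number \<lparr>verts = verts G, edges = f ` edges G\<rparr> = z"
      unfolding fE H.matching_number by (rule z)
  qed (use pV pe' e in \<open>auto simp: f_def E d_def\<close>)
qed

text \<open>Characteristic equations are compared. The vertex \<open>p\<close> of \<open>h\<close>
  and a vertex \<open>y\<close> of \<open>g\<close> other than \<open>r\<close> trade places:
  \<open>g\<close> receives \<open>p\<close> and forms a 2-cycle with \<open>e\<close>, while
  \<open>h\<close> receives \<open>y\<close> and becomes pendant at \<open>q\<close>. A third edge
  at \<open>r\<close> is what makes the comparison strict; with only two the sides agree.\<close>

lemma no_loop_one_edge:
  assumes core: "star_core k (verts G) N K r g" and E: "edges G = N \<union> K" and z: "card K + 1 = z"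
    and h: "h \<in> K" and pq: "p \<noteq> q" "h \<inter> \<Union>N = {p, q}"
    and e: "e \<in> N" "p \<in> e" "q \<in> e"
    and one: "\<And>h'. h' \<in> K \<Longrightarrow> h' \<noteq> h \<Longrightarrow> card (h' \<inter> \<Union>N) = 1"
    and uniq: "\<And>v e e'. e \<in> N \<Longrightarrow> e' \<in> N \<Longrightarrow> v \<in> e \<Longrightarrow> v \<in> e' \<Longrightarrow> v \<noteq> r \<Longrightarrow> e = e'"
    and N3: "card N \<ge> 3"
  shows False
proof -
  interpret star_core k "verts G" N K r g by (rule core)
  have ph: "p \<in> h" "q \<in> h" using pq by auto
  have pr: "p \<noteq> r" "q \<noteq> r" using rK[OF h] ph by auto
  have fg: "finite g" "card g = k" "g \<subseteq> verts G" "r \<in> g" using fin_edge uni gN rN by auto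
  have fh: "finite h" "card h = k" "h \<subseteq> verts G" using fin_edge uni h by auto
  have ge: "g \<noteq> e" using gK[OF h] ph e by (auto simp: disjnt_iff)
  have gh: "g \<inter> h = {}" using gK[OF h] by (auto simp: disjnt_def)
  obtain y where y: "y \<in> g" "y \<noteq> r"
  proof -
    have "\<not> g \<subseteq> {r}" using fg k3 card_mono[of "{r}" g] by auto
    then show ?thesis using that by auto
  qed
  have yN: "a = g" if "a \<in> N" "y \<in> a" for a using uniq[of a g y] that y gN by auto
  have yK: "y \<notin> h'" if "h' \<in> K" for h' using gK[OF that] y by (auto simp: disjnt_iff)
  have pN: "a = e" if "a \<in> N" "p \<in> a" for a using uniq[of a e p] that e pr by auto
  have qN: "a = e" if "a \<in> N" "q \<in> a" for a using uniq[of a e q] that e pr by auto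
  have pK: "h' = h" if "h' \<in> K" "p \<in> h'" for h'
    using that ph h disjK by (auto simp: pairwise_def disjnt_iff)
  have qK: "h' = h" if "h' \<in> K" "q \<in> h'" for h'
    using that ph h disjK by (auto simp: pairwise_def disjnt_iff)
  have pg: "p \<notin> g" using gh ph by auto
  have yh: "y \<notin> h" using yK h by auto
  define g' where "g' = insert p (g - {y})"
  define h'' where "h'' = insert y (h - {p})"
  define N' where "N' = insert g' (N - {g})"
  define K' where "K' = insert h'' (K - {h})"
  have cg: "card g' = k" unfolding g'_def using fg pg y k3 by (subst card_insert_disjoint) auto
  have ch: "card h'' = k" unfolding h''_def using fh yh ph k3 by (subst card_insert_disjoint) auto
  have sub: "g' \<subseteq> verts G" "h'' \<subseteq> verts G" using fg fh ph y by (auto simp: g'_def h''_def)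
  have rg': "r \<in> g'" using fg y by (auto simp: g'_def)
  have rh': "r \<notin> h''" using y rK[OF h] by (auto simp: h''_def)
  obtain u0 where u0: "u0 \<in> g" "u0 \<noteq> r" "u0 \<noteq> y"
  proof -
    have "\<not> g \<subseteq> {r, y}" using fg k3 by (intro not_subset_pair) simp
    then show ?thesis using that by auto
  qed
  have g'N: "g' \<notin> N"
  proof
    assume a: "g' \<in> N"
    then have "g' = e" using pN by (auto simp: g'_def)
    then show False using uniq[of e g u0] u0 e gN ge by (auto simp: g'_def)
  qed
  have h'K: "h'' \<notin> K" using yK by (auto simp: h''_def)
  have UN: "\<Union>N' = \<Union>N - {y}"
  proof
    have "p \<noteq> y" using pg y by auto
    then have "g' \<subseteq> \<Union>N - {y}" using e gN by (auto simp: g'_def)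
    moreover have "a \<subseteq> \<Union>N - {y}" if "a \<in> N - {g}" for a using that yN[of a] by auto
    ultimately show "\<Union>N' \<subseteq> \<Union>N - {y}" by (auto simp: N'_def)
    show "\<Union>N - {y} \<subseteq> \<Union>N'" by (auto simp: N'_def g'_def)
  qed
  have hN: "h'' \<inter> \<Union>N' = {q}" using pq yh by (auto simp: UN h''_def)
  have oN: "h' \<inter> \<Union>N' = h' \<inter> \<Union>N" if "h' \<in> K" for h' using yK[OF that] by (auto simp: UN)
  interpret H: twin_star k "verts G" N' K' r g' p e g'
  proof
    show "verts G = \<Union>N' \<union> \<Union>K'"
    proof
      show "\<Union>N' \<union> \<Union>K' \<subseteq> verts G" using uni sub by (auto simp: N'_def K'_def)
      show "verts G \<subseteq> \<Union>N' \<union> \<Union>K'"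
        unfolding UN cover using e by (auto simp: K'_def h''_def)
    qed
    show "pairwise disjnt K'"
      unfolding K'_def pairwise_insert
    proof (intro conjI allI impI)
      show "pairwise disjnt (K - {h})" using disjK by (auto simp: pairwise_def)
      fix b assume b: "b \<in> K - {h} \<and> b \<noteq> h''"
      then have "disjnt h b" using disjK h by (auto simp: pairwise_def)
      then show "disjnt h'' b" "disjnt b h''" using b yK by (auto simp: h''_def disjnt_iff)
    qed
    show "disjnt g' a" if a: "a \<in> K'" for a
    proof (cases "a = h''")
      case True
      then show ?thesis using gh pg yh ph by (auto simp: g'_def h''_def disjnt_iff)
    next
      case False
      then have "a \<in> K" "a \<noteq> h" using a by (auto simp: K'_def)
      then show ?thesis using gK[of a] pK[of a] by (auto simp: g'_def disjnt_iff)
    qed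
    show single': "card (a \<inter> \<Union>N') = 1" if a: "a \<in> K'" for a
    proof (cases "a = h''")
      case True
      then show ?thesis by (simp add: hN)
    next
      case False
      then have "a \<in> K" "a \<noteq> h" using a by (auto simp: K'_def)
      then show ?thesis using one[of a] oN[of a] by simp
    qed
    show "a \<inter> \<Union>N' \<noteq> {}" if a: "a \<in> K'" for a using single'[OF a] by auto
    show "card (verts G) = (k - 1) * card (N' \<union> K')"
    proof -
      have "N' \<union> K' = insert g' (insert h'' ((N \<union> K) - {g} - {h}))"
        using rN rK h gN NK by (auto simp: N'_def K'_def)
      moreover have "g' \<notin> insert h'' ((N \<union> K) - {g} - {h})"
        using g'N rg' rh' rK by auto
      moreover have "h'' \<notin> (N \<union> K) - {g} - {h}" using h'K rh' rN by auto
      ultimately have "card (N' \<union> K') = Suc (Suc (card ((N \<union> K) - {g} - {h})))"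
        using finE by simp
      also have "\<dots> = card (N \<union> K)"
      proof -
        have "h \<in> (N \<union> K) - {g}" "g \<in> N \<union> K" using h gN gh ph by auto
        then show ?thesis using finE by (simp only: card_Suc_Diff1 finite_UnI finite_Diff)
      qed
      finally show ?thesis using cardV by simp
    qed
    show "v = p \<and> {a, b} = {e, g'}"
      if a: "a \<in> N'" "b \<in> N'" "v \<in> a" "v \<in> b" "v \<noteq> r" "a \<noteq> b" for v a b
    proof -
      have main: "v = p \<and> b = e" if b: "b \<in> N - {g}" "v \<in> b" "v \<in> g'" for b
      proof (cases "v = p")
        case True
        then show ?thesis using pN b by auto
      next
        case False
        then have "v \<in> g" using b by (auto simp: g'_def)
        then show ?thesis using uniq[of b g v] b gN a(5) by auto
      qed
      consider "a = g'" "b \<in> N - {g}" | "b = g'" "a \<in> N - {g}" | "a \<in> N - {g}" "b \<in> N - {g}"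
        using a by (auto simp: N'_def)
      then show ?thesis
      proof cases
        case 1
        then show ?thesis using main[of b] a by auto
      next
        case 2
        then show ?thesis using main[of a] a by auto
      next
        case 3
        then show ?thesis using uniq[of a b v] a by auto
      qed
    qed
    show "e \<noteq> g'" using g'N e by auto
    show "p \<in> g'" by (simp add: g'_def)
    show "e \<in> N'" using e ge by (auto simp: N'_def)
    show "g' \<in> N'" by (simp add: N'_def)
    show "\<And>a. a \<in> N' \<union> K' \<Longrightarrow> a \<subseteq> verts G \<and> card a = k"
      using uni sub cg ch by (auto simp: N'_def K'_def)
    show "\<And>a. a \<in> N' \<Longrightarrow> r \<in> a" using rN rg' by (auto simp: N'_def)
    show "\<And>a. a \<in> K' \<Longrightarrow> r \<notin> a" using rK rh' by (auto simp: K'_def)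
  qed (simp_all add: k3 finV e pr N'_def)
  have cK: "card K' = card K"
  proof -
    have "card K' = Suc (card (K - {h}))" unfolding K'_def using finE h'K by simp
    then show ?thesis using h finE by (metis card_Suc_Diff1)
  qed
  have mH: "matching_number \<lparr>verts = verts G, edges = N' \<union> K'\<rparr> = z"
    using H.matching_number cK z by simp
  have le: "spectral_radius k \<lparr>verts = verts G, edges = N' \<union> K'\<rparr> \<le> spectral_radius k G"
    using maxG[OF H.unicyclic] mH by simp
  have k2: "k \<ge> 2" using k3 by simp
  obtain x where x: "\<forall>v\<in>verts G. x v > 0"
    and eig: "\<forall>v\<in>verts G. load (edges G) x v = spectral_radius k G * x v ^ k"
    using perron_vector[OF unif con k2] by blast
  interpret Q: star_perron k "verts G" N K r g x "spectral_radius k G"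
    by unfold_locales (use x eig E N3 in simp_all)
  let ?a = "Q.al"
  define s where "s = sqrt ?a"
  have s: "s > 0" "s < 1" "s\<^sup>2 = ?a" using Q.al0 Q.al1 by (auto simp: s_def)
  define w where "w = sqrt (1 - ?a)"
  have w: "w > 0" "w\<^sup>2 = 1 - s\<^sup>2" using Q.al0 Q.al1 s by (auto simp: w_def)
  define c where "c = 1 / w"
  have c1: "c \<ge> 1"
  proof -
    have "w \<le> 1" using Q.al0 by (simp add: w_def)
    then show ?thesis using w by (simp add: c_def)
  qed
  have c2: "c\<^sup>2 = Q.bt" using w s by (simp add: c_def Q.bt_def power_divide)
  have btj: "Q.bt ^ i = (c ^ i)\<^sup>2" for i
    unfolding c2[symmetric] by (simp only: power_mult[symmetric] mult.commute)
  define j where "j = card (\<Union>K \<inter> (e - {p, q}))"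
  define Q0 where "Q0 = c ^ j"
  have Q0pos: "Q0 > 0" using c1 by (simp add: Q0_def)
  \<comment> \<open>The terms that do not change. The edge \<open>g\<close> meets no edge of
    \<open>K\<close> and accounts for the summand 1 in the equation below.\<close>
  define T where "T = (\<Sum>a\<in>N - {e, g}. Q.bt ^ card (\<Union>K \<inter> a))"
  have eq: "?a * ((Q0 / (1 - s))\<^sup>2 + 1 + T) = 1"
  proof -
    have "(\<Sum>a\<in>N - {e}. Q.bt ^ card (\<Union>K \<inter> a)) = 1 + T"
    proof -
      have "(\<Sum>a\<in>N - {e}. Q.bt ^ card (\<Union>K \<inter> a)) =
          Q.bt ^ card (\<Union>K \<inter> g) + (\<Sum>a\<in>N - {e} - {g}. Q.bt ^ card (\<Union>K \<inter> a))"
        using finE gN ge by (intro sum.remove) auto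
      moreover have "\<Union>K \<inter> g = {}" using gK by (auto simp: disjnt_iff)
      moreover have "N - {e} - {g} = N - {e, g}" by auto
      ultimately show ?thesis by (simp add: T_def)
    qed
    then show ?thesis
      using Q.loop_characteristic[OF h pq e one uniq]
      by (simp add: s_def j_def Q0_def btj power_divide add.assoc)
  qed
  have T1: "T \<ge> 1"
  proof -
    have "\<not> N \<subseteq> {e, g}" using N3 by (rule not_subset_pair)
    then obtain a where a: "a \<in> N - {e, g}" by auto
    have "1 \<le> Q.bt ^ card (\<Union>K \<inter> a)" using Q.bt1 by (intro one_le_power) auto
    also have "\<dots> \<le> T" unfolding T_def using a finE Q.bt1 by (intro member_le_sum) auto
    finally show ?thesis .
  qed
  \<comment> \<open>Dropping the positive term \<open>T\<close> from the characteristic equation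
    gives this strict bound.\<close>
  have "s * Q0 < (1 - s) * w"
  proof -
    have "?a * ((Q0 / (1 - s))\<^sup>2 + 1) < ?a * ((Q0 / (1 - s))\<^sup>2 + 1 + T)"
      using Q.al0 T1 by (intro mult_strict_left_mono) auto
    then have "s\<^sup>2 * ((Q0 / (1 - s))\<^sup>2 + 1) < 1" using eq s by simp
    then have "s\<^sup>2 * (Q0 / (1 - s))\<^sup>2 < w\<^sup>2" using w by (simp add: algebra_simps)
    then have "(s * (Q0 / (1 - s)))\<^sup>2 < w\<^sup>2" by (simp only: power_mult_distrib)
    then have "s * (Q0 / (1 - s)) < w" using w by (meson power2_less_imp_less less_imp_le)
    then show ?thesis using s by (simp add: field_simps)
  qed
  then have "(Q0 / (1 - s))\<^sup>2 < (Q0 / w)\<^sup>2 + 2 * (Q0 / w)"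
    using s w Q0pos by (intro loop_inequality) auto
  then have "?a * ((Q0 / (1 - s))\<^sup>2 + 1 + T) < ?a * ((Q0 / w)\<^sup>2 + 2 * (Q0 / w) + 1 + T)"
    using Q.al0 by (intro mult_strict_left_mono) auto
  \<comment> \<open>In the new hypergraph \<open>e\<close> has the attachment vertex
    \<open>q\<close> in addition to the \<open>j\<close> others, and \<open>g'\<close> has none. The
    summand 1 of \<open>g\<close> completes the square.\<close>
  also have "(Q0 / w)\<^sup>2 + 2 * (Q0 / w) + 1 = (c ^ (j + 1) + 1)\<^sup>2"
    by (simp add: power2_sum Q0_def c_def algebra_simps)
  finally have gt: "1 < ?a * ((c ^ (j + 1) + 1)\<^sup>2 + T)" using eq by simp
  have ye: "y \<notin> e" using yN[of e] e ge by auto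
  have A1: "card (\<Union>K' \<inter> \<Union>N' \<inter> e) = j + 1"
  proof -
    have "\<Union>K' \<inter> \<Union>N' \<inter> e = insert q (\<Union>K \<inter> (e - {p, q}))"
    proof (intro equalityI subsetI)
      fix v assume v: "v \<in> \<Union>K' \<inter> \<Union>N' \<inter> e"
      then consider "v \<in> h''" | h' where "h' \<in> K - {h}" "v \<in> h'" by (auto simp: K'_def)
      then show "v \<in> insert q (\<Union>K \<inter> (e - {p, q}))"
      proof cases
        case 1
        then show ?thesis using v hN by auto
      next
        case 2
        then show ?thesis using v pK[of h'] by auto
      qed
    next
      fix v assume v: "v \<in> insert q (\<Union>K \<inter> (e - {p, q}))"
      show "v \<in> \<Union>K' \<inter> \<Union>N' \<inter> e"
      proof (cases "v = q")
        case True
        then show ?thesis using hN e by (auto simp: K'_def)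
      next
        case False
        then obtain h' where h': "h' \<in> K" "v \<in> h'" "v \<in> e" "v \<noteq> p" using v by auto
        then have "h' \<noteq> h" using pq False e by auto
        then show ?thesis using h' ye e by (auto simp: K'_def UN)
      qed
    qed
    moreover have "finite (\<Union>K \<inter> (e - {p, q}))" using fin_edge e by auto
    ultimately show ?thesis by (simp add: j_def)
  qed
  have A2: "\<Union>K' \<inter> \<Union>N' \<inter> g' = {}" using H.gK by (auto simp: disjnt_iff)
  have A3: "\<Union>K' \<inter> \<Union>N' \<inter> a = \<Union>K \<inter> a" if a: "a \<in> N - {e, g}" for a
  proof -
    have "p \<notin> a" "q \<notin> a" "y \<notin> a" using a pN qN yN by auto
    moreover have "a \<inter> h = {}" using calculation pq a by auto
    ultimately show ?thesis using a by (auto simp: K'_def h''_def UN)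
  qed
  have N'': "N' - {e, g'} = N - {e, g}" using g'N by (auto simp: N'_def)
  have "twin_char N' e g' (\<Union>K' \<inter> \<Union>N') c = (c ^ (j + 1) + 1)\<^sup>2 + T"
    unfolding twin_char_def A1 A2 N'' T_def using A3 by (simp add: power_mult c2)
  then have "spectral_radius k G < spectral_radius k \<lparr>verts = verts G, edges = N' \<union> K'\<rparr>"
    using gt Q.al0 Q.al1 Q.\<rho>pos
    by (intro H.spectral_radius_greater[of ?a]) (auto simp: Q.al_def c_def w_def)
  then show False using le by simp
qed

text \<open>When \<open>K\<close> contributes to the cycle, only \<open>card N = 2\<close> survives.
  Then \<open>e\<close> and \<open>h\<close> form a 2-cycle with common vertices \<open>p\<close>
  and \<open>q\<close>; taking \<open>p\<close> as the new centre makes \<open>g\<close> a pendant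
  edge at \<open>r\<close>, and \<open>h\<close> becomes the edge at the centre that meets no edge
  of the new matching.\<close>

lemma twin_structure:
  obtains N K r g v2 e1 e2 where "twin_star k (verts G) N K r g v2 e1 e2"
    "edges G = N \<union> K" "card K + 1 = z"
proof -
  obtain N K r g where core: "star_core k (verts G) N K r g" and E: "edges G = N \<union> K"
    and z: "card K + 1 = z" using star_core_structure by blast
  interpret star_core k "verts G" N K r g by (rule core)
  show ?thesis
  proof (cases rule: sunflower_cases)
    case (twin v2 e1 e2)
    then show ?thesis using that E z by blast
  next
    case (loop h p q)
    note uniq = loop(5)
    have k2: "k \<ge> 2" using k3 by simp
    obtain x where x: "\<forall>v\<in>verts G. x v > 0"
      and eig: "\<forall>v\<in>verts G. load (edges G) x v = spectral_radius k G * x v ^ k"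
      using perron_vector[OF unif con k2] by blast
    have "p \<in> h \<inter> \<Union>N" "q \<in> h \<inter> \<Union>N" unfolding loop(3) by auto
    then obtain e e' where e: "e \<in> N" "p \<in> e" "e' \<in> N" "q \<in> e'" by auto
    have qp: "h \<inter> \<Union>N = {q, p}" unfolding loop(3) by auto
    have ee: "e = e'"
    proof (rule ccontr)
      assume ne: "e \<noteq> e'"
      show False
      proof (cases "x q \<le> x p")
        case True
        then show False
          using no_loop_two_edges[OF core E z loop(1,2,3) e ne _ x eig] uniq by blast
      next
        case False
        then show False
          using no_loop_two_edges[OF core E z loop(1) loop(2)[symmetric] qp e(3,4,1,2) ne[symmetric] _ x eig]
            uniq by (meson linear)
      qed
    qed
    have "card N < 3"
    proof (rule ccontr)
      assume "\<not> card N < 3"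
      then show False
        using no_loop_one_edge[OF core E z loop(1,2,3) e(1,2) e(4)[folded ee] loop(4) uniq] by simp
    qed
    moreover have ge: "g \<noteq> e" using gK[OF loop(1)] loop(3) e by (auto simp: disjnt_iff)
    have "card {g, e} \<le> card N" using finE gN e by (intro card_mono) auto
    ultimately have "{g, e} = N" using ge finE gN e by (intro card_subset_eq) auto
    then have N: "N = {e, g}" by auto
    have ph: "p \<in> h" "q \<in> h" using loop(3) by auto
    have pr: "p \<noteq> r" "q \<noteq> r" using rK[OF loop(1)] ph by auto
    have hN: "h \<notin> N" using NK loop(1) by auto
    have gh: "g \<inter> h = {}" using gK[OF loop(1)] by (auto simp: disjnt_def)
    have eh: "e \<inter> h = {p, q}" using loop(3) gh N by auto
    have eg: "e \<inter> g = {r}" using uniq[of e g] e gN ge rN by auto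
    define K' where "K' = insert g (K - {h})"
    have hK: "h' \<inter> h = {}" if "h' \<in> K - {h}" for h'
      using disjK that loop(1) by (auto simp: pairwise_def disjnt_def)
    have hg: "h' \<inter> g = {}" if "h' \<in> K" for h'
      using gK[OF that] by (auto simp: disjnt_def)
    have E': "{e, h} \<union> K' = N \<union> K" using N loop(1) by (auto simp: K'_def)
    have one: "card (a \<inter> \<Union>{e, h}) = 1" if a: "a \<in> K'" for a
    proof (cases "a = g")
      case True
      then have "a \<inter> \<Union>{e, h} = {r}" using eg gh by auto
      then show ?thesis by simp
    next
      case False
      then have aK: "a \<in> K - {h}" using a by (auto simp: K'_def)
      then have "a \<inter> \<Union>{e, h} = a \<inter> \<Union>N" using hK[OF aK] hg[of a] N by auto
      then show ?thesis using loop(4) aK by auto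
    qed
    have "twin_star k (verts G) {e, h} K' p h q e h"
    proof
      show "verts G = \<Union>{e, h} \<union> \<Union>K'"
        using cover E' by (metis Union_Un_distrib)
      show "pairwise disjnt K'"
        using disjK gK by (auto simp: K'_def pairwise_def disjnt_sym)
      show "a \<inter> \<Union>{e, h} \<noteq> {}" if "a \<in> K'" for a using one[OF that] by auto
      show "card (verts G) = (k - 1) * card ({e, h} \<union> K')" unfolding E' by (rule cardV)
      show "\<And>a. a \<in> {e, h} \<union> K' \<Longrightarrow> a \<subseteq> verts G \<and> card a = k" unfolding E' by (rule uni)
      show "p \<notin> a" if "a \<in> K'" for a using that gh hK[of a] ph by (auto simp: K'_def)
      show "disjnt h a" if "a \<in> K'" for a
        using that gh hK[of a] by (auto simp: K'_def disjnt_def)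
      show "v = q \<and> {a, b} = {e, h}"
        if "a \<in> {e, h}" "b \<in> {e, h}" "v \<in> a" "v \<in> b" "v \<noteq> p" "a \<noteq> b" for v a b
        using that eh by blast
      show "e \<noteq> h" using hN e by auto
    qed (use k3 finV e ee ph loop(2) one in auto)
    moreover have "edges G = {e, h} \<union> K'" using E E' by simp
    moreover have "card K' + 1 = z"
    proof -
      have "g \<notin> K - {h}" using NK gN by auto
      then have "card K' = Suc (card (K - {h}))" using finE by (simp add: K'_def)
      then show ?thesis using z loop(1) finE by (metis card_Suc_Diff1)
    qed
    ultimately show ?thesis using that by blast
  qed
qed

end

section \<open>Optimal distribution of the pendant edges\<close>


text \<open>The remaining optimisation problem. The numbers \<open>f\<close>, \<open>i\<close>,
  \<open>j\<close>, \<open>l b\<close> count attachment vertices at \<open>v2\<close>, inside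
  \<open>e1\<close>, inside \<open>e2\<close> and in the branch \<open>b\<close>. By
  \<open>free\<close> some edge at the centre carries none; \<open>opt\<close> compares only with
  distributions that leave a branch empty, and \<open>ij\<close> fixes the order of the two cycle
  edges.\<close>

locale config =
  fixes k T :: nat and c :: real and B :: "'b set" and f i j :: nat and l :: "'b \<Rightarrow> nat"
  assumes k3: "k \<ge> 3" and c1: "c > 1" and finB: "finite B" and neB: "B \<noteq> {}"
    and bounds: "f \<le> 1" "i \<le> k - 2" "j \<le> k - 2" "\<And>b. b \<in> B \<Longrightarrow> l b \<le> k - 1"
    and total: "f + i + j + sum l B = T"
    and free: "(\<exists>b\<in>B. l b = 0) \<or> (f = 0 \<and> (i = 0 \<or> j = 0))"
    and ij: "j \<le> i"
    and opt: "\<And>f' i' j' l'. f' \<le> 1 \<Longrightarrow> i' \<le> k - 2 \<Longrightarrow> j' \<le> k - 2 \<Longrightarrow> \<forall>b\<in>B. l' b \<le> k - 1 \<Longrightarrow>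
      f' + i' + j' + sum l' B = T \<Longrightarrow> (\<exists>b\<in>B. l' b = 0) \<Longrightarrow>
      (c ^ (f' + i') + c ^ (f' + j'))\<^sup>2 + (\<Sum>b\<in>B. c ^ (2 * l' b)) \<le>
      (c ^ (f + i) + c ^ (f + j))\<^sup>2 + (\<Sum>b\<in>B. c ^ (2 * l b))"
begin

lemma pow_less: "a < b \<Longrightarrow> c ^ a < c ^ b"
  using c1 by (rule power_strict_increasing[rotated])

lemma pow_le: "a \<le> b \<Longrightarrow> c ^ a \<le> c ^ b"
  using c1 by (intro power_increasing) auto

lemma pow_pos: "c ^ a > 0"
  using c1 by simp

text \<open>Only the cycle and one branch change, so the terms of all other branches cancel.\<close>

lemma opt_one:
  assumes b: "b \<in> B" and f': "f' \<le> 1" and i': "i' \<le> k - 2" and j': "j' \<le> k - 2" and x: "x \<le> k - 1"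
    and sum: "f' + i' + j' + x = f + i + j + l b"
    and free': "x = 0 \<or> (\<exists>a\<in>B - {b}. l a = 0)"
  shows "(c ^ (f' + i') + c ^ (f' + j'))\<^sup>2 + c ^ (2 * x) \<le>
      (c ^ (f + i) + c ^ (f + j))\<^sup>2 + c ^ (2 * l b)"
proof -
  have s: "sum h B = h b + sum h (B - {b})" for h :: "'b \<Rightarrow> nat"
    using finB b by (rule sum.remove)
  have sr: "sum h B = h b + sum h (B - {b})" for h :: "'b \<Rightarrow> real"
    using finB b by (rule sum.remove)
  have r: "sum (l(b := x)) (B - {b}) = sum l (B - {b})"
    by (intro sum.cong) auto
  have rr: "(\<Sum>a\<in>B - {b}. c ^ (2 * (l(b := x)) a)) = (\<Sum>a\<in>B - {b}. c ^ (2 * l a))"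
    by (intro sum.cong) auto
  have "(c ^ (f' + i') + c ^ (f' + j'))\<^sup>2 + (\<Sum>a\<in>B. c ^ (2 * (l(b := x)) a)) \<le>
      (c ^ (f + i) + c ^ (f + j))\<^sup>2 + (\<Sum>a\<in>B. c ^ (2 * l a))"
  proof (rule opt[OF f' i' j'])
    show "\<forall>a\<in>B. (l(b := x)) a \<le> k - 1" using bounds(4) x by auto
    show "f' + i' + j' + sum (l(b := x)) B = T"
      using total sum s[of l] s[of "l(b := x)"] r by simp
    show "\<exists>a\<in>B. (l(b := x)) a = 0" using free' b by auto
  qed
  then show ?thesis
    unfolding sr[of "\<lambda>a. c ^ (2 * (l(b := x)) a)"] sr[of "\<lambda>a. c ^ (2 * l a)"] rr by simp
qed

text \<open>Without an empty branch \<open>f\<close> and \<open>j\<close> vanish, so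
  \<open>e2\<close> carries nothing. Emptying a branch into \<open>e2\<close> merely permutes the
  squares and enlarges the cross term. A full branch has one attachment too many for the
  \<open>k - 2\<close> places of \<open>e2\<close>; the extra one goes to \<open>v2\<close>.\<close>

lemma free_branch: "\<exists>b\<in>B. l b = 0"
proof (rule ccontr)
  assume n: "\<not> ?thesis"
  then have f0: "f = 0" and j0: "j = 0" using free ij by auto
  obtain b where b: "b \<in> B" using neB by auto
  then have lb: "l b \<ge> 1" using n by (cases "l b") auto
  have lk: "l b \<le> k - 1" using bounds(4)[OF b] .
  show False
  proof (cases "l b \<le> k - 2")
    case True
    have "(c ^ i + c ^ l b)\<^sup>2 + 1 \<le> (c ^ i + 1)\<^sup>2 + c ^ (2 * l b)"
      using opt_one[OF b, of 0 i "l b" 0] bounds True f0 j0 by simp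
    then have "c ^ i * c ^ l b \<le> c ^ i"
      by (simp add: power2_eq_square power_mult algebra_simps)
    then have "c ^ l b \<le> 1" using pow_pos[of i] by simp
    then show False using pow_less[of 0 "l b"] lb by simp
  next
    case False
    then have lb': "l b = k - 1" using lk by simp
    have le0: "(c ^ (1 + i) + c ^ (1 + (k - 2)))\<^sup>2 + c ^ (2 * 0) \<le> (c ^ (f + i) + c ^ (f + j))\<^sup>2 + c ^ (2 * l b)"
      using bounds f0 j0 lb' k3 by (intro opt_one[OF b]) auto
    have k1: "1 + (k - 2) = k - 1" using k3 by simp
    have le: "(c ^ (1 + i) + c ^ (k - 1))\<^sup>2 + 1 \<le> (c ^ i + 1)\<^sup>2 + (c ^ (k - 1))\<^sup>2"
      using le0[unfolded k1] f0 j0 lb' by (simp add: power_even_eq)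
    have "c ^ (1 + i) > c ^ i" by (rule pow_less) simp
    moreover have "c ^ (k - 1) > 1" using pow_less[of 0 "k - 1"] k3 by simp
    ultimately have 1: "c ^ (1 + i) * c ^ (k - 1) > c ^ i * 1"
      using pow_pos by (intro mult_strict_mono) (auto simp: less_imp_le)
    have 2: "(c ^ (1 + i))\<^sup>2 > (c ^ i)\<^sup>2"
      using \<open>c ^ (1 + i) > c ^ i\<close> pow_pos[of i] by (intro power_strict_mono) auto
    show False using le 1 2 by (simp only: power2_sum) (simp add: algebra_simps)
  qed
qed

text \<open>An attachment at \<open>v2\<close> counts in both exponents of the square. Moving one
  there from \<open>e1\<close> keeps the exponent of \<open>e1\<close> and raises that of
  \<open>e2\<close>. If the cycle edges are empty, a whole branch is moved to \<open>v2\<close> and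
  \<open>e1\<close>.\<close>

lemma f_one:
  assumes "T \<ge> 1"
  shows "f = 1"
proof (rule ccontr)
  assume "f \<noteq> 1"
  then have f0: "f = 0" using bounds(1) by simp
  show False
  proof (cases "i \<ge> 1")
    case True
    obtain b where b: "b \<in> B" "l b = 0" using free_branch by auto
    have "(c ^ (1 + (i - 1)) + c ^ (1 + j))\<^sup>2 + c ^ (2 * 0) \<le> (c ^ (f + i) + c ^ (f + j))\<^sup>2 + c ^ (2 * l b)"
      using bounds f0 True b by (intro opt_one[OF b(1)]) auto
    then have "(c ^ i + c ^ (1 + j))\<^sup>2 \<le> (c ^ i + c ^ j)\<^sup>2" using True f0 b by simp
    then have "c ^ i + c ^ (1 + j) \<le> c ^ i + c ^ j"
      by (rule power2_le_imp_le) (simp add: pow_pos less_imp_le add_nonneg_nonneg)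
    then show False using pow_less[of j "1 + j"] by simp
  next
    case False
    then have ij0: "i = 0" "j = 0" using ij by auto
    then have "sum l B \<noteq> 0" using total f0 assms by simp
    then obtain b where b: "b \<in> B" "l b \<noteq> 0" by (meson sum.neutral)
    have "(c ^ (1 + (l b - 1)) + c ^ (1 + 0))\<^sup>2 + c ^ (2 * 0) \<le> (c ^ (f + i) + c ^ (f + j))\<^sup>2 + c ^ (2 * l b)"
      using bounds(4)[OF b(1)] f0 ij0 b by (intro opt_one[OF b(1)]) auto
    then have "(c ^ l b + c)\<^sup>2 + 1 \<le> 4 + (c ^ l b)\<^sup>2"
      using b(2) f0 ij0 by (simp add: power_even_eq)
    then have le: "2 * (c ^ l b * c) + c\<^sup>2 \<le> 3" by (simp add: power2_sum)
    have "c ^ l b > 1" using pow_less[of 0 "l b"] b by simp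
    then have "c ^ l b * c > 1 * 1" using c1 by (intro mult_strict_mono) auto
    moreover have "c\<^sup>2 > 1" using c1 by simp
    ultimately show False using le by simp
  qed
qed

text \<open>Otherwise one attachment can be moved from \<open>e2\<close> to \<open>e1\<close>, and
  by convexity of the powers of \<open>c\<close> the sum inside the square increases.\<close>

lemma first_full: "j = 0 \<or> i = k - 2"
proof (rule ccontr)
  assume n: "\<not> ?thesis"
  then have j1: "j \<ge> 1" and ik: "i < k - 2" using bounds by auto
  obtain b where b: "b \<in> B" "l b = 0" using free_branch by auto
  have "(c ^ (f + (i + 1)) + c ^ (f + (j - 1)))\<^sup>2 + c ^ (2 * 0) \<le> (c ^ (f + i) + c ^ (f + j))\<^sup>2 + c ^ (2 * l b)"
    using bounds j1 ik b by (intro opt_one[OF b(1)]) auto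
  then have "(c ^ (f + (i + 1)) + c ^ (f + (j - 1)))\<^sup>2 \<le> (c ^ (f + i) + c ^ (f + j))\<^sup>2"
    using b by simp
  then have le: "c ^ (f + (i + 1)) + c ^ (f + (j - 1)) \<le> c ^ (f + i) + c ^ (f + j)"
    by (rule power2_le_imp_le) (simp add: pow_pos less_imp_le add_nonneg_nonneg)
  let ?u = "c ^ (f + (j - 1))" let ?v = "c ^ (f + i)"
  have "c ^ (f + j) = ?u * c" using j1 by (cases j) (auto simp: mult.commute)
  moreover have "c ^ (f + (i + 1)) = ?v * c" by (simp add: mult.commute)
  ultimately have "(?v - ?u) * (c - 1) \<le> 0" using le by (simp add: algebra_simps)
  moreover have "?v > ?u" using ij j1 by (intro pow_less) auto
  ultimately show False using c1 by (simp add: mult_le_0_iff)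
qed

text \<open>One attachment moves from a branch with \<open>a\<close> of them to a cycle edge of
  exponent \<open>s + 1\<close>; \<open>M\<close> is the power of the other cycle edge. Since
  \<open>a - 1 \<le> s + 1\<close>, the squares do not lose in total, and the cross term with
  \<open>M\<close> is pure gain.\<close>

lemma slot_gain:
  assumes M: "M > 0" and a: "a \<ge> 1" "a \<le> s + 2"
  shows "(c ^ (s + 1) + M)\<^sup>2 + c ^ (2 * a) < (c ^ (s + 2) + M)\<^sup>2 + c ^ (2 * (a - 1))"
proof -
  define u where "u = c ^ (a - 1)"
  define v where "v = c ^ (s + 1)"
  have ca: "c ^ a = u * c" using a by (cases a) (auto simp: u_def mult.commute)
  have cs: "c ^ (s + 2) = v * c" by (simp add: v_def mult.commute)
  have uv: "u \<le> v" unfolding u_def v_def using a by (intro pow_le) auto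
  have u0: "u > 0" "v > 0" unfolding u_def v_def by (rule pow_pos)+
  have "(v * c + M)\<^sup>2 + u\<^sup>2 - ((v + M)\<^sup>2 + (u * c)\<^sup>2) =
      (v\<^sup>2 - u\<^sup>2) * (c\<^sup>2 - 1) + 2 * M * v * (c - 1)"
    by (simp add: power2_eq_square algebra_simps)
  moreover have "v\<^sup>2 - u\<^sup>2 \<ge> 0" using uv u0 by (simp add: power_mono)
  moreover have "c\<^sup>2 - 1 \<ge> 0" using c1 by (simp add: less_imp_le)
  moreover have "2 * M * v * (c - 1) > 0" using M u0 c1 by simp
  ultimately have "(v * c + M)\<^sup>2 + u\<^sup>2 - ((v + M)\<^sup>2 + (u * c)\<^sup>2) > 0"
    by (simp add: add_nonneg_pos)
  then show ?thesis unfolding power_even_eq ca cs u_def[symmetric] v_def[symmetric] by simp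
qed

text \<open>For a larger branch the two exponents are exchanged: the squares are only permuted, and
  the cross term with \<open>M\<close> grows.\<close>

lemma slot_swap:
  assumes M: "M > 0" and a: "a \<ge> s + 3"
  shows "(c ^ (s + 1) + M)\<^sup>2 + c ^ (2 * a) < (c ^ a + M)\<^sup>2 + c ^ (2 * (s + 1))"
proof -
  have "M * c ^ (s + 1) < M * c ^ a" using a M by (intro mult_strict_left_mono pow_less) auto
  then show ?thesis by (simp only: power2_sum power_even_eq) (simp add: algebra_simps)
qed

text \<open>A cycle edge with a free place gains from any nonempty branch, by a single move if the
  branch is small and by exchanging the exponents if it is large.\<close>

lemma branches_last:
  assumes b: "b \<in> B" "l b \<noteq> 0"
  shows "i = k - 2 \<and> j = k - 2"
proof (rule ccontr)
  assume n: "\<not> ?thesis"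
  obtain a where a: "a \<in> B" "l a = 0" using free_branch by auto
  have ab: "a \<in> B - {b}" using a b by auto
  have "sum l B \<ge> l b" using finB b by (intro member_le_sum) auto
  then have f1: "f = 1" using f_one total b by simp
  have lb: "l b \<le> k - 1" "l b \<ge> 1" using bounds(4) b by auto
  show False
  proof (cases "i = k - 2")
    case False
    then have ik: "i < k - 2" and j0: "j = 0" using bounds first_full by auto
    show False
    proof (cases "l b \<le> i + 2")
      case True
      have "(c ^ (1 + (i + 1)) + c ^ (1 + 0))\<^sup>2 + c ^ (2 * (l b - 1)) \<le> (c ^ (f + i) + c ^ (f + j))\<^sup>2 + c ^ (2 * l b)"
        using bounds ik j0 f1 lb a ab by (intro opt_one[OF b(1)]) auto
      then show False using slot_gain[OF _ lb(2) True, of c] c1 f1 j0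
        by (simp add: add.commute)
    next
      case False
      have "(c ^ (1 + (l b - 1)) + c ^ (1 + 0))\<^sup>2 + c ^ (2 * (i + 1)) \<le> (c ^ (f + i) + c ^ (f + j))\<^sup>2 + c ^ (2 * l b)"
        using bounds ik j0 f1 lb a ab False by (intro opt_one[OF b(1)]) auto
      then show False using slot_swap[of c i "l b"] False c1 f1 j0 lb
        by (simp add: add.commute)
    qed
  next
    case True
    then have jk: "j < k - 2" using n bounds by auto
    let ?M = "c ^ (1 + i)"
    have M: "?M > 0" by (rule pow_pos)
    show False
    proof (cases "l b \<le> j + 2")
      case le: True
      have "(?M + c ^ (1 + (j + 1)))\<^sup>2 + c ^ (2 * (l b - 1)) \<le> (c ^ (f + i) + c ^ (f + j))\<^sup>2 + c ^ (2 * l b)"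
        using bounds jk f1 lb a ab le by (intro opt_one[OF b(1)]) auto
      then show False using slot_gain[OF M lb(2) le] f1
        by (simp add: add.commute)
    next
      case False
      have "(?M + c ^ (1 + (l b - 1)))\<^sup>2 + c ^ (2 * (j + 1)) \<le> (c ^ (f + i) + c ^ (f + j))\<^sup>2 + c ^ (2 * l b)"
        using bounds jk f1 lb a ab False by (intro opt_one[OF b(1)]) auto
      then show False using slot_swap[OF M, of j "l b"] False f1 lb
        by (simp add: add.commute)
    qed
  qed
qed

text \<open>By convexity of \<open>c^(2 x)\<close>, moving one attachment from the smaller of two
  partially filled branches to the larger increases the sum. The empty branch stays empty, so the
  new distribution is admissible.\<close>

lemma one_partial_aux:
  assumes b: "b \<in> B" "b' \<in> B" "b \<noteq> b'" "0 < l b" "l b < k - 1" "0 < l b'" "l b' < k - 1" "l b \<le> l b'"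
  shows False
proof -
  obtain a where a: "a \<in> B" "l a = 0" using free_branch by auto
  define l' where "l' = l(b := l b - 1, b' := l b' + 1)"
  have fin: "finite (B - {b})" "b' \<in> B - {b}" using finB b by auto
  have s: "sum h B = h b + (h b' + sum h (B - {b} - {b'}))" for h :: "'b \<Rightarrow> nat"
    using sum.remove[OF finB b(1), of h] sum.remove[OF fin, of h] by simp
  have sr: "sum h B = h b + (h b' + sum h (B - {b} - {b'}))" for h :: "'b \<Rightarrow> real"
    using sum.remove[OF finB b(1), of h] sum.remove[OF fin, of h] by simp
  have r: "sum l' (B - {b} - {b'}) = sum l (B - {b} - {b'})"
    by (intro sum.cong) (auto simp: l'_def)
  have rr: "(\<Sum>a\<in>B - {b} - {b'}. c ^ (2 * l' a)) = (\<Sum>a\<in>B - {b} - {b'}. c ^ (2 * l a))"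
    by (intro sum.cong) (auto simp: l'_def)
  have l'b: "l' b = l b - 1" "l' b' = l b' + 1" using b by (auto simp: l'_def)
  have "(c ^ (f + i) + c ^ (f + j))\<^sup>2 + (\<Sum>a\<in>B. c ^ (2 * l' a)) \<le>
      (c ^ (f + i) + c ^ (f + j))\<^sup>2 + (\<Sum>a\<in>B. c ^ (2 * l a))"
  proof (rule opt[OF bounds(1,2,3)])
    show "\<forall>a\<in>B. l' a \<le> k - 1" using bounds(4) b by (auto simp: l'_def)
    show "f + i + j + sum l' B = T" using total s[of l] s[of l'] r l'b b by simp
    show "\<exists>a\<in>B. l' a = 0" using a b by (intro bexI[of _ a]) (auto simp: l'_def)
  qed
  then have le: "c ^ (2 * (l b - 1)) + c ^ (2 * (l b' + 1)) \<le> c ^ (2 * l b) + c ^ (2 * l b')"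
    unfolding sr[of "\<lambda>a. c ^ (2 * l' a)"] sr[of "\<lambda>a. c ^ (2 * l a)"] rr l'b by simp
  let ?u = "c ^ (2 * (l b - 1))" let ?v = "c ^ (2 * l b')"
  have "2 * l b = 2 * (l b - 1) + 2" using b by simp
  then have cb: "c ^ (2 * l b) = ?u * c\<^sup>2" by (simp only: power_add)
  have "2 * (l b' + 1) = 2 * l b' + 2" by simp
  then have cb': "c ^ (2 * (l b' + 1)) = ?v * c\<^sup>2" by (simp only: power_add)
  have "(?v - ?u) * (c\<^sup>2 - 1) \<le> 0" using le unfolding cb cb' by (simp add: algebra_simps)
  moreover have "?v > ?u" using b by (intro pow_less) auto
  moreover have "c\<^sup>2 > 1" using c1 by simp
  ultimately show False by (simp add: mult_le_0_iff)
qed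

lemma one_partial:
  assumes "b \<in> B" "b' \<in> B" "0 < l b" "l b < k - 1" "0 < l b'" "l b' < k - 1"
  shows "b = b'"
  using one_partial_aux[of b b'] one_partial_aux[of b' b] assms by (metis linear)

end

section \<open>Reattaching pendant edges\<close>


context twin_star
begin

abbreviation "in1 \<equiv> e1 - {r, v2}"
abbreviation "in2 \<equiv> e2 - {r, v2}"
abbreviation "branches \<equiv> N - {e1, e2}"

lemma fin_N: "e \<in> N \<Longrightarrow> finite e" using fin_edge by auto

lemma in_cells:
  "finite in1" "finite in2" "card in1 = k - 2" "card in2 = k - 2"
  "b \<in> N \<Longrightarrow> finite b" "b \<in> N \<Longrightarrow> card (b - {r}) = k - 1" "in1 \<inter> in2 = {}"
  "b \<in> branches \<Longrightarrow> b \<inter> in1 = {}" "b \<in> branches \<Longrightarrow> b \<inter> in2 = {}" "b \<in> branches \<Longrightarrow> v2 \<notin> b"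
  "b \<in> branches \<Longrightarrow> b' \<in> branches \<Longrightarrow> b \<noteq> b' \<Longrightarrow> b \<inter> b' = {r}"
proof -
  have c: "card e1 = k" "card e2 = k" "r \<in> e1" "r \<in> e2" "finite e1" "finite e2"
    using uni e1N e2N rN fin_N by auto
  show "finite in1" "finite in2" using c by auto
  show "card in1 = k - 2" "card in2 = k - 2"
    using c v2e v2r by (auto simp: card_Diff_subset numeral_2_eq_2)
  show "b \<in> N \<Longrightarrow> finite b" by (rule fin_N)
  show "b \<in> N \<Longrightarrow> card (b - {r}) = k - 1" using uni rN fin_N by auto
  show "in1 \<inter> in2 = {}" using overlap[OF e1N e2N] e12 by auto
  show "b \<in> branches \<Longrightarrow> b \<inter> in1 = {}" using overlap[of b e1] e1N by auto
  show "b \<in> branches \<Longrightarrow> b \<inter> in2 = {}" using overlap[of b e2] e2N by auto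
  show "b \<in> branches \<Longrightarrow> v2 \<notin> b"
    using overlap[of b e1 v2] e1N v2e v2r by auto
  show "b \<in> branches \<Longrightarrow> b' \<in> branches \<Longrightarrow> b \<noteq> b' \<Longrightarrow> b \<inter> b' = {r}"
    using overlap[of b b'] rN by auto
qed

lemma UN_cells: "\<Union>N - {r} = {v2} \<union> in1 \<union> in2 \<union> (\<Union>b\<in>branches. b - {r})"
  using e1N e2N v2e v2r by auto

text \<open>The edges of \<open>N\<close> overlap only in \<open>r\<close> and \<open>v2\<close>, so
  \<open>{v2}\<close>, \<open>in1\<close>, \<open>in2\<close> and the sets \<open>b - {r}\<close>
  are disjoint cells. Subsets can be chosen independently in them, and their traces on the edges can
  be read off.\<close>

lemma card_cells:
  assumes S: "S0 \<subseteq> {v2}" "S1 \<subseteq> in1" "S2 \<subseteq> in2" "\<And>b. b \<in> branches \<Longrightarrow> S b \<subseteq> b - {r}"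
  defines "A \<equiv> S0 \<union> S1 \<union> S2 \<union> (\<Union>b\<in>branches. S b)"
  shows "card A = card S0 + card S1 + card S2 + (\<Sum>b\<in>branches. card (S b))"
    "A \<inter> e1 = S0 \<union> S1" "A \<inter> e2 = S0 \<union> S2" "\<And>b. b \<in> branches \<Longrightarrow> A \<inter> b = S b"
    "card (S0 \<union> S1) = card S0 + card S1" "card (S0 \<union> S2) = card S0 + card S2"
proof -
  note c = in_cells
  have f0: "finite S0" "finite S1" "finite S2" using S c(1,2) by (auto intro: finite_subset)
  have fb: "finite (S b)" if "b \<in> branches" for b
    using S(4)[OF that] c(5)[of b] that by (auto intro: finite_subset)
  have fB: "finite branches" using finE by auto
  have d01: "S0 \<inter> S1 = {}" and d02: "S0 \<inter> S2 = {}" and d12: "S1 \<inter> S2 = {}"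
    using S(1,2,3) c(7) by auto
  have db: "(S0 \<union> S1 \<union> S2) \<inter> (\<Union>b\<in>branches. S b) = {}"
  proof -
    have "(S0 \<union> S1 \<union> S2) \<inter> S b = {}" if b: "b \<in> branches" for b
      using S(1,2,3) S(4)[OF b] c(8,9,10)[OF b] by blast
    then show ?thesis by blast
  qed
  have "card (\<Union>b\<in>branches. S b) = (\<Sum>b\<in>branches. card (S b))"
  proof (rule card_UN_disjoint[OF fB])
    show "\<forall>b\<in>branches. finite (S b)" using fb by auto
    show "\<forall>b\<in>branches. \<forall>b'\<in>branches. b \<noteq> b' \<longrightarrow> S b \<inter> S b' = {}"
    proof (intro ballI impI)
      fix b b' assume b: "b \<in> branches" "b' \<in> branches" "b \<noteq> b'"
      show "S b \<inter> S b' = {}" using S(4)[OF b(1)] S(4)[OF b(2)] c(11)[OF b] by blast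
    qed
  qed
  moreover have "card A = card (S0 \<union> S1 \<union> S2) + card (\<Union>b\<in>branches. S b)"
    unfolding A_def using f0 fB fb db by (intro card_Un_disjoint) auto
  moreover have "card (S0 \<union> S1 \<union> S2) = card (S0 \<union> S1) + card S2"
    using f0 d02 d12 by (intro card_Un_disjoint) auto
  moreover show "card (S0 \<union> S1) = card S0 + card S1" using f0 d01 by (intro card_Un_disjoint) auto
  ultimately show "card A = card S0 + card S1 + card S2 + (\<Sum>b\<in>branches. card (S b))" by simp
  show "card (S0 \<union> S2) = card S0 + card S2" using f0 d02 by (intro card_Un_disjoint) auto
  have ne: "e1 \<inter> S2 = {}" "e2 \<inter> S1 = {}" using S(2,3) c(7) by blast+
  have nb: "e1 \<inter> S b = {}" "e2 \<inter> S b = {}" if b: "b \<in> branches" for b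
    using S(4)[OF b] c(8,9,10)[OF b] by blast+
  have sub: "S0 \<subseteq> e1" "S0 \<subseteq> e2" "S1 \<subseteq> e1" "S2 \<subseteq> e2" using S(1,2,3) v2e by auto
  have u: "(\<Union>b\<in>branches. S b) \<inter> e1 = {}" "(\<Union>b\<in>branches. S b) \<inter> e2 = {}" using nb by auto
  have v: "S0 \<inter> e1 = S0" "S0 \<inter> e2 = S0" "S1 \<inter> e1 = S1" "S2 \<inter> e2 = S2" "S2 \<inter> e1 = {}" "S1 \<inter> e2 = {}"
    using sub ne by auto
  show "A \<inter> e1 = S0 \<union> S1" unfolding A_def Int_Un_distrib2 u v by simp
  show "A \<inter> e2 = S0 \<union> S2" unfolding A_def Int_Un_distrib2 u v by simp
  show "A \<inter> b = S b" if b: "b \<in> branches" for b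
  proof -
    have o: "S b' \<inter> b = {}" if b': "b' \<in> branches" "b' \<noteq> b" for b'
      using S(4)[OF b'(1)] c(11)[OF b'(1) b b'(2)] by blast
    have sb: "S b \<subseteq> b" using S(4)[OF b] by blast
    have "(\<Union>b'\<in>branches. S b') \<inter> b = S b"
    proof (intro equalityI subsetI)
      fix y assume "y \<in> (\<Union>b'\<in>branches. S b') \<inter> b"
      then obtain b' where "b' \<in> branches" "y \<in> S b'" "y \<in> b" by auto
      then show "y \<in> S b" using o[of b'] by (cases "b' = b") auto
    qed (use b sb in auto)
    moreover have "(S0 \<union> S1 \<union> S2) \<inter> b = {}" using S(1,2,3) c(8,9,10)[OF b] by blast
    ultimately show ?thesis unfolding A_def by (simp only: Int_Un_distrib2) simp
  qed
qed

lemma decompose: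
  assumes A: "A \<subseteq> \<Union>N - {r}"
  shows "card A = card (A \<inter> {v2}) + card (A \<inter> in1) + card (A \<inter> in2) + (\<Sum>b\<in>branches. card (A \<inter> b))"
    "card (A \<inter> e1) = card (A \<inter> {v2}) + card (A \<inter> in1)"
    "card (A \<inter> e2) = card (A \<inter> {v2}) + card (A \<inter> in2)"
proof -
  have sub: "A \<inter> {v2} \<subseteq> {v2}" "A \<inter> in1 \<subseteq> in1" "A \<inter> in2 \<subseteq> in2"
    "\<And>b. b \<in> branches \<Longrightarrow> A \<inter> b \<subseteq> b - {r}"
    using A by auto
  have eq: "A \<inter> {v2} \<union> A \<inter> in1 \<union> A \<inter> in2 \<union> (\<Union>b\<in>branches. A \<inter> b) = A"
    using A UN_cells by auto
  note c = card_cells[of "A \<inter> {v2}" "A \<inter> in1" "A \<inter> in2" "\<lambda>b. A \<inter> b", OF sub, unfolded eq]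
  show "card A = card (A \<inter> {v2}) + card (A \<inter> in1) + card (A \<inter> in2) + (\<Sum>b\<in>branches. card (A \<inter> b))"
    by (rule c(1))
  show "card (A \<inter> e1) = card (A \<inter> {v2}) + card (A \<inter> in1)"
    using c(2,5) by simp
  show "card (A \<inter> e2) = card (A \<inter> {v2}) + card (A \<inter> in2)"
    using c(3,6) by simp
qed

lemma realise:
  assumes "f \<le> 1" "i \<le> k - 2" "j \<le> k - 2" "\<forall>b\<in>branches. l b \<le> k - 1"
  obtains A where "A \<subseteq> \<Union>N - {r}" "card A = f + i + j + sum l branches"
    "card (A \<inter> e1) = f + i" "card (A \<inter> e2) = f + j" "\<And>b. b \<in> branches \<Longrightarrow> card (A \<inter> b) = l b"
proof -
  obtain S0 where S0: "S0 \<subseteq> {v2}" "card S0 = f"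
    using obtain_subset_with_card_n[of f "{v2}"] assms(1) by auto
  obtain S1 where S1: "S1 \<subseteq> in1" "card S1 = i"
    using obtain_subset_with_card_n[of i in1] assms(2) in_cells(3) by auto
  obtain S2 where S2: "S2 \<subseteq> in2" "card S2 = j"
    using obtain_subset_with_card_n[of j in2] assms(3) in_cells(4) by auto
  have "\<exists>S. S \<subseteq> b - {r} \<and> card S = l b" if b: "b \<in> branches" for b
  proof -
    have "l b \<le> card (b - {r})" using assms(4) in_cells(6)[of b] b by simp
    then show ?thesis by (metis obtain_subset_with_card_n)
  qed
  then obtain S where S: "\<And>b. b \<in> branches \<Longrightarrow> S b \<subseteq> b - {r} \<and> card (S b) = l b" by metis
  then have Ss: "\<And>b. b \<in> branches \<Longrightarrow> S b \<subseteq> b - {r}" by auto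
  note c = card_cells[OF S0(1) S1(1) S2(1) Ss]
  show ?thesis
  proof (rule that)
    show "S0 \<union> S1 \<union> S2 \<union> (\<Union>b\<in>branches. S b) \<subseteq> \<Union>N - {r}"
      unfolding UN_cells by (intro Un_mono S0(1) S1(1) S2(1) UN_mono subset_refl Ss)
    show "card (S0 \<union> S1 \<union> S2 \<union> (\<Union>b\<in>branches. S b)) = f + i + j + sum l branches"
      using c(1) S0(2) S1(2) S2(2) S by simp
  qed (use c S0 S1 S2 S in simp_all)
qed

lemma attachment: "h \<in> K \<Longrightarrow> \<exists>u. h \<inter> \<Union>N = {u}"
  using single by (metis card_1_singletonE)

lemma card_outer: "h \<in> K \<Longrightarrow> card (h - \<Union>N) = k - 1"
proof -
  assume h: "h \<in> K"
  have "card h = card (h \<inter> \<Union>N) + card (h - \<Union>N)"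
    using fin_edge h by (intro card_Int_Diff) auto
  then show ?thesis using uni h single[OF h] by auto
qed

lemma attachments: "\<Union>K \<inter> \<Union>N \<subseteq> \<Union>N - {r}" "card (\<Union>K \<inter> \<Union>N) = card K"
proof -
  show "\<Union>K \<inter> \<Union>N \<subseteq> \<Union>N - {r}" using rK by auto
  have "\<Union>K \<inter> \<Union>N = (\<Union>h\<in>K. h \<inter> \<Union>N)" by auto
  also have "card \<dots> = (\<Sum>h\<in>K. card (h \<inter> \<Union>N))"
    using finE fin_edge disjK by (intro card_UN_disjoint) (auto simp: pairwise_def disjnt_iff)
  also have "\<dots> = card K" using single by simp
  finally show "card (\<Union>K \<inter> \<Union>N) = card K" .
qed

text \<open>Each edge of \<open>K\<close> keeps its \<open>k - 1\<close> outer vertices and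
  exchanges its attachment vertex for an element of \<open>A\<close>, along the bijection
  \<open>\<tau>\<close>. No vertex is lost, and \<open>g'\<close> takes over the role of
  \<open>g\<close>, which preserves the matching number.\<close>

lemma reattach:
  assumes A: "A \<subseteq> \<Union>N - {r}" "card A = card K" and g': "g' \<in> N" "A \<inter> g' = {}"
  obtains K' where "twin_star k V N K' r g' v2 e1 e2" "\<Union>K' \<inter> \<Union>N = A" "card K' = card K"
proof -
  have fA: "finite A" using A(1) fin_UN by (auto intro: finite_subset)
  obtain \<tau> where \<tau>: "bij_betw \<tau> K A"
    using finite_same_card_bij[OF finE(2) fA] A(2) by auto
  then have \<tau>A: "\<tau> h \<in> A" if "h \<in> K" for h using that by (auto simp: bij_betw_def)
  have \<tau>inj: "inj_on \<tau> K" using \<tau> by (auto simp: bij_betw_def)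
  define \<kappa> where "\<kappa> h = insert (\<tau> h) (h - \<Union>N)" for h
  have \<kappa>N: "\<kappa> h \<inter> \<Union>N = {\<tau> h}" if "h \<in> K" for h using \<tau>A[OF that] A(1) by (auto simp: \<kappa>_def)
  have \<kappa>c: "card (\<kappa> h) = k" if h: "h \<in> K" for h
  proof -
    have "\<tau> h \<notin> h - \<Union>N" using \<tau>A[OF h] A(1) by auto
    then show ?thesis using card_outer[OF h] fin_edge[of h] h k3 by (simp add: \<kappa>_def)
  qed
  have \<kappa>d: "\<kappa> h \<inter> \<kappa> h' = {}" if h: "h \<in> K" "h' \<in> K" "h \<noteq> h'" for h h'
  proof -
    have "h \<inter> h' = {}" using disjK h by (auto simp: pairwise_def disjnt_def)
    moreover have "\<tau> h \<noteq> \<tau> h'" using \<tau>inj h by (auto simp: inj_on_def)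
    moreover have "\<tau> h \<in> \<Union>N" "\<tau> h' \<in> \<Union>N" using \<tau>A h A(1) by auto
    ultimately show ?thesis unfolding \<kappa>_def by blast
  qed
  have \<kappa>inj: "inj_on \<kappa> K"
  proof (rule inj_onI, rule ccontr)
    fix h h' assume "h \<in> K" "h' \<in> K" "\<kappa> h = \<kappa> h'" "h \<noteq> h'"
    then show False using \<kappa>d[of h h'] by (auto simp: \<kappa>_def)
  qed
  have Un: "\<Union>(\<kappa> ` K) = A \<union> (\<Union>K - \<Union>N)"
    using \<tau> by (auto simp: \<kappa>_def bij_betw_def)
  have UnN: "\<Union>(\<kappa> ` K) \<inter> \<Union>N = A" unfolding Un using A(1) by auto
  have r\<kappa>: "r \<notin> \<kappa> h" if "h \<in> K" for h using rK[OF that] \<tau>A[OF that] A(1) by (auto simp: \<kappa>_def)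
  have V\<kappa>: "\<kappa> h \<subseteq> V" if "h \<in> K" for h
    using uni[of h] that \<tau>A[OF that] A(1) cover by (auto simp: \<kappa>_def)
  have "twin_star k V N (\<kappa> ` K) r g' v2 e1 e2"
  proof
    show "V = \<Union>N \<union> \<Union>(\<kappa> ` K)" unfolding Un cover using A(1) by auto
    show "pairwise disjnt (\<kappa> ` K)"
      unfolding pairwise_def disjnt_def using \<kappa>d by blast
    show "disjnt g' a" if "a \<in> \<kappa> ` K" for a
    proof -
      have "a \<inter> g' \<subseteq> \<Union>(\<kappa> ` K) \<inter> \<Union>N \<inter> g'" using that g' by auto
      then show ?thesis unfolding UnN using g' by (auto simp: disjnt_def)
    qed
    show "a \<inter> \<Union>N \<noteq> {}" if "a \<in> \<kappa> ` K" for a using that \<kappa>N by auto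
    show "card (a \<inter> \<Union>N) = 1" if "a \<in> \<kappa> ` K" for a using that \<kappa>N by auto
    show "card V = (k - 1) * card (N \<union> \<kappa> ` K)"
    proof -
      have "N \<inter> \<kappa> ` K = {}" using rN r\<kappa> by auto
      then have "card (N \<union> \<kappa> ` K) = card N + card K"
        using finE card_image[OF \<kappa>inj] by (simp add: card_Un_disjoint)
      then show ?thesis using cardV card_E by simp
    qed
    show "\<And>v e e'. e \<in> N \<Longrightarrow> e' \<in> N \<Longrightarrow> v \<in> e \<Longrightarrow> v \<in> e' \<Longrightarrow> v \<noteq> r \<Longrightarrow> e \<noteq> e' \<Longrightarrow>
      v = v2 \<and> {e, e'} = {e1, e2}" by (rule overlap)
    show "a \<subseteq> V \<and> card a = k" if "a \<in> N \<union> \<kappa> ` K" for a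
      using that uni V\<kappa> \<kappa>c by auto
    show "r \<notin> a" if "a \<in> \<kappa> ` K" for a using that r\<kappa> by auto
  qed (simp_all add: k3 finV rN g' e1N e2N e12 v2e v2r)
  then show ?thesis using that UnN card_image[OF \<kappa>inj] by blast
qed

lemma swap: "twin_star k V N K r g v2 e2 e1"
proof
  show "\<And>v e e'. e \<in> N \<Longrightarrow> e' \<in> N \<Longrightarrow> v \<in> e \<Longrightarrow> v \<in> e' \<Longrightarrow> v \<noteq> r \<Longrightarrow> e \<noteq> e' \<Longrightarrow>
      v = v2 \<and> {e, e'} = {e2, e1}" using overlap by (simp add: insert_commute)
qed (simp_all add: e1N e2N e12[symmetric] v2e v2r single[simplified])

end

context extremal
begin

text \<open>The number \<open>c\<close> comes from the spectral radius of \<open>G\<close> and is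
  the same for all competitors \<open>A\<close>. A larger bracket at this \<open>c\<close> would
  yield a hypergraph with the same matching number and larger spectral radius.\<close>

lemma attachment_optimal:
  assumes tw: "twin_star k (verts G) N K r g v2 e1 e2" and E: "edges G = N \<union> K" and z: "card K + 1 = z"
  obtains c where "c > 1" "\<And>A g'. A \<subseteq> \<Union>N - {r} \<Longrightarrow> card A = card K \<Longrightarrow> g' \<in> N \<Longrightarrow> A \<inter> g' = {} \<Longrightarrow>
    twin_char N e1 e2 A c \<le> twin_char N e1 e2 (\<Union>K \<inter> \<Union>N) c"
proof -
  interpret twin_star k "verts G" N K r g v2 e1 e2 by (rule tw)
  have G: "hyp = G" using E by (cases G) simp
  define a where "a = 1 / spectral_radius k G ^ k"
  have a: "0 < a" "a < 1" "a * twin_char N e1 e2 (\<Union>K \<inter> \<Union>N) (1 / sqrt (1 - a)) = 1"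
    "spectral_radius k G > 0"
    using characteristic_root[of a] unfolding G a_def by auto
  show ?thesis
  proof (rule that[of "1 / sqrt (1 - a)"])
    show "1 / sqrt (1 - a) > 1" using a by simp
    fix A g' assume A: "A \<subseteq> \<Union>N - {r}" "card A = card K" "g' \<in> N" "A \<inter> g' = {}"
    obtain K' where K': "twin_star k (verts G) N K' r g' v2 e1 e2" "\<Union>K' \<inter> \<Union>N = A" "card K' = card K"
      using reattach[OF A] by blast
    interpret H: twin_star k "verts G" N K' r g' v2 e1 e2 by (rule K'(1))
    show "twin_char N e1 e2 A (1 / sqrt (1 - a)) \<le> twin_char N e1 e2 (\<Union>K \<inter> \<Union>N) (1 / sqrt (1 - a))"
    proof (rule ccontr)
      assume "\<not> ?thesis"
      then have "a * twin_char N e1 e2 (\<Union>K \<inter> \<Union>N) (1 / sqrt (1 - a)) < a * twin_char N e1 e2 A (1 / sqrt (1 - a))"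
        using a(1) by (intro mult_strict_left_mono) auto
      then have "1 < a * twin_char N e1 e2 (\<Union>K' \<inter> \<Union>N) (1 / sqrt (1 - a))"
        using a(3) K'(2) by simp
      then have "spectral_radius k G < spectral_radius k H.hyp"
        using a by (intro H.spectral_radius_greater[of a]) (auto simp: a_def)
      moreover have "spectral_radius k H.hyp \<le> spectral_radius k G"
        using maxG[OF H.unicyclic] H.matching_number K'(3) z by simp
      ultimately show False by simp
    qed
  qed
qed

lemma config_structure:
  assumes tw: "twin_star k (verts G) N K r g v2 e1 e2" and E: "edges G = N \<union> K" and z: "card K + 1 = z"
    and ne: "N - {e1, e2} \<noteq> {}"
    and ord: "card (\<Union>K \<inter> \<Union>N \<inter> (e2 - {r, v2})) \<le> card (\<Union>K \<inter> \<Union>N \<inter> (e1 - {r, v2}))"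
  obtains c where "config k (card K) c (N - {e1, e2}) (card (\<Union>K \<inter> \<Union>N \<inter> {v2}))
    (card (\<Union>K \<inter> \<Union>N \<inter> (e1 - {r, v2}))) (card (\<Union>K \<inter> \<Union>N \<inter> (e2 - {r, v2})))
    (\<lambda>b. card (\<Union>K \<inter> \<Union>N \<inter> b))"
proof -
  interpret twin_star k "verts G" N K r g v2 e1 e2 by (rule tw)
  let ?A = "\<Union>K \<inter> \<Union>N"
  obtain c where c: "c > 1" and opt: "\<And>A g'. A \<subseteq> \<Union>N - {r} \<Longrightarrow> card A = card K \<Longrightarrow> g' \<in> N \<Longrightarrow> A \<inter> g' = {} \<Longrightarrow>
    twin_char N e1 e2 A c \<le> twin_char N e1 e2 ?A c"
    using attachment_optimal[OF tw E z] by blast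
  note d = decompose[OF attachments(1)]
  have gA: "?A \<inter> g = {}" using gK by (auto simp: disjnt_iff)
  have "config k (card K) c branches (card (?A \<inter> {v2})) (card (?A \<inter> in1)) (card (?A \<inter> in2)) (\<lambda>b. card (?A \<inter> b))"
  proof
    show "card (?A \<inter> {v2}) \<le> 1"
      using card_mono[of "{v2}" "?A \<inter> {v2}"] by auto
    show "card (?A \<inter> in1) \<le> k - 2" "card (?A \<inter> in2) \<le> k - 2"
      using card_mono[of in1 "?A \<inter> in1"] card_mono[of in2 "?A \<inter> in2"] in_cells(1-4) by auto
    show "card (?A \<inter> b) \<le> k - 1" if b: "b \<in> branches" for b
    proof -
      have "?A \<inter> b \<subseteq> b - {r}" using attachments(1) by auto
      then show ?thesis using card_mono[of "b - {r}" "?A \<inter> b"] in_cells(5,6)[of b] b by auto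
    qed
    show "card (?A \<inter> {v2}) + card (?A \<inter> in1) + card (?A \<inter> in2) + (\<Sum>b\<in>branches. card (?A \<inter> b)) = card K"
      using d(1) attachments(2) by simp
    \<comment> \<open>The edge \<open>g\<close> carries no attachment; it is either a branch or one
      of the two cycle edges.\<close>
    show "(\<exists>b\<in>branches. card (?A \<inter> b) = 0) \<or>
      (card (?A \<inter> {v2}) = 0 \<and> (card (?A \<inter> in1) = 0 \<or> card (?A \<inter> in2) = 0))"
    proof (cases "g \<in> branches")
      case True
      then show ?thesis using gA by (metis card.empty)
    next
      case False
      then have "g = e1 \<or> g = e2" using gN by auto
      then show ?thesis using gA d(2,3) by auto
    qed
    fix f' i' j' l'
    assume a: "f' \<le> 1" "i' \<le> k - 2" "j' \<le> k - 2" "\<forall>b\<in>branches. l' b \<le> k - 1"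
      "f' + i' + j' + sum l' branches = card K" "\<exists>b\<in>branches. l' b = 0"
    obtain A where A: "A \<subseteq> \<Union>N - {r}" "card A = f' + i' + j' + sum l' branches"
      "card (A \<inter> e1) = f' + i'" "card (A \<inter> e2) = f' + j'" "\<And>b. b \<in> branches \<Longrightarrow> card (A \<inter> b) = l' b"
      using realise[OF a(1-4)] by blast
    obtain b where b: "b \<in> branches" "l' b = 0" using a(6) by auto
    have "finite (A \<inter> b)" using in_cells(5)[of b] b by auto
    then have "A \<inter> b = {}" using A(5)[OF b(1)] b(2) by simp
    then have "twin_char N e1 e2 A c \<le> twin_char N e1 e2 ?A c"
      using opt[OF A(1)] A(2) a(5) b by auto
    then show "(c ^ (f' + i') + c ^ (f' + j'))\<^sup>2 + (\<Sum>b\<in>branches. c ^ (2 * l' b)) \<le>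
      (c ^ (card (?A \<inter> {v2}) + card (?A \<inter> in1)) + c ^ (card (?A \<inter> {v2}) + card (?A \<inter> in2)))\<^sup>2 +
      (\<Sum>b\<in>branches. c ^ (2 * card (?A \<inter> b)))"
      unfolding twin_char_def A(3,4) d(2,3) using A(5) by simp
  qed (use k3 c finE ne ord in auto)
  then show ?thesis using that by blast
qed

end

section \<open>Isomorphism with the standard hypergraphs\<close>


lemma ex_bij_extend:
  assumes "finite D" "S \<subseteq> D" and a: "bij_betw a S {..<card S}"
  obtains \<beta> where "bij_betw \<beta> D {..<card D}" "\<And>x. x \<in> S \<Longrightarrow> \<beta> x = a x"
proof -
  have fS: "finite S" "finite (D - S)" using assms by (auto intro: finite_subset)
  have le: "card S \<le> card D" using assms by (simp add: card_mono)
  have "card (D - S) = card {card S..<card D}" using assms fS by (simp add: card_Diff_subset)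
  then obtain b where b: "bij_betw b (D - S) {card S..<card D}"
    using finite_same_card_bij[of "D - S"] fS by blast
  let ?\<beta> = "\<lambda>x. if x \<in> S then a x else b x"
  have "bij_betw ?\<beta> (S \<union> (D - S)) ({..<card S} \<union> {card S..<card D})"
    using a b by (intro bij_betw_disjoint_Un) auto
  moreover have "S \<union> (D - S) = D" "{..<card S} \<union> {card S..<card D} = {..<card D}"
    using assms le by auto
  ultimately have "bij_betw ?\<beta> D {..<card D}" by simp
  then show ?thesis by (rule that) simp
qed

text \<open>In the standard hypergraphs the vertices carrying pendant edges are the initial ones of
  each edge, so a given subset has to be enumerated before the rest.\<close>

lemma ex_bij_prefix:
  assumes "finite D" "S \<subseteq> D"
  obtains \<beta> where "bij_betw \<beta> D {..<card D}" "\<beta> ` S = {..<card S}"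
proof -
  have "finite S" using assms by (rule finite_subset[rotated])
  then obtain a where a: "bij_betw a S {..<card S}"
    using finite_same_card_bij[of S "{..<card S}"] by auto
  obtain \<beta> where \<beta>: "bij_betw \<beta> D {..<card D}" "\<And>x. x \<in> S \<Longrightarrow> \<beta> x = a x"
    using ex_bij_extend[OF assms a] by blast
  have "\<beta> ` S = {..<card S}" using a \<beta>(2) by (simp add: bij_betw_def)
  with \<beta>(1) show ?thesis by (rule that)
qed

text \<open>The nested version serves to order the branches: the full ones come before a partial
  one, and the empty ones come last.\<close>

lemma ex_bij_prefix2:
  assumes "finite D" "S \<subseteq> D" "R \<subseteq> S"
  obtains \<beta> where "bij_betw \<beta> D {..<card D}" "\<beta> ` S = {..<card S}" "\<beta> ` R = {..<card R}"
proof -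
  have "finite S" using assms by (simp add: finite_subset)
  then obtain a where a: "bij_betw a S {..<card S}" "a ` R = {..<card R}"
    using ex_bij_prefix[OF _ assms(3)] by blast
  obtain \<beta> where \<beta>: "bij_betw \<beta> D {..<card D}" "\<And>x. x \<in> S \<Longrightarrow> \<beta> x = a x"
    using ex_bij_extend[OF assms(1,2) a(1)] by blast
  have "\<beta> ` S = {..<card S}" using a(1) \<beta>(2) by (simp add: bij_betw_def)
  moreover have "\<beta> ` R = a ` R" using assms(3) \<beta>(2) by (intro image_cong) auto
  ultimately show ?thesis using that[OF \<beta>(1)] a(2) by simp
qed

text \<open>A normal form of \<open>U_edges\<close> in which full, partial and empty branches are
  treated alike and only the set \<open>A\<close> of vertices with a pendant edge varies.\<close>

definition std_edges :: "nat \<Rightarrow> nat \<Rightarrow> uvertex set \<Rightarrow> uvertex set set" where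
  "std_edges k Q A = {{V1, V2} \<union> InE1 ` {..<k - 2}, {V1, V2} \<union> InE2 ` {..<k - 2}}
     \<union> new_edge k V1 ` {..<Q} \<union> (\<lambda>u. new_edge k u 0) ` A"

definition std_attachments :: "nat \<Rightarrow> nat \<Rightarrow> nat \<Rightarrow> nat \<Rightarrow> (nat \<Rightarrow> nat) \<Rightarrow> uvertex set" where
  "std_attachments Q f i j L = {u. u = V2 \<and> f = 1} \<union> InE1 ` {..<i} \<union> InE2 ` {..<j} \<union>
     (\<Union>a<Q. New V1 a ` {..<L a})"

context twin_star
begin

text \<open>The map \<open>\<phi>0\<close> labels the vertices of \<open>N\<close> cell by cell, and
  \<open>\<phi>\<close> labels the outer vertices of an edge of \<open>K\<close> after its
  attachment vertex. The enumerations put the attachment vertices first in each cell, so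
  \<open>\<phi>0\<close> carries them to the standard attachments.\<close>

lemma iso_std:
  assumes \<beta>: "bij_betw \<beta> branches {..<Q}"
    and L: "\<And>b. b \<in> branches \<Longrightarrow> L (\<beta> b) = card (\<Union>K \<inter> \<Union>N \<inter> b)"
  obtains \<phi> where "inj_on \<phi> V" "(`) \<phi> ` (N \<union> K) = std_edges k Q (std_attachments Q
    (card (\<Union>K \<inter> \<Union>N \<inter> {v2})) (card (\<Union>K \<inter> \<Union>N \<inter> in1)) (card (\<Union>K \<inter> \<Union>N \<inter> in2)) L)"
proof -
  let ?A = "\<Union>K \<inter> \<Union>N"
  note c = in_cells
  have rA: "r \<notin> ?A" using attachments(1) by auto
  have int12: "in1 \<inter> in2 = {}" by (rule c(7))
  obtain \<beta>1 where \<beta>1: "bij_betw \<beta>1 in1 {..<k - 2}" "\<beta>1 ` (?A \<inter> in1) = {..<card (?A \<inter> in1)}"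
    using ex_bij_prefix[OF c(1), of "?A \<inter> in1"] c(3) by (metis Int_lower2)
  obtain \<beta>2 where \<beta>2: "bij_betw \<beta>2 in2 {..<k - 2}" "\<beta>2 ` (?A \<inter> in2) = {..<card (?A \<inter> in2)}"
    using ex_bij_prefix[OF c(2), of "?A \<inter> in2"] c(4) by (metis Int_lower2)
  have "\<exists>\<gamma>. bij_betw \<gamma> (b - {r}) {..<k - 1} \<and> \<gamma> ` (?A \<inter> b) = {..<L (\<beta> b)}" if b: "b \<in> branches" for b
  proof -
    have "finite (b - {r})" "card (b - {r}) = k - 1" "?A \<inter> b \<subseteq> b - {r}"
      using c(5,6)[of b] b rA by auto
    then show ?thesis using ex_bij_prefix[of "b - {r}" "?A \<inter> b"] L[OF b] by metis
  qed
  then obtain \<gamma> where \<gamma>: "\<And>b. b \<in> branches \<Longrightarrow> bij_betw (\<gamma> b) (b - {r}) {..<k - 1} \<and> \<gamma> b ` (?A \<inter> b) = {..<L (\<beta> b)}"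
    by metis
  have "\<exists>\<delta>. bij_betw \<delta> (h - \<Union>N) {..<k - 1}" if h: "h \<in> K" for h
  proof -
    have "finite (h - \<Union>N)" using fin_edge h by auto
    then show ?thesis using finite_same_card_bij[of "h - \<Union>N" "{..<k - 1}"] card_outer[OF h] by auto
  qed
  then obtain \<delta> where \<delta>: "\<And>h. h \<in> K \<Longrightarrow> bij_betw (\<delta> h) (h - \<Union>N) {..<k - 1}" by metis
  define att where "att h = (SOME u. h \<inter> \<Union>N = {u})" for h
  have att: "h \<inter> \<Union>N = {att h}" if "h \<in> K" for h
    unfolding att_def using attachment[OF that] by (rule someI_ex)
  define br where "br v = (SOME b. b \<in> branches \<and> v \<in> b)" for v
  define he where "he v = (SOME h. h \<in> K \<and> v \<in> h)" for v
  have br: "br v = b" if b: "b \<in> branches" "v \<in> b" "v \<noteq> r" for v b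
  proof -
    have "br v \<in> branches \<and> v \<in> br v" unfolding br_def using b by (intro someI) auto
    then show ?thesis using c(11)[of "br v" b] b by blast
  qed
  have he: "he v = h" if h: "h \<in> K" "v \<in> h" for v h
  proof -
    have "he v \<in> K \<and> v \<in> he v" unfolding he_def using h by (intro someI) auto
    then show ?thesis using h disjK by (metis disjnt_iff pairwiseD)
  qed
  define \<phi>0 where "\<phi>0 v = (if v = r then V1 else if v = v2 then V2 else if v \<in> e1 then InE1 (\<beta>1 v)
     else if v \<in> e2 then InE2 (\<beta>2 v) else New V1 (\<beta> (br v)) (\<gamma> (br v) v))" for v
  define \<phi> where "\<phi> v = (if v \<in> \<Union>N then \<phi>0 v else New (\<phi>0 (att (he v))) 0 (\<delta> (he v) v))" for v
  have p_r: "\<phi>0 r = V1" and p_2: "\<phi>0 v2 = V2" using v2r by (auto simp: \<phi>0_def)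
  have p_1: "\<phi>0 v = InE1 (\<beta>1 v)" if "v \<in> in1" for v using that by (auto simp: \<phi>0_def)
  have p_in2: "\<phi>0 v = InE2 (\<beta>2 v)" if "v \<in> in2" for v
  proof -
    have "v \<notin> e1" using that int12 by blast
    then show ?thesis using that by (auto simp: \<phi>0_def)
  qed
  have p_b: "\<phi>0 v = New V1 (\<beta> b) (\<gamma> b v)" if b: "b \<in> branches" "v \<in> b - {r}" for v b
  proof -
    have "v \<noteq> v2" "v \<notin> in1" "v \<notin> in2" using b c(8,9,10)[OF b(1)] by blast+
    then show ?thesis using b br[OF b(1), of v] by (auto simp: \<phi>0_def)
  qed
  have cases_N: "v = r \<or> v = v2 \<or> v \<in> in1 \<or> v \<in> in2 \<or> (\<exists>b\<in>branches. v \<in> b - {r})" if "v \<in> \<Union>N" for v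
    using that UN_cells by blast
  have inj1: "\<beta>1 u = \<beta>1 v \<Longrightarrow> u = v" if "u \<in> in1" "v \<in> in1" for u v
    using \<beta>1(1) that by (meson bij_betw_def inj_on_def)
  have inj2: "\<beta>2 u = \<beta>2 v \<Longrightarrow> u = v" if "u \<in> in2" "v \<in> in2" for u v
    using \<beta>2(1) that by (meson bij_betw_def inj_on_def)
  have injb: "b = b' \<and> u = v" if "b \<in> branches" "b' \<in> branches" "u \<in> b - {r}" "v \<in> b' - {r}"
    "\<beta> b = \<beta> b'" "\<gamma> b u = \<gamma> b' v" for b b' u v
  proof -
    have "b = b'" using \<beta> that by (meson bij_betw_def inj_on_def)
    moreover have "inj_on (\<gamma> b) (b - {r})" using \<gamma>[OF that(1)] by (auto simp: bij_betw_def)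
    ultimately show ?thesis using that(3,4,6) by (auto dest: inj_onD)
  qed
  have inj0: "u = v" if uv: "u \<in> \<Union>N" "v \<in> \<Union>N" "\<phi>0 u = \<phi>0 v" for u v
  proof -
    note cu = cases_N[OF uv(1)] and cv = cases_N[OF uv(2)]
    show ?thesis
      using cu
    proof (elim disjE bexE)
      assume "u = r" then show ?thesis using cv uv(3) p_r p_2 p_1 p_in2 p_b by (elim disjE bexE) auto
    next
      assume "u = v2" then show ?thesis using cv uv(3) p_r p_2 p_1 p_in2 p_b by (elim disjE bexE) auto
    next
      assume u: "u \<in> in1"
      then show ?thesis using cv uv(3) p_r p_2 p_1[OF u] p_1[of v] p_in2[of v] p_b[of _ v] inj1[OF u, of v] by (elim disjE bexE) auto
    next
      assume u: "u \<in> in2"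
      then show ?thesis using cv uv(3) p_r p_2 p_in2[OF u] p_1[of v] p_in2[of v] p_b[of _ v] inj2[OF u, of v] by (elim disjE bexE) auto
    next
      fix b assume b: "b \<in> branches" and u: "u \<in> b - {r}"
      show ?thesis
        using cv
      proof (elim disjE bexE)
        fix b' assume b': "b' \<in> branches" and v: "v \<in> b' - {r}"
        then show ?thesis using uv(3) p_b[OF b u] p_b[OF b' v] injb[OF b b' u v] by simp
      qed (use uv(3) p_r p_2 p_1[of v] p_in2[of v] p_b[OF b u] in auto)
    qed
  qed
  \<comment> \<open>Labels \<open>New\<close> of vertices of \<open>N\<close> are based at
    \<open>V1\<close>, whereas outer vertices get labels based at the label of an attachment vertex,
    which is never \<open>V1\<close>. This keeps the two kinds apart.\<close>
  have range0: "\<phi>0 v \<noteq> New w 0 y" if v: "v \<in> \<Union>N" and w: "w \<noteq> V1" for v w y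
    using cases_N[OF v] p_r p_2 p_1[of v] p_in2[of v] p_b[of _ v] w by (elim disjE bexE) auto
  have att_props: "att h \<in> \<Union>N \<and> att h \<in> h \<and> att h \<noteq> r \<and> \<phi>0 (att h) \<noteq> V1" if h: "h \<in> K" for h
  proof -
    have a: "att h \<in> h \<inter> \<Union>N" using att[OF h] by simp
    then have "att h \<noteq> r" using rK[OF h] by auto
    then have "\<phi>0 (att h) \<noteq> V1" using inj0[of "att h" r] p_r a rN[OF gN] gN by auto
    then show ?thesis using a \<open>att h \<noteq> r\<close> by auto
  qed
  have \<phi>N: "\<phi> v = \<phi>0 v" if "v \<in> \<Union>N" for v using that by (simp add: \<phi>_def)
  have \<phi>K: "\<phi> v = New (\<phi>0 (att h)) 0 (\<delta> h v)" if "h \<in> K" "v \<in> h - \<Union>N" for h v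
    using that he[of h v] by (simp add: \<phi>_def)
  have inj: "inj_on \<phi> V"
  proof (rule inj_onI)
    fix u v assume uv: "u \<in> V" "v \<in> V" "\<phi> u = \<phi> v"
    have mixed: "\<phi> u' \<noteq> \<phi> v'" if u': "u' \<in> \<Union>N" and v': "v' \<in> V" "v' \<notin> \<Union>N" for u' v'
    proof -
      obtain h where h: "h \<in> K" "v' \<in> h" using v' cover by auto
      then show ?thesis
        using range0[OF u', of "\<phi>0 (att h)"] att_props[OF h(1)] \<phi>K[OF h(1), of v'] \<phi>N[OF u'] v' by auto
    qed
    show "u = v"
    proof (cases "u \<in> \<Union>N"; cases "v \<in> \<Union>N")
      assume "u \<in> \<Union>N" "v \<in> \<Union>N"
      then show ?thesis using inj0 uv(3) \<phi>N by simp
    next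
      assume "u \<in> \<Union>N" "v \<notin> \<Union>N"
      then show ?thesis using mixed uv by metis
    next
      assume "u \<notin> \<Union>N" "v \<in> \<Union>N"
      then show ?thesis using mixed uv by metis
    next
      assume n: "u \<notin> \<Union>N" "v \<notin> \<Union>N"
      obtain h where h: "h \<in> K" "u \<in> h" using uv n cover by auto
      obtain h' where h': "h' \<in> K" "v \<in> h'" using uv n cover by auto
      have eq: "\<phi>0 (att h) = \<phi>0 (att h')" "\<delta> h u = \<delta> h' v"
        using \<phi>K[OF h(1), of u] \<phi>K[OF h'(1), of v] h h' n uv(3) by auto
      have "att h = att h'" using inj0 eq(1) att_props[OF h(1)] att_props[OF h'(1)] by blast
      then have hh: "h = h'"
        using att_props[OF h(1)] att_props[OF h'(1)] h(1) h'(1) disjK by (metis disjnt_iff pairwiseD)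
      have "inj_on (\<delta> h) (h - \<Union>N)" using \<delta>[OF h(1)] by (simp add: bij_betw_def)
      then show ?thesis using eq(2) h h' n hh by (auto dest: inj_onD)
    qed
  qed
  have img1: "\<phi>0 ` in1 = InE1 ` {..<k - 2}"
  proof -
    have "\<phi>0 ` in1 = InE1 ` \<beta>1 ` in1" unfolding image_image using p_1 by (intro image_cong) auto
    then show ?thesis using \<beta>1(1) by (simp add: bij_betw_def)
  qed
  have img2: "\<phi>0 ` in2 = InE2 ` {..<k - 2}"
  proof -
    have "\<phi>0 ` in2 = InE2 ` \<beta>2 ` in2" unfolding image_image using p_in2 by (intro image_cong) auto
    then show ?thesis using \<beta>2(1) by (simp add: bij_betw_def)
  qed
  have imgb: "\<phi>0 ` (b - {r}) = New V1 (\<beta> b) ` {..<k - 1}" if b: "b \<in> branches" for b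
  proof -
    have "\<phi>0 ` (b - {r}) = New V1 (\<beta> b) ` \<gamma> b ` (b - {r})" unfolding image_image using p_b[OF b] by (intro image_cong) auto
    then show ?thesis using \<gamma>[OF b] by (simp add: bij_betw_def)
  qed
  have \<phi>e: "\<phi> ` e = \<phi>0 ` e" if "e \<in> N" for e using that \<phi>N by (intro image_cong) auto
  have E1: "\<phi> ` e1 = {V1, V2} \<union> InE1 ` {..<k - 2}"
  proof -
    have "e1 = insert r (insert v2 in1)" using rN[OF e1N] v2e by auto
    then have "\<phi>0 ` e1 = insert (\<phi>0 r) (insert (\<phi>0 v2) (\<phi>0 ` in1))" by (metis image_insert)
    then show ?thesis using \<phi>e[OF e1N] img1 p_r p_2 by auto
  qed
  have E2: "\<phi> ` e2 = {V1, V2} \<union> InE2 ` {..<k - 2}"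
  proof -
    have "e2 = insert r (insert v2 in2)" using rN[OF e2N] v2e by auto
    then have "\<phi>0 ` e2 = insert (\<phi>0 r) (insert (\<phi>0 v2) (\<phi>0 ` in2))" by (metis image_insert)
    then show ?thesis using \<phi>e[OF e2N] img2 p_r p_2 by auto
  qed
  have EB: "\<phi> ` b = new_edge k V1 (\<beta> b)" if b: "b \<in> branches" for b
  proof -
    have "b = insert r (b - {r})" using rN b by auto
    then have "\<phi>0 ` b = insert (\<phi>0 r) (\<phi>0 ` (b - {r}))" by (metis image_insert)
    then show ?thesis using \<phi>e[of b] b imgb[OF b] p_r by (simp add: new_edge_def)
  qed
  have EK: "\<phi> ` h = new_edge k (\<phi>0 (att h)) 0" if h: "h \<in> K" for h
  proof -
    have "h = insert (att h) (h - \<Union>N)" using att[OF h] by blast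
    then have "\<phi> ` h = insert (\<phi> (att h)) (\<phi> ` (h - \<Union>N))" by (metis image_insert)
    moreover have "\<phi> ` (h - \<Union>N) = New (\<phi>0 (att h)) 0 ` \<delta> h ` (h - \<Union>N)"
      unfolding image_image using \<phi>K[OF h] by (intro image_cong) auto
    moreover have "\<delta> h ` (h - \<Union>N) = {..<k - 1}" using \<delta>[OF h] by (simp add: bij_betw_def)
    ultimately show ?thesis using \<phi>N att_props[OF h] by (simp add: new_edge_def)
  qed
  have attA: "att ` K = ?A"
  proof
    show "att ` K \<subseteq> ?A" using att_props by blast
    show "?A \<subseteq> att ` K"
    proof
      fix v assume "v \<in> ?A"
      then obtain h where h: "h \<in> K" "v \<in> h" "v \<in> \<Union>N" by auto
      then have "v \<in> {att h}" using att[OF h(1)] by blast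
      then show "v \<in> att ` K" using h by auto
    qed
  qed
  have A_split: "?A = (?A \<inter> {v2}) \<union> (?A \<inter> in1) \<union> (?A \<inter> in2) \<union> (\<Union>b\<in>branches. ?A \<inter> b)"
    using attachments(1) UN_cells by blast
  have A2: "\<phi>0 ` (?A \<inter> {v2}) = {u. u = V2 \<and> card (?A \<inter> {v2}) = 1}"
    using p_2 by (cases "v2 \<in> ?A") auto
  have A1: "\<phi>0 ` (?A \<inter> in1) = InE1 ` {..<card (?A \<inter> in1)}"
  proof -
    have "\<phi>0 ` (?A \<inter> in1) = InE1 ` \<beta>1 ` (?A \<inter> in1)" unfolding image_image using p_1 by (intro image_cong) auto
    then show ?thesis using \<beta>1(2) by simp
  qed
  have A3: "\<phi>0 ` (?A \<inter> in2) = InE2 ` {..<card (?A \<inter> in2)}"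
  proof -
    have "\<phi>0 ` (?A \<inter> in2) = InE2 ` \<beta>2 ` (?A \<inter> in2)" unfolding image_image using p_in2 by (intro image_cong) auto
    then show ?thesis using \<beta>2(2) by simp
  qed
  have A4: "\<phi>0 ` (?A \<inter> b) = New V1 (\<beta> b) ` {..<L (\<beta> b)}" if b: "b \<in> branches" for b
  proof -
    have "\<phi>0 v = New V1 (\<beta> b) (\<gamma> b v)" if "v \<in> ?A \<inter> b" for v
      using that rA by (intro p_b[OF b]) auto
    then have "\<phi>0 ` (?A \<inter> b) = New V1 (\<beta> b) ` \<gamma> b ` (?A \<inter> b)"
      unfolding image_image by (intro image_cong) auto
    then show ?thesis using \<gamma>[OF b] by simp
  qed
  have A5: "\<phi>0 ` (\<Union>b\<in>branches. ?A \<inter> b) = (\<Union>a<Q. New V1 a ` {..<L a})"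
  proof -
    have "\<phi>0 ` (\<Union>b\<in>branches. ?A \<inter> b) = (\<Union>b\<in>branches. New V1 (\<beta> b) ` {..<L (\<beta> b)})"
      unfolding image_UN using A4 by (intro SUP_cong) auto
    also have "\<dots> = (\<Union>a\<in>\<beta> ` branches. New V1 a ` {..<L a})" by simp
    also have "\<beta> ` branches = {..<Q}" using \<beta> by (simp add: bij_betw_def)
    finally show ?thesis .
  qed
  have "\<phi>0 ` ?A = \<phi>0 ` ((?A \<inter> {v2}) \<union> (?A \<inter> in1) \<union> (?A \<inter> in2) \<union> (\<Union>b\<in>branches. ?A \<inter> b))"
    using A_split by (rule arg_cong)
  also have "\<dots> = std_attachments Q (card (?A \<inter> {v2})) (card (?A \<inter> in1)) (card (?A \<inter> in2)) L"
    unfolding image_Un A1 A2 A3 A5 std_attachments_def ..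
  finally have A: "\<phi>0 ` ?A = std_attachments Q (card (?A \<inter> {v2})) (card (?A \<inter> in1)) (card (?A \<inter> in2)) L" .
  have N: "N = {e1, e2} \<union> branches" using e1N e2N by auto
  have "(`) \<phi> ` branches = new_edge k V1 ` {..<Q}"
  proof -
    have "(`) \<phi> ` branches = new_edge k V1 ` \<beta> ` branches"
      unfolding image_image using EB by (intro image_cong) auto
    then show ?thesis using \<beta> by (simp add: bij_betw_def)
  qed
  moreover have "(`) \<phi> ` K = (\<lambda>u. new_edge k u 0) ` \<phi>0 ` att ` K"
    unfolding image_image using EK by (intro image_cong) auto
  moreover have "(`) \<phi> ` (N \<union> K) = {\<phi> ` e1, \<phi> ` e2} \<union> (`) \<phi> ` branches \<union> (`) \<phi> ` K"
    using e1N e2N by auto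
  ultimately have "(`) \<phi> ` (N \<union> K) = std_edges k Q (std_attachments Q (card (?A \<inter> {v2}))
      (card (?A \<inter> in1)) (card (?A \<inter> in2)) L)"
    unfolding E1 E2 attA A std_edges_def by simp
  then show ?thesis using that inj by blast
qed

end

lemma U_edges_std:
  assumes k: "k \<ge> 3" and f: "f \<le> 1" and w: "w \<le> k - 2" and c: "c = (if w = 0 then 0 else 1)"
    and Q: "Q = t + c + (n div (k - 1) - (f + i + j + t + t * (k - 1) + w + c + 2))"
    and L: "\<And>a. L a = (if a < t then k - 1 else if a = t then w else 0)"
  shows "U_edges n k f i j t w = std_edges k Q (std_attachments Q f i j L)"
proof -
  \<comment> \<open>For \<open>0 < w \<le> k - 2\<close> the quotient lies strictly between 0 and
    1.\<close>
  have ceil: "nat \<lceil>real w / real (k - 1)\<rceil> = c"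
  proof (cases "w = 0")
    case False
    have "\<lceil>real w / real (k - 1)\<rceil> = 1"
      using False w k by (intro ceiling_unique) (auto simp: field_simps)
    then show ?thesis using False c by simp
  qed (use c in simp)
  have tQ: "t \<le> Q" "w > 0 \<Longrightarrow> t < Q" using Q c by auto
  have f2: "{new_edge k V2 j |j. j < f} = (\<lambda>u. new_edge k u 0) ` {u. u = V2 \<and> f = 1}"
    using f by (cases f) auto
  have br: "{new_edge k (New V1 j i) 0 |j i. j < t \<and> i < k - 1} \<union> {new_edge k (New V1 t i) 0 |i. i < w}
      = (\<lambda>u. new_edge k u 0) ` (\<Union>a<Q. New V1 a ` {..<L a})"
  proof (intro equalityI subsetI)
    fix e assume "e \<in> {new_edge k (New V1 j i) 0 |j i. j < t \<and> i < k - 1} \<union> {new_edge k (New V1 t i) 0 |i. i < w}"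
    then consider a y where "e = new_edge k (New V1 a y) 0" "a < t" "y < k - 1"
      | y where "e = new_edge k (New V1 t y) 0" "y < w" by auto
    then show "e \<in> (\<lambda>u. new_edge k u 0) ` (\<Union>a<Q. New V1 a ` {..<L a})"
    proof cases
      case 1
      then have "New V1 a y \<in> (\<Union>a<Q. New V1 a ` {..<L a})" using tQ L by auto
      then show ?thesis using 1 by blast
    next
      case 2
      then have "New V1 t y \<in> (\<Union>a<Q. New V1 a ` {..<L a})" using tQ L by auto
      then show ?thesis using 2 by blast
    qed
  next
    fix e assume "e \<in> (\<lambda>u. new_edge k u 0) ` (\<Union>a<Q. New V1 a ` {..<L a})"
    then obtain a y where "e = new_edge k (New V1 a y) 0" "a < Q" "y < L a" by auto
    then show "e \<in> {new_edge k (New V1 j i) 0 |j i. j < t \<and> i < k - 1} \<union> {new_edge k (New V1 t i) 0 |i. i < w}"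
      using L[of a] by (auto split: if_splits)
  qed
  have st: "{new_edge k V1 j |j. j < t} \<union> {new_edge k V1 j |j. t \<le> j \<and> j < t + c} \<union>
     {new_edge k V1 j |j. t + c \<le> j \<and> j < Q} = new_edge k V1 ` {..<Q}"
    using tQ Q by (auto simp: image_iff) (metis not_le)
  have i1: "{new_edge k (InE1 i') 0 |i'. i' < i} = (\<lambda>u. new_edge k u 0) ` InE1 ` {..<i}"
    and i2: "{new_edge k (InE2 i') 0 |i'. i' < j} = (\<lambda>u. new_edge k u 0) ` InE2 ` {..<j}" by auto
  have "U_edges n k f i j t w = {{V1, V2} \<union> InE1 ` {..<k - 2}, {V1, V2} \<union> InE2 ` {..<k - 2}}
     \<union> ({new_edge k V1 j |j. j < t} \<union> {new_edge k V1 j |j. t \<le> j \<and> j < t + c} \<union>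
     {new_edge k V1 j |j. t + c \<le> j \<and> j < Q}) \<union>
     ({new_edge k V2 j |j. j < f} \<union> {new_edge k (InE1 i') 0 |i'. i' < i} \<union> {new_edge k (InE2 i') 0 |i'. i' < j}
      \<union> ({new_edge k (New V1 j i) 0 |j i. j < t \<and> i < k - 1} \<union> {new_edge k (New V1 t i) 0 |i. i < w}))"
    unfolding U_edges_def Let_def ceil Q by (simp only: Un_ac)
  then show ?thesis
    unfolding st f2 i1 i2 br std_edges_def std_attachments_def image_Un .
qed

section \<open>The extremal hypergraphs\<close>


text \<open>At most one branch is neither full nor empty. Here \<open>t\<close> is the number of
  full branches and \<open>w\<close> the size of the partial one, or 0 if there is none.\<close>

lemma enumerate_branches:
  fixes l :: "'b \<Rightarrow> nat"
  assumes B: "finite B" and k: "k \<ge> 3" and le: "\<And>b. b \<in> B \<Longrightarrow> l b \<le> k - 1"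
    and partial: "\<And>b b'. b \<in> B \<Longrightarrow> b' \<in> B \<Longrightarrow> 0 < l b \<Longrightarrow> l b < k - 1 \<Longrightarrow> 0 < l b' \<Longrightarrow>
      l b' < k - 1 \<Longrightarrow> b = b'"
  obtains \<beta> t w where "bij_betw \<beta> B {..<card B}" "w \<le> k - 2" "sum l B = t * (k - 1) + w"
    "t + (if w = 0 then 0 else 1) \<le> card B"
    "\<And>b. b \<in> B \<Longrightarrow> (if \<beta> b < t then k - 1 else if \<beta> b = t then w else 0) = l b"
proof -
  define F where "F = {b \<in> B. l b = k - 1}"
  define S where "S = {b \<in> B. l b \<noteq> 0}"
  have FS: "F \<subseteq> S" and SB: "S \<subseteq> B" using k by (auto simp: F_def S_def)
  have fin: "finite F" "finite S" using FS SB B by (auto intro: finite_subset)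
  obtain \<beta> where \<beta>: "bij_betw \<beta> B {..<card B}" "\<beta> ` S = {..<card S}" "\<beta> ` F = {..<card F}"
    using ex_bij_prefix2[OF B SB FS] by blast
  have inj: "inj_on \<beta> B" using \<beta>(1) by (simp add: bij_betw_def)
  have memF: "\<beta> b < card F \<longleftrightarrow> b \<in> F" if "b \<in> B" for b
    using \<beta>(3) inj that FS SB by (metis (no_types, lifting) inj_on_image_mem_iff lessThan_iff subset_trans)
  have memS: "\<beta> b < card S \<longleftrightarrow> b \<in> S" if "b \<in> B" for b
    using \<beta>(2) inj that SB by (metis (no_types, lifting) inj_on_image_mem_iff lessThan_iff)
  have sumS: "sum l B = sum l S"
    using SB B by (intro sum.mono_neutral_right) (auto simp: S_def)
  have sumF: "sum l S = sum l (S - F) + card F * (k - 1)"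
    using sum.subset_diff[OF FS fin(2), of l] by (simp add: F_def)
  have part: "0 < l b \<and> l b < k - 1 \<and> b \<in> B" if "b \<in> S - F" for b
    using that le[of b] by (auto simp: S_def F_def)
  have cS: "card S = card F + card (S - F)"
    using fin FS by (simp add: card_Diff_subset card_mono)
  have cB: "card S \<le> card B" using SB B by (rule card_mono[rotated])
  show ?thesis
  proof (cases "S - F = {}")
    case True
    then have SF: "S = F" using FS by auto
    show ?thesis
    proof (rule that[of \<beta> 0 "card F"])
      show "sum l B = card F * (k - 1) + 0" using sumS sumF True by simp
      show "card F + (if (0::nat) = 0 then 0 else 1) \<le> card B" using cB SF by simp
      show "(if \<beta> b < card F then k - 1 else if \<beta> b = card F then 0 else 0) = l b" if b: "b \<in> B" for b
      proof (cases "b \<in> F")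
        case True
        then show ?thesis using memF[OF b] by (simp add: F_def)
      next
        case False
        then have "l b = 0" using SF b by (auto simp: S_def)
        then show ?thesis using memF[OF b] False by simp
      qed
    qed (use \<beta> in auto)
  next
    case False
    then obtain p where p: "p \<in> S - F" by auto
    have SFp: "S - F = {p}"
    proof (intro equalityI subsetI)
      fix b assume b: "b \<in> S - F"
      show "b \<in> {p}" using partial[of b p] part[OF b] part[OF p] by simp
    next
      fix b assume "b \<in> {p}"
      then show "b \<in> S - F" using p by simp
    qed
    have cS1: "card S = card F + 1" using cS SFp by simp
    show ?thesis
    proof (rule that[of \<beta> "l p" "card F"])
      show "l p \<le> k - 2" using part[OF p] by linarith
      show "sum l B = card F * (k - 1) + l p" using sumS sumF SFp by simp
      show "card F + (if l p = 0 then 0 else 1) \<le> card B" using cB cS1 by simp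
      show "(if \<beta> b < card F then k - 1 else if \<beta> b = card F then l p else 0) = l b" if b: "b \<in> B" for b
      proof -
        consider "b \<in> F" | "b = p" | "b \<notin> S" using SFp by (metis DiffI singletonD)
        then show ?thesis
        proof cases
          case 1
          then show ?thesis using memF[OF b] by (simp add: F_def)
        next
          case 2
          then have "\<not> \<beta> b < card F" "\<beta> b < card S" using memF[OF b] memS[OF b] p by auto
          then show ?thesis using cS1 2 by simp
        next
          case 3
          then have "\<not> \<beta> b < card S" using memS[OF b] by simp
          then show ?thesis using cS1 3 b by (auto simp: S_def)
        qed
      qed
    qed (use \<beta> in auto)
  qed
qed

context extremal
begin

lemma iso_U:
  assumes tw: "twin_star k (verts G) N K r g v2 e1 e2" and E: "edges G = N \<union> K" and z: "card K + 1 = z"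
    and f: "f = card (\<Union>K \<inter> \<Union>N \<inter> {v2})" and i: "i = card (\<Union>K \<inter> \<Union>N \<inter> (e1 - {r, v2}))"
    and j: "j = card (\<Union>K \<inter> \<Union>N \<inter> (e2 - {r, v2}))"
    and \<beta>: "bij_betw \<beta> (N - {e1, e2}) {..<card (N - {e1, e2})}" and w: "w \<le> k - 2"
    and S: "(\<Sum>b\<in>N - {e1, e2}. card (\<Union>K \<inter> \<Union>N \<inter> b)) = t * (k - 1) + w"
    and tc: "t + (if w = 0 then 0 else 1) \<le> card (N - {e1, e2})"
    and L: "\<And>b. b \<in> N - {e1, e2} \<Longrightarrow>
      (if \<beta> b < t then k - 1 else if \<beta> b = t then w else 0) = card (\<Union>K \<inter> \<Union>N \<inter> b)"
  shows "hypergraph_iso G (U_hypergraph (card (verts G)) k f i j t w)"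
proof -
  interpret twin_star k "verts G" N K r g v2 e1 e2 by (rule tw)
  let ?Q = "card branches"
  define L where "L = (\<lambda>a. if a < t then k - 1 else if a = t then w else 0)"
  have L': "L (\<beta> b) = card (\<Union>K \<inter> \<Union>N \<inter> b)" if "b \<in> branches" for b
    using L[OF that] by (simp add: L_def)
  obtain \<phi> where \<phi>: "inj_on \<phi> (verts G)"
    "(`) \<phi> ` (N \<union> K) = std_edges k ?Q (std_attachments ?Q f i j L)"
    using iso_std[OF \<beta> L', folded f i j] by metis
  define c where "c = (if w = 0 then 0 else 1 :: nat)"
  have cN: "card N = ?Q + 2"
  proof -
    have "card branches = card N - card {e1, e2}" using finE e1N e2N by (intro card_Diff_subset) auto
    then show ?thesis using e12 card_N_ge by simp
  qed
  have nm: "card (verts G) div (k - 1) = card N + card K" using cardV card_E k3 by simp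
  have sumK: "f + i + j + (t * (k - 1) + w) = card K"
    using decompose(1)[OF attachments(1)] attachments(2) S by (simp add: f i j)
  have "f \<le> 1" using card_mono[of "{v2}" "\<Union>K \<inter> \<Union>N \<inter> {v2}"] by (auto simp: f)
  then have "U_edges (card (verts G)) k f i j t w = std_edges k ?Q (std_attachments ?Q f i j L)"
    using k3 w c_def
  proof (intro U_edges_std)
    \<comment> \<open>The number of edges is \<open>card N + card K\<close>, and
      \<open>card K\<close> is the number of attachments. The truncated difference is therefore
      exact and counts the empty branches.\<close>
    show "?Q = t + c + (card (verts G) div (k - 1) - (f + i + j + t + t * (k - 1) + w + c + 2))"
      unfolding nm cN using sumK tc by (simp add: c_def)
  qed (auto simp: L_def)
  then have eq: "(`) \<phi> ` edges G = U_edges (card (verts G)) k f i j t w" using \<phi>(2) E by simp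
  have "\<phi> ` verts G = \<Union>(U_edges (card (verts G)) k f i j t w)"
    unfolding eq[symmetric] by (subst verts_cover) auto
  then show ?thesis
    unfolding hypergraph_iso_def U_hypergraph_def using \<phi>(1) eq
    by (intro exI[of _ \<phi>]) (auto simp: bij_betw_def)
qed

text \<open>\<open>K\<close> has \<open>z - 1\<close> edges, and \<open>N\<close> contains both
  edges of the cycle.\<close>

lemma card_edges_ge: "card (edges G) \<ge> z + 1"
proof -
  obtain N K r g v2 e1 e2 where tw: "twin_star k (verts G) N K r g v2 e1 e2"
    and E: "edges G = N \<union> K" and z: "card K + 1 = z" using twin_structure by blast
  interpret twin_star k "verts G" N K r g v2 e1 e2 by (rule tw)
  show ?thesis using card_E card_N_ge E z by simp
qed

text \<open>Here \<open>N\<close> consists of the two cycle edges, and \<open>g\<close> is one of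
  them. It carries no edge of \<open>K\<close>, which also excludes \<open>v2\<close>; all
  \<open>z - 1\<close> pendant edges sit on the other one.\<close>

lemma iso_minimal:
  assumes m: "card (edges G) = z + 1"
  shows "hypergraph_iso G (U_hypergraph (card (verts G)) k 0 0 (z - 1) 0 0)"
proof -
  obtain N K r g v2 e1' e2' where tw': "twin_star k (verts G) N K r g v2 e1' e2'"
    and E: "edges G = N \<union> K" and z: "card K + 1 = z" using twin_structure by blast
  obtain e1 e2 where tw: "twin_star k (verts G) N K r g v2 e1 e2" and g: "g = e1" and Ne: "N - {e1, e2} = {}"
  proof -
    interpret T: twin_star k "verts G" N K r g v2 e1' e2' by (rule tw')
    have "card N = 2" using T.card_E E m z by simp
    then have "{e1', e2'} = N"
      using T.finE T.e1N T.e2N T.e12 by (intro card_subset_eq) auto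
    then have "g = e1' \<or> g = e2'" "N - {e1', e2'} = {}" "N - {e2', e1'} = {}" using T.gN by auto
    then show ?thesis using that tw' T.swap by blast
  qed
  interpret twin_star k "verts G" N K r g v2 e1 e2 by (rule tw)
  have A: "\<Union>K \<inter> \<Union>N \<inter> e1 = {}" using gK g by (auto simp: disjnt_iff)
  note d = decompose[OF attachments(1)]
  have 0: "card (\<Union>K \<inter> \<Union>N \<inter> {v2}) = 0" "card (\<Union>K \<inter> \<Union>N \<inter> in1) = 0"
    using d(2) A by auto
  have j: "card (\<Union>K \<inter> \<Union>N \<inter> in2) = z - 1"
    using d(1) attachments(2) 0 Ne z by simp
  have bij: "bij_betw (\<lambda>_. 0) branches {..<card branches}" unfolding Ne by (simp add: bij_betw_def)
  have s: "(\<Sum>b\<in>branches. card (\<Union>K \<inter> \<Union>N \<inter> b)) = 0 * (k - 1) + 0" unfolding Ne by simp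
  show ?thesis
    by (rule iso_U[OF tw E z 0(1)[symmetric] 0(2)[symmetric] j[symmetric] bij _ s]) (use Ne in auto)
qed

text \<open>The number of pendant edges on the branches is \<open>s\<close>. With at most one
  partial branch, the quotient and remainder of \<open>s\<close> modulo \<open>k - 1\<close>
  describe the branches. The conditions encode the filling order \<open>v2\<close>,
  \<open>e1\<close>, \<open>e2\<close>, branches, so that \<open>z\<close> determines all
  parameters.\<close>

lemma iso_general:
  assumes m: "card (edges G) \<ge> z + 2"
  shows "\<exists>f i j s. hypergraph_iso G (U_hypergraph (card (verts G)) k f i j (s div (k - 1)) (s mod (k - 1))) \<and>
    f + i + j + s = z - 1 \<and> f \<le> 1 \<and> (z \<ge> 2 \<longrightarrow> f = 1) \<and> i \<le> k - 2 \<and> j \<le> k - 2 \<and>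
    (j = 0 \<or> i = k - 2) \<and> (s = 0 \<or> (i = k - 2 \<and> j = k - 2))"
proof -
  obtain N K r g v2 e1' e2' where tw': "twin_star k (verts G) N K r g v2 e1' e2'"
    and E: "edges G = N \<union> K" and z: "card K + 1 = z" using twin_structure by blast
  obtain e1 e2 where tw: "twin_star k (verts G) N K r g v2 e1 e2"
    and ord: "card (\<Union>K \<inter> \<Union>N \<inter> (e2 - {r, v2})) \<le> card (\<Union>K \<inter> \<Union>N \<inter> (e1 - {r, v2}))"
  proof -
    interpret T: twin_star k "verts G" N K r g v2 e1' e2' by (rule tw')
    show ?thesis using that[OF tw'] that[OF T.swap] by linarith
  qed
  interpret twin_star k "verts G" N K r g v2 e1 e2 by (rule tw)
  let ?A = "\<Union>K \<inter> \<Union>N"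
  have cB: "card branches = card N - 2"
  proof -
    have "card branches = card N - card {e1, e2}" using finE e1N e2N by (intro card_Diff_subset) auto
    then show ?thesis using e12 by simp
  qed
  then have ne: "branches \<noteq> {}" using card_E E m z by (intro notI) simp
  let ?f = "card (?A \<inter> {v2})" and ?i = "card (?A \<inter> in1)" and ?j = "card (?A \<inter> in2)"
  let ?l = "\<lambda>b. card (?A \<inter> b)"
  obtain c where cfg: "config k (card K) c branches ?f ?i ?j ?l"
    using config_structure[OF tw E z ne ord] by blast
  interpret C: config k "card K" c branches ?f ?i ?j ?l by (rule cfg)
  obtain \<beta> t w where en: "bij_betw \<beta> branches {..<card branches}" "w \<le> k - 2"
    "sum ?l branches = t * (k - 1) + w" "t + (if w = 0 then 0 else 1) \<le> card branches"
    "\<And>b. b \<in> branches \<Longrightarrow> (if \<beta> b < t then k - 1 else if \<beta> b = t then w else 0) = ?l b"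
  proof (rule enumerate_branches[of branches k ?l])
    show "finite branches" by (rule C.finB)
    show "3 \<le> k" by (rule k3)
    show "\<And>b. b \<in> branches \<Longrightarrow> ?l b \<le> k - 1" by (rule C.bounds(4))
    show "\<And>b b'. b \<in> branches \<Longrightarrow> b' \<in> branches \<Longrightarrow> 0 < ?l b \<Longrightarrow> ?l b < k - 1 \<Longrightarrow> 0 < ?l b' \<Longrightarrow>
      ?l b' < k - 1 \<Longrightarrow> b = b'" by (rule C.one_partial)
  qed (rule that)
  have wk: "w < k - 1" using en(2) k3 by simp
  then have tw_eq: "sum ?l branches div (k - 1) = t" "sum ?l branches mod (k - 1) = w"
    unfolding en(3) by auto
  show ?thesis
  proof (intro exI conjI)
    show "hypergraph_iso G (U_hypergraph (card (verts G)) k ?f ?i ?j (sum ?l branches div (k - 1)) (sum ?l branches mod (k - 1)))"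
      unfolding tw_eq by (rule iso_U[OF tw E z refl refl refl en])
    show "?f + ?i + ?j + sum ?l branches = z - 1" using C.total z by simp
    show "z \<ge> 2 \<longrightarrow> ?f = 1" using C.f_one z by simp
    show "?f \<le> 1" "?i \<le> k - 2" "?j \<le> k - 2" by (rule C.bounds)+
    show "?j = 0 \<or> ?i = k - 2" by (rule C.first_full)
    show "sum ?l branches = 0 \<or> (?i = k - 2 \<and> ?j = k - 2)"
    proof (cases "\<exists>b\<in>branches. ?l b \<noteq> 0")
      case True
      then show ?thesis using C.branches_last by blast
    next
      case False
      then have "sum ?l branches = 0" by (intro sum.neutral) blast
      then show ?thesis ..
    qed
  qed
qed

end

theorem theorem1p4:
  fixes k n z m :: nat and G :: "'a hypergraph" and HH :: "'a hypergraph set"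
  assumes "k \<ge> 3" and "z \<ge> 1"
    and "HH = {H. unicyclic k H \<and> card (verts H) = n \<and> matching_number H = z}"
    and "G \<in> HH"
    and "spectral_radius k G = Max (spectral_radius k ` HH)"
    and "m = card (edges G)"
  shows "m \<ge> z + 1 \<and>
    (m = z + 1 \<longrightarrow> hypergraph_iso G (U_hypergraph n k 0 0 (z - 1) 0 0)) \<and>
    (m \<ge> z + 2 \<and> 1 \<le> z \<and> z \<le> 2 \<longrightarrow> hypergraph_iso G (U_hypergraph n k (z - 1) 0 0 0 0)) \<and>
    (m \<ge> z + 2 \<and> 3 \<le> z \<and> z \<le> k \<longrightarrow> hypergraph_iso G (U_hypergraph n k 1 (z - 2) 0 0 0)) \<and>
    (m \<ge> z + 2 \<and> k + 1 \<le> z \<and> z \<le> 2 * k - 2 \<longrightarrow>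
       hypergraph_iso G (U_hypergraph n k 1 (k - 2) (z - k) 0 0)) \<and>
    (m \<ge> z + 2 \<and> 2 * k - 1 \<le> z \<and>
       int z \<le> int m - 2 - \<lceil>(real m - 2 * real k) / (real k - 1)\<rceil> \<longrightarrow>
       (let t = nat \<lfloor>(real z - 2 * real k + 2) / (real k - 1)\<rfloor>;
            w = z + 2 - 2 * k - t * (k - 1)
        in hypergraph_iso G (U_hypergraph n k 1 (k - 2) (k - 2) t w)))"
proof -
  have GH: "unicyclic k G" "card (verts G) = n" "matching_number G = z" using assms(3,4) by auto
  have k1: "k \<ge> 1" using assms(1) by simp
  have finV: "finite (verts G)" using GH(1) by (simp add: unicyclic_def uniform_hypergraph_def)
  \<comment> \<open>Without finiteness the value of \<open>Max\<close> would be unspecified.\<close>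
  have fin: "finite (spectral_radius k ` HH)"
    using assms(3) GH(2) by (intro finite_spectral_radii[OF k1 finV]) (auto simp: unicyclic_def)
  interpret extremal k z G
  proof
    fix H :: "'a hypergraph"
    assume "unicyclic k H" "verts H = verts G" "matching_number H = z"
    then have "H \<in> HH" using assms(3) GH(2) by simp
    then show "spectral_radius k H \<le> spectral_radius k G"
      unfolding assms(5) using fin by (intro Max_ge) auto
  qed (use assms GH in auto)
  note n = GH(2)
  have c1: "m = z + 1 \<longrightarrow> hypergraph_iso G (U_hypergraph n k 0 0 (z - 1) 0 0)"
    using iso_minimal unfolding n assms(6) by blast
  have gen: "\<exists>f i j s. hypergraph_iso G (U_hypergraph n k f i j (s div (k - 1)) (s mod (k - 1))) \<and>
    f + i + j + s = z - 1 \<and> f \<le> 1 \<and> (z \<ge> 2 \<longrightarrow> f = 1) \<and> i \<le> k - 2 \<and> j \<le> k - 2 \<and>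
    (j = 0 \<or> i = k - 2) \<and> (s = 0 \<or> (i = k - 2 \<and> j = k - 2))" if "m \<ge> z + 2"
    using iso_general[unfolded n] that unfolding assms(6) by simp
  have c2: "hypergraph_iso G (U_hypergraph n k (z - 1) 0 0 0 0)" if a: "m \<ge> z + 2" "1 \<le> z" "z \<le> 2"
  proof -
    obtain f i j s where s: "hypergraph_iso G (U_hypergraph n k f i j (s div (k - 1)) (s mod (k - 1)))"
      "f + i + j + s = z - 1" "f \<le> 1" "z \<ge> 2 \<longrightarrow> f = 1" using gen[OF a(1)] by blast
    \<comment> \<open>There is at most one pendant edge in \<open>K\<close>, and it is attached at
      \<open>v2\<close>.\<close>
    have "f = z - 1 \<and> i = 0 \<and> j = 0 \<and> s = 0" using s(2-4) a by linarith
    then show ?thesis using s(1) by simp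
  qed
  have c3: "hypergraph_iso G (U_hypergraph n k 1 (z - 2) 0 0 0)" if a: "m \<ge> z + 2" "3 \<le> z" "z \<le> k"
  proof -
    obtain f i j s where s: "hypergraph_iso G (U_hypergraph n k f i j (s div (k - 1)) (s mod (k - 1)))"
      "f + i + j + s = z - 1" "z \<ge> 2 \<longrightarrow> f = 1" "j = 0 \<or> i = k - 2" "s = 0 \<or> (i = k - 2 \<and> j = k - 2)"
      using gen[OF a(1)] by blast
    \<comment> \<open>A full \<open>e1\<close> together with \<open>v2\<close> holds
      \<open>k - 1 \<ge> z - 1\<close> pendant edges, so nothing is left for \<open>e2\<close> or
      the branches.\<close>
    have "f = 1 \<and> i = z - 2 \<and> j = 0 \<and> s = 0" using s(2-5) a assms(1) by auto
    then show ?thesis using s(1) by simp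
  qed
  have c4: "hypergraph_iso G (U_hypergraph n k 1 (k - 2) (z - k) 0 0)"
    if a: "m \<ge> z + 2" "k + 1 \<le> z" "z \<le> 2 * k - 2"
  proof -
    obtain f i j s where s: "hypergraph_iso G (U_hypergraph n k f i j (s div (k - 1)) (s mod (k - 1)))"
      "f + i + j + s = z - 1" "z \<ge> 2 \<longrightarrow> f = 1" "j = 0 \<or> i = k - 2" "s = 0 \<or> (i = k - 2 \<and> j = k - 2)"
      "i \<le> k - 2"
      using gen[OF a(1)] by blast
    \<comment> \<open>Now \<open>z - 1\<close> exceeds the capacity \<open>k - 1\<close> of
      \<open>v2\<close> and \<open>e1\<close>, but not the capacity \<open>2 k - 3\<close> of the
      whole cycle.\<close>
    have "f = 1 \<and> i = k - 2 \<and> j = z - k \<and> s = 0" using s(2-6) a assms(1) by auto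
    then show ?thesis using s(1) by simp
  qed
  have c5: "hypergraph_iso G (U_hypergraph n k 1 (k - 2) (k - 2) t w)"
    if a: "m \<ge> z + 2" "2 * k - 1 \<le> z" and t: "t = nat \<lfloor>(real z - 2 * real k + 2) / (real k - 1)\<rfloor>"
      and w: "w = z + 2 - 2 * k - t * (k - 1)" for t w
  proof -
    obtain f i j s where s: "hypergraph_iso G (U_hypergraph n k f i j (s div (k - 1)) (s mod (k - 1)))"
      "f + i + j + s = z - 1" "z \<ge> 2 \<longrightarrow> f = 1" "s = 0 \<or> (i = k - 2 \<and> j = k - 2)"
      "i \<le> k - 2" "j \<le> k - 2"
      using gen[OF a(1)] by blast
    \<comment> \<open>The cycle holds at most \<open>2 k - 3 < z - 1\<close> of the pendant edges.
      So the branches are used, the cycle is full, and \<open>s = z - 1 - (2 k - 3)\<close>.\<close>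
    have fs: "f = 1 \<and> i = k - 2 \<and> j = k - 2 \<and> s = z + 2 - 2 * k" using s(2-6) a assms(1) by auto
    have "(real z - 2 * real k + 2) / (real k - 1) = real s / real (k - 1)"
      using fs a assms(1) by (simp add: of_nat_diff)
    then have "t = s div (k - 1)" unfolding t by (simp add: floor_divide_of_nat_eq)
    moreover have "w = s mod (k - 1)"
      unfolding w calculation using fs by (simp add: minus_div_mult_eq_mod)
    ultimately show ?thesis using s(1) fs by simp
  qed
  show ?thesis
    using card_edges_ge c1 c2 c3 c4 c5 unfolding Let_def assms(6) by auto
qed

end
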